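(* For $B\geqslant 0$, let $\vec{B}=B\vec{u}_z$ be a constant uniform magnetic field in $\mathbb{R}^3$ directed along the unit vector $\vec{u}_z$. Let $e_0$ be the smallest eigenvalue of the Zeeman Hamiltonian $$H=\frac{1}{2}\left(-\mathrm{i}\vec\nabla+\frac{1}{2}\vec{r}\times\vec{B}\right)^2-\frac{1}{r}$$ acting on $\mathsf{L}^2(\mathbb{R}^3)$. Then $$\forall B\geqslant 0,\qquad e_0\leqslant -\frac{1}{2}+\frac{B}{2}.$$
   Context: Here $\vec r\in\mathbb{R}^3$ is the position variable, $r=\|\vec r\|$, and $H$ is the self-adjoint Hamiltonian of a hydrogen atom in a constant uniform magnetic field. *)

theory Defs
  imports "HOL-Analysis.Analysis"
begin

type_synonym wavefunction = "real^3 \<Rightarrow> complex"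

subsection \<open>Unbounded operators on the Hilbert space $L^2(R^3; C)$\<close>

text \<open>Elements of $L^2$ are represented by square-integrable Borel functions, equality in $L^2$
  being equality almost everywhere. An unbounded operator is represented by its graph, a set of
  pairs of such functions.\<close>

definition L2 :: "wavefunction set" where
  "L2 = {\<psi> \<in> borel_measurable lborel. integrable lborel (\<lambda>x. (cmod (\<psi> x))\<^sup>2)}"

definition L2_inner :: "wavefunction \<Rightarrow> wavefunction \<Rightarrow> complex" where
  "L2_inner \<phi> \<psi> = (LINT x|lborel. cnj (\<phi> x) * \<psi> x)"

definition adjoint_operator :: "(wavefunction \<times> wavefunction) set \<Rightarrow> (wavefunction \<times> wavefunction) set" where
  "adjoint_operator T =
     {(\<psi>, \<eta>). \<psi> \<in> L2 \<and> \<eta> \<in> L2 \<and> (\<forall>(f, g) \<in> T. L2_inner \<psi> g = L2_inner \<eta> f)}"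

definition eigenvalue :: "(wavefunction \<times> wavefunction) set \<Rightarrow> complex \<Rightarrow> bool" where
  "eigenvalue T \<mu> \<longleftrightarrow>
     (\<exists>(\<psi>, \<eta>) \<in> T. \<not> (AE x in lborel. \<psi> x = 0) \<and> (AE x in lborel. \<eta> x = \<mu> * \<psi> x))"

definition smallest_eigenvalue :: "(wavefunction \<times> wavefunction) set \<Rightarrow> real \<Rightarrow> bool" where
  "smallest_eigenvalue T e \<longleftrightarrow>
     eigenvalue T (complex_of_real e) \<and> (\<forall>e'. eigenvalue T (complex_of_real e') \<longrightarrow> e \<le> e')"

subsection \<open>Test functions\<close>

definition partial_deriv :: "3 \<Rightarrow> wavefunction \<Rightarrow> wavefunction" where
  "partial_deriv j f x = frechet_derivative f (at x) (axis j 1)"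

primrec times_cont_diff :: "nat \<Rightarrow> wavefunction \<Rightarrow> bool" where
  "times_cont_diff 0 f \<longleftrightarrow> continuous_on UNIV f"
| "times_cont_diff (Suc k) f \<longleftrightarrow>
     (\<forall>x. f differentiable (at x)) \<and> (\<forall>j. times_cont_diff k (partial_deriv j f))"

definition test_functions :: "wavefunction set" where
  "test_functions = {f. (\<forall>k. times_cont_diff k f) \<and> compact (closure {x. f x \<noteq> 0})}"

subsection \<open>The Zeeman Hamiltonian\<close>

definition kinetic_momentum :: "real^3 \<Rightarrow> 3 \<Rightarrow> wavefunction \<Rightarrow> wavefunction" where
  "kinetic_momentum Bv j \<psi> x =
     - \<i> * partial_deriv j \<psi> x + complex_of_real (((1/2) *\<^sub>R cross3 x Bv) $ j) * \<psi> x"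

definition zeeman_expression :: "real^3 \<Rightarrow> wavefunction \<Rightarrow> wavefunction" where
  "zeeman_expression Bv \<psi> x =
     (1/2) * (\<Sum>j\<in>UNIV. kinetic_momentum Bv j (kinetic_momentum Bv j \<psi>) x)
       - complex_of_real (1 / norm x) * \<psi> x"

text \<open>The differential expression is essentially self-adjoint on the smooth compactly supported
  functions (the potential $-1/r$ is in $L^2 + L^\infty$ and the vector potential is linear), so
  its unique self-adjoint realization is the adjoint of its restriction to these functions.
  Concretely, the domain consists of all $\psi$ in $L^2$ for which $H \psi$, taken in the
  distributional sense, is again in $L^2$.\<close>

definition zeeman_hamiltonian :: "real^3 \<Rightarrow> (wavefunction \<times> wavefunction) set" where
  "zeeman_hamiltonian Bv =
     adjoint_operator {(f, zeeman_expression Bv f) | f. f \<in> test_functions}"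

end

theory Submission
  imports Defs "HOL-Complex_Analysis.Great_Picard"
begin

text \<open>Let \<open>e\<close> be the infimum of the energy \<open>\<langle>u, H u\<rangle>\<close> over normalized test functions \<open>u\<close>. The theorem
  follows from two facts: \<open>e \<le> - 1 / 2 + B / 2\<close> (\<open>energy_infimum_le\<close>), and \<open>e\<close> is an eigenvalue of \<open>H\<close>
  (\<open>ground_state_exists\<close>). A trial function alone would bound the bottom of the spectrum; the second
  fact makes the bound one on an eigenvalue.

  For the upper bound, let \<open>\<phi> = exp (- r - B \<rho>\<^sup>2 / 4)\<close>, where \<open>\<rho>\<close> is the distance from the field axis.
  This is the product of the ground state of hydrogen and a state of the lowest Landau level, and
  a direct computation gives \<open>H \<phi> = (- 1 / 2 + B / 2 - B \<rho>\<^sup>2 / (2 r)) \<phi>\<close>. So the local energy lies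
  at or below the claimed bound at every point away from the nucleus. The same holds with bound \<open>B / 2 - a\<^sup>2 / 2\<close> if \<open>r\<close> in the
  exponent is replaced by \<open>a \<surd>(r\<^sup>2 + \<epsilon>\<^sup>2)\<close>, where \<open>0 < a < 1\<close> and \<open>\<epsilon> = 2 (1 - a)\<close>: the weakened decay
  pays for the smoothing at the nucleus. The resulting smooth function is truncated at radius
  \<open>R\<close>, which costs energy of relative order \<open>1 / R\<^sup>2\<close> (\<open>trial_energy\<close>), and then \<open>R\<close> tends to infinity
  and \<open>a\<close> to 1.

  Existence of the ground state is shown by the direct method. Hardy's inequality (\<open>Hardy\<close>) makes
  the Coulomb energy small relative to the kinetic energy, so the energy is bounded below and a
  minimizing sequence has bounded kinetic energy. By Rellich's theorem (\<open>local_Rellich\<close>) a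
  subsequence converges in \<open>L\<^sup>2\<close> of every ball to some \<open>\<psi>\<close>. The Cauchy--Schwarz inequality for the
  nonnegative form \<open>\<langle>u, (H - e) u\<rangle>\<close> (\<open>weak_eigenvalue_equation_error\<close>) shows that
  \<open>\<langle>\<psi>, (H - e) g\<rangle> = 0\<close> for each test function \<open>g\<close>, which says that \<open>\<psi>\<close> lies in the domain of the
  adjoint and is mapped to \<open>e \<psi>\<close>. It remains to exclude \<open>\<psi> = 0\<close>. The kinetic energy is at least \<open>B / 2\<close>
  (\<open>Landau_lower_bound\<close>) while the total energy tends to \<open>e \<le> B / 2 - 1 / 2\<close>, so the Coulomb energy
  stays close to or above \<open>1 / 2\<close>. By \<open>coulomb_energy_split\<close> this keeps a fixed amount of mass in a
  bounded region, where the convergence is strong.\<close>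

section \<open>Calculus of smooth functions\<close>

definition smooth :: "wavefunction \<Rightarrow> bool" where
  "smooth f \<longleftrightarrow> (\<forall>k. times_cont_diff k f)"

lemma partial_deriv_eq:
  assumes "(f has_derivative f') (at x)"
  shows "partial_deriv j f x = f' (axis j 1)"
  unfolding partial_deriv_def using frechet_derivative_at[OF assms] by simp

lemma partial_deriv_const: "partial_deriv j (\<lambda>x. c) x = 0"
  by (subst partial_deriv_eq[where f' = "\<lambda>_. 0"]) auto

lemma partial_deriv_add:
  assumes "f differentiable (at x)" "g differentiable (at x)"
  shows "partial_deriv j (\<lambda>x. f x + g x) x = partial_deriv j f x + partial_deriv j g x"
proof -
  obtain f' g' where d: "(f has_derivative f') (at x)" "(g has_derivative g') (at x)"
    using assms unfolding differentiable_def by blast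
  show ?thesis
    using partial_deriv_eq[OF has_derivative_add[OF d]] partial_deriv_eq[OF d(1)] partial_deriv_eq[OF d(2)]
    by simp
qed

lemma partial_deriv_mult:
  assumes "f differentiable (at x)" "g differentiable (at x)"
  shows "partial_deriv j (\<lambda>x. f x * g x) x = partial_deriv j f x * g x + f x * partial_deriv j g x"
proof -
  obtain f' g' where d: "(f has_derivative f') (at x)" "(g has_derivative g') (at x)"
    using assms unfolding differentiable_def by blast
  show ?thesis
    using partial_deriv_eq[OF has_derivative_mult[OF d]] partial_deriv_eq[OF d(1)] partial_deriv_eq[OF d(2)]
    by simp
qed

lemma partial_deriv_cmult:
  assumes "f differentiable (at x)"
  shows "partial_deriv j (\<lambda>x. c * f x) x = c * partial_deriv j f x"
  using partial_deriv_mult[of "\<lambda>_. c" x f j] assms by (simp add: partial_deriv_const)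

lemma partial_deriv_cnj:
  assumes "f differentiable (at x)"
  shows "partial_deriv j (\<lambda>x. cnj (f x)) x = cnj (partial_deriv j f x)"
proof -
  obtain f' where d: "(f has_derivative f') (at x)"
    using assms unfolding differentiable_def by blast
  show ?thesis
    using partial_deriv_eq[OF has_derivative_cnj[OF d]] partial_deriv_eq[OF d] by simp
qed

lemma has_derivative_coord:
  "((\<lambda>x::real^3. complex_of_real (x $ i)) has_derivative (\<lambda>h. complex_of_real (h $ i))) (at x)"
  by (rule bounded_linear_imp_has_derivative)
    (rule bounded_linear_compose[OF bounded_linear_of_real bounded_linear_vec_nth])

lemma partial_deriv_coord:
  "partial_deriv j (\<lambda>x. complex_of_real (x $ i)) x = (if i = j then 1 else 0)"
  by (subst partial_deriv_eq[OF has_derivative_coord]) (simp add: axis_def)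

lemma differentiable_of_real_comp:
  fixes p :: "real^3 \<Rightarrow> real"
  shows "(\<lambda>x. complex_of_real (p x)) differentiable (at x) \<longleftrightarrow> p differentiable (at x)"
proof
  assume "(\<lambda>x. complex_of_real (p x)) differentiable (at x)"
  then obtain D where "((\<lambda>x. complex_of_real (p x)) has_derivative D) (at x)"
    unfolding differentiable_def by blast
  from bounded_linear.has_derivative[OF bounded_linear_Re this]
  show "p differentiable (at x)" unfolding differentiable_def by auto
next
  assume "p differentiable (at x)"
  then obtain D where "(p has_derivative D) (at x)"
    unfolding differentiable_def by blast
  from bounded_linear.has_derivative[OF bounded_linear_of_real this]
  show "(\<lambda>x. complex_of_real (p x)) differentiable (at x)" unfolding differentiable_def by auto
qed

lemma of_real_comp_chain:
  fixes p :: "real^3 \<Rightarrow> real"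
  assumes "(\<lambda>x. complex_of_real (p x)) differentiable (at x)"
    and h: "(h has_real_derivative h') (at (p x))"
  shows "(\<lambda>x. complex_of_real (h (p x))) differentiable (at x)"
    and "partial_deriv j (\<lambda>x. complex_of_real (h (p x))) x =
      complex_of_real h' * partial_deriv j (\<lambda>x. complex_of_real (p x)) x"
proof -
  obtain D where D: "(p has_derivative D) (at x)"
    using iffD1[OF differentiable_of_real_comp assms(1)] unfolding differentiable_def by blast
  have c: "((\<lambda>x. h (p x)) has_derivative (\<lambda>v. h' * D v)) (at x)"
    using has_derivative_compose[OF D] h unfolding has_field_derivative_def
    by blast
  have c': "((\<lambda>x. complex_of_real (h (p x))) has_derivative (\<lambda>v. complex_of_real (h' * D v))) (at x)"
    by (rule bounded_linear.has_derivative[OF bounded_linear_of_real c])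
  have D': "((\<lambda>x. complex_of_real (p x)) has_derivative (\<lambda>v. complex_of_real (D v))) (at x)"
    by (rule bounded_linear.has_derivative[OF bounded_linear_of_real D])
  show "(\<lambda>x. complex_of_real (h (p x))) differentiable (at x)"
    using c' unfolding differentiable_def by blast
  show "partial_deriv j (\<lambda>x. complex_of_real (h (p x))) x =
      complex_of_real h' * partial_deriv j (\<lambda>x. complex_of_real (p x)) x"
    unfolding partial_deriv_eq[OF c'] partial_deriv_eq[OF D'] by simp
qed

lemma times_cont_diff_SucD: "times_cont_diff (Suc k) f \<Longrightarrow> times_cont_diff k f"
proof (induction k arbitrary: f)
  case 0
  then show ?case
    by (simp add: differentiable_imp_continuous_on differentiable_on_def)
next
  case (Suc k)
  have "times_cont_diff k (partial_deriv j f)" for j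
    using Suc by simp
  with Suc.prems show ?case by simp
qed

lemma times_cont_diff_const: "times_cont_diff k (\<lambda>_. c)"
proof (induction k arbitrary: c)
  case (Suc k)
  have "partial_deriv j (\<lambda>_. c) = (\<lambda>_. 0)" for j
    by (rule ext) (rule partial_deriv_const)
  with Suc show ?case by simp
qed simp

lemma times_cont_diff_coord: "times_cont_diff k (\<lambda>x. complex_of_real (x $ i))"
proof (cases k)
  case 0
  then show ?thesis by (auto intro!: continuous_intros)
next
  case (Suc m)
  have "partial_deriv j (\<lambda>x. complex_of_real (x $ i)) = (\<lambda>_. if i = j then 1 else 0)" for j
    by (rule ext) (rule partial_deriv_coord)
  then show ?thesis
    using has_derivative_coord unfolding Suc
    by (auto simp: differentiable_def intro!: times_cont_diff_const)
qed

lemma times_cont_diff_add: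
  "times_cont_diff k f \<Longrightarrow> times_cont_diff k g \<Longrightarrow> times_cont_diff k (\<lambda>x. f x + g x)"
proof (induction k arbitrary: f g)
  case (Suc k)
  have "partial_deriv j (\<lambda>x. f x + g x) = (\<lambda>x. partial_deriv j f x + partial_deriv j g x)" for j
    using Suc.prems by (intro ext partial_deriv_add) auto
  with Suc show ?case by auto
qed (auto intro!: continuous_intros)

lemma times_cont_diff_mult:
  "times_cont_diff k f \<Longrightarrow> times_cont_diff k g \<Longrightarrow> times_cont_diff k (\<lambda>x. f x * g x)"
proof (induction k arbitrary: f g)
  case (Suc k)
  have "partial_deriv j (\<lambda>x. f x * g x) = (\<lambda>x. partial_deriv j f x * g x + f x * partial_deriv j g x)" for j
    using Suc.prems by (intro ext partial_deriv_mult) auto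
  moreover have "times_cont_diff k f" "times_cont_diff k g"
    using Suc.prems times_cont_diff_SucD by blast+
  ultimately show ?case using Suc
    by (auto intro!: times_cont_diff_add)
qed (auto intro!: continuous_intros)

lemma times_cont_diff_cnj:
  "times_cont_diff k f \<Longrightarrow> times_cont_diff k (\<lambda>x. cnj (f x))"
proof (induction k arbitrary: f)
  case (Suc k)
  have "partial_deriv j (\<lambda>x. cnj (f x)) = (\<lambda>x. cnj (partial_deriv j f x))" for j
    using Suc.prems by (intro ext partial_deriv_cnj) auto
  moreover have "(\<lambda>x. cnj (f x)) differentiable (at x)" for x
    using Suc.prems has_derivative_cnj unfolding times_cont_diff.simps differentiable_def by blast
  ultimately show ?case using Suc by auto
qed (auto intro!: continuous_intros)

lemma smooth_C1: "smooth f \<Longrightarrow> times_cont_diff (Suc 0) f"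
  by (simp add: smooth_def del: times_cont_diff.simps)

lemma smooth_differentiable: "smooth f \<Longrightarrow> f differentiable (at x)"
  using smooth_C1[of f] by simp

lemma smooth_continuous: "smooth f \<Longrightarrow> continuous_on UNIV f"
  unfolding smooth_def by (metis times_cont_diff.simps(1))

lemma smooth_partial_deriv: "smooth f \<Longrightarrow> smooth (partial_deriv j f)"
  unfolding smooth_def using times_cont_diff.simps(2) by blast

text \<open>The sequence \<open>H\<close> lists the successive derivatives of its first member, which allows the chain
  rule to be iterated. Derivatives are taken at the values of \<open>p\<close>, so that \<open>H\<close> may be singular
  elsewhere, as for reciprocals and square roots.\<close>

lemma times_cont_diff_of_real_comp:
  fixes p :: "real^3 \<Rightarrow> real" and H :: "nat \<Rightarrow> real \<Rightarrow> real"
  assumes p: "smooth (\<lambda>x. complex_of_real (p x))"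
    and H: "\<And>n x. (H n has_real_derivative H (Suc n) (p x)) (at (p x))"
  shows "times_cont_diff k (\<lambda>x. complex_of_real (H n (p x)))"
proof (induction k arbitrary: n)
  case 0
  have "(\<lambda>x. complex_of_real (p x)) differentiable (at x)" for x
    using p by (rule smooth_differentiable)
  then have "(\<lambda>x. complex_of_real (H n (p x))) differentiable (at x)" for x
    by (rule of_real_comp_chain(1)[OF _ H])
  then have "continuous_on UNIV (\<lambda>x. complex_of_real (H n (p x)))"
    by (intro differentiable_imp_continuous_on) (simp add: differentiable_on_def)
  then show ?case by (simp only: times_cont_diff.simps)
next
  case (Suc k)
  have d: "(\<lambda>x. complex_of_real (p x)) differentiable (at x)" for x
    using p by (rule smooth_differentiable)
  have "partial_deriv j (\<lambda>x. complex_of_real (H n (p x))) =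
      (\<lambda>x. complex_of_real (H (Suc n) (p x)) * partial_deriv j (\<lambda>x. complex_of_real (p x)) x)" for j
    by (rule ext) (rule of_real_comp_chain(2)[OF d H])
  moreover have "times_cont_diff k (partial_deriv j (\<lambda>x. complex_of_real (p x)))" for j
    using smooth_partial_deriv[OF p] unfolding smooth_def by blast
  ultimately show ?case
    using Suc of_real_comp_chain(1)[OF d H] by (simp add: times_cont_diff_mult)
qed

lemma smooth_const: "smooth (\<lambda>_. c)"
  and smooth_coord: "smooth (\<lambda>x. complex_of_real (x $ i))"
  and smooth_add: "smooth f \<Longrightarrow> smooth g \<Longrightarrow> smooth (\<lambda>x. f x + g x)"
  and smooth_mult: "smooth f \<Longrightarrow> smooth g \<Longrightarrow> smooth (\<lambda>x. f x * g x)"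
  and smooth_cnj: "smooth f \<Longrightarrow> smooth (\<lambda>x. cnj (f x))"
  unfolding smooth_def
  by (simp_all add: times_cont_diff_const times_cont_diff_coord times_cont_diff_add
      times_cont_diff_mult times_cont_diff_cnj)

lemma smooth_of_real_comp:
  fixes p :: "real^3 \<Rightarrow> real" and H :: "nat \<Rightarrow> real \<Rightarrow> real"
  assumes "smooth (\<lambda>x. complex_of_real (p x))"
    and "\<And>n x. (H n has_real_derivative H (Suc n) (p x)) (at (p x))"
  shows "smooth (\<lambda>x. complex_of_real (H n (p x)))"
proof -
  have "times_cont_diff k (\<lambda>x. complex_of_real (H n (p x)))" for k
    by (rule times_cont_diff_of_real_comp[where H = H and p = p]) (rule assms)+
  then show ?thesis unfolding smooth_def by blast
qed

lemma partial_deriv_vanishes: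
  assumes "\<And>x. norm x > R \<Longrightarrow> f x = 0" "norm x > R"
  shows "partial_deriv j f x = 0"
proof -
  have "open {x::real^3. norm x > R}"
    by (intro open_Collect_less continuous_intros)
  then have "(f has_derivative (\<lambda>_. 0)) (at x)"
    using assms by (intro has_derivative_transform_within_open[OF has_derivative_const]) auto
  from partial_deriv_eq[OF this] show ?thesis .
qed

lemma test_function_iff:
  "f \<in> test_functions \<longleftrightarrow> smooth f \<and> (\<exists>R. \<forall>x. norm x > R \<longrightarrow> f x = 0)"
proof -
  have "compact (closure {x. f x \<noteq> 0}) \<longleftrightarrow> bounded {x. f x \<noteq> 0}"
    by (simp add: compact_closure)
  also have "\<dots> \<longleftrightarrow> (\<exists>R. \<forall>x. norm x > R \<longrightarrow> f x = 0)"
    unfolding bounded_iff by (auto simp: not_less[symmetric])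
  finally show ?thesis unfolding test_functions_def smooth_def by blast
qed

section \<open>Integration by parts\<close>

lemma vanishing_imp_indicator:
  fixes f :: "real^3 \<Rightarrow> 'b::real_vector"
  assumes "\<And>x. norm x > R \<Longrightarrow> f x = 0"
  shows "(\<lambda>x. indicator (cball 0 R) x *\<^sub>R f x) = f"
  using assms by (auto simp: fun_eq_iff indicator_def not_le)

lemma integrable_compact_support:
  fixes f :: "real^3 \<Rightarrow> 'b::{banach, second_countable_topology}"
  assumes "continuous_on UNIV f" "\<And>x. norm x > R \<Longrightarrow> f x = 0"
  shows "integrable lborel f"
  using borel_integrable_compact[of "cball (0::real^3) R" f] assms
  by (simp add: vanishing_imp_indicator continuous_on_subset)

lemma bounded_compact_support:
  fixes f :: "real^3 \<Rightarrow> 'b::real_normed_vector"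
  assumes "continuous_on UNIV f" "\<And>x. norm x > R \<Longrightarrow> f x = 0"
  obtains L where "L \<ge> 0" "\<And>x. norm (f x) \<le> L"
proof -
  have "bounded (f ` cball 0 R)"
    using assms(1) by (intro compact_imp_bounded compact_continuous_image)
      (auto intro: continuous_on_subset)
  then obtain L where L: "\<And>x. x \<in> cball 0 R \<Longrightarrow> norm (f x) \<le> L"
    unfolding bounded_iff by blast
  have "norm (f x) \<le> max L 0" for x
    using L[of x] assms(2)[of x] by (cases "norm x \<le> R") auto
  then show ?thesis using that[of "max L 0"] by simp
qed

lemma integral_translation:
  fixes f :: "'a::euclidean_space \<Rightarrow> 'b::{banach, second_countable_topology}"
  assumes [measurable]: "f \<in> borel_measurable borel"
  shows "(LINT x|lborel. f (x + a)) = (LINT x|lborel. f x)"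
proof -
  have "(LINT x|lborel. f x) = (LINT x|distr lborel borel ((+) a). f x)"
    by (simp add: lborel_distr_plus)
  also have "\<dots> = (LINT x|lborel. f (x + a))"
    by (subst integral_distr) (auto simp: add.commute)
  finally show ?thesis by simp
qed

lemma nn_integral_translation:
  fixes f :: "'a::euclidean_space \<Rightarrow> ennreal"
  assumes [measurable]: "f \<in> borel_measurable borel"
  shows "(\<integral>\<^sup>+x. f (x + a) \<partial>lborel) = (\<integral>\<^sup>+x. f x \<partial>lborel)"
proof -
  have "(\<integral>\<^sup>+x. f x \<partial>lborel) = (\<integral>\<^sup>+x. f x \<partial>distr lborel borel ((+) a))"
    by (simp add: lborel_distr_plus)
  also have "\<dots> = (\<integral>\<^sup>+x. f (x + a) \<partial>lborel)"
    by (subst nn_integral_distr) (auto simp: add.commute)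
  finally show ?thesis by simp
qed

lemma has_vector_derivative_partial:
  assumes "f differentiable (at (x + t *\<^sub>R axis j 1))"
  shows "((\<lambda>t. f (x + t *\<^sub>R axis j 1)) has_vector_derivative
    partial_deriv j f (x + t *\<^sub>R axis j 1)) (at t)"
proof -
  let ?D = "frechet_derivative f (at (x + t *\<^sub>R axis j 1))"
  have D: "(f has_derivative ?D) (at (x + t *\<^sub>R axis j 1))"
    using assms frechet_derivative_works by blast
  have l: "((\<lambda>t. x + t *\<^sub>R axis j 1) has_derivative (\<lambda>s. s *\<^sub>R axis j 1)) (at t)"
    by (auto intro!: derivative_eq_intros)
  have "((\<lambda>t. f (x + t *\<^sub>R axis j 1)) has_derivative (\<lambda>s. ?D (s *\<^sub>R axis j 1))) (at t)"
    using has_derivative_compose[OF l D] .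
  moreover have "?D (s *\<^sub>R axis j 1) = s *\<^sub>R ?D (axis j 1)" for s
    using has_derivative_linear[OF D] by (simp add: linear_cmul)
  ultimately show ?thesis
    unfolding has_vector_derivative_def partial_deriv_def by simp
qed

text \<open>Difference quotients with the particular step \<open>1 / (n + 1)\<close> turn limits in the step into limits
  of sequences, to which dominated convergence applies.\<close>

definition diff_quotient :: "3 \<Rightarrow> nat \<Rightarrow> wavefunction \<Rightarrow> wavefunction" where
  "diff_quotient j n f x =
    complex_of_real (real (Suc n)) * (f (x + (1 / real (Suc n)) *\<^sub>R axis j 1) - f x)"

lemma diff_quotient_tendsto:
  assumes "f differentiable (at x)"
  shows "(\<lambda>n. diff_quotient j n f x) \<longlonglongrightarrow> partial_deriv j f x"
proof -
  let ?g = "\<lambda>t. f (x + t *\<^sub>R axis j 1)"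
  let ?d = "partial_deriv j f x"
  have "(?g has_vector_derivative ?d) (at 0)"
    using has_vector_derivative_partial[of f x 0 j] assms by simp
  then have "((\<lambda>h. norm (?g (0 + h) - ?g 0 - h *\<^sub>R ?d) / norm h) \<longlongrightarrow> 0) (at 0)"
    unfolding has_vector_derivative_def has_derivative_at by blast
  moreover have "filterlim (\<lambda>n. 1 / real (Suc n)) (at 0) sequentially"
    unfolding filterlim_at using LIMSEQ_inverse_real_of_nat by (simp add: inverse_eq_divide)
  ultimately have "(\<lambda>n. norm (?g (0 + 1 / real (Suc n)) - ?g 0 - (1 / real (Suc n)) *\<^sub>R ?d)
      / norm (1 / real (Suc n))) \<longlonglongrightarrow> 0"
    by (rule filterlim_compose)
  moreover have "norm (?g (0 + 1 / real (Suc n)) - ?g 0 - (1 / real (Suc n)) *\<^sub>R ?d)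
      / norm (1 / real (Suc n)) = norm (diff_quotient j n f x - ?d)" for n
  proof -
    have "diff_quotient j n f x - ?d = complex_of_real (real (Suc n)) *
        (?g (0 + 1 / real (Suc n)) - ?g 0 - (1 / real (Suc n)) *\<^sub>R ?d)"
      by (simp add: diff_quotient_def scaleR_conv_of_real right_diff_distrib del: of_nat_Suc)
    also have "norm \<dots> = real (Suc n) * norm (?g (0 + 1 / real (Suc n)) - ?g 0 - (1 / real (Suc n)) *\<^sub>R ?d)"
      by (simp only: norm_mult norm_of_real abs_of_nat)
    finally show ?thesis by (simp add: field_simps)
  qed
  ultimately show ?thesis
    by (simp add: tendsto_norm_zero_iff LIM_zero_iff)
qed

lemma lipschitz_along_axis:
  assumes d: "\<And>x. f differentiable (at x)" and L: "\<And>x. norm (partial_deriv j f x) \<le> L"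
  shows "norm (f (x + t *\<^sub>R axis j 1) - f x) \<le> L * \<bar>t\<bar>"
proof -
  have "norm (f (x + t *\<^sub>R axis j 1) - f (x + 0 *\<^sub>R axis j 1)) \<le> L * norm (t - 0)"
  proof (rule differentiable_bound[of UNIV "\<lambda>t. f (x + t *\<^sub>R axis j 1)"])
    fix s :: real
    show "((\<lambda>t. f (x + t *\<^sub>R axis j 1)) has_derivative
        (\<lambda>h. h *\<^sub>R partial_deriv j f (x + s *\<^sub>R axis j 1))) (at s)"
      using has_vector_derivative_partial[OF d] unfolding has_vector_derivative_def .
    show "onorm (\<lambda>h. h *\<^sub>R partial_deriv j f (x + s *\<^sub>R axis j 1)) \<le> L"
      using L[of "x + s *\<^sub>R axis j 1"]
      by (simp add: onorm_scaleR_left[OF bounded_linear_ident] onorm_id)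
  qed auto
  then show ?thesis by simp
qed

lemma diff_quotient_bound:
  assumes d: "\<And>x. f differentiable (at x)" and L: "\<And>x. norm (partial_deriv j f x) \<le> L"
    and R: "\<And>x. norm x > R \<Longrightarrow> f x = 0"
  shows "norm (diff_quotient j n f x) \<le> L * indicator (cball 0 (R + 1)) x"
proof (cases "norm x \<le> R + 1")
  case True
  have "norm (diff_quotient j n f x) \<le> real (Suc n) * (L * \<bar>1 / real (Suc n)\<bar>)"
    unfolding diff_quotient_def norm_mult norm_of_real abs_of_nat
    by (intro mult_left_mono lipschitz_along_axis d L) simp
  then show ?thesis using True by simp
next
  case False
  have "norm x \<le> norm (x + (1 / real (Suc n)) *\<^sub>R axis j 1) + norm ((1 / real (Suc n)) *\<^sub>R axis j (1::real))"
    using norm_triangle_ineq4[of "x + (1 / real (Suc n)) *\<^sub>R axis j 1" "(1 / real (Suc n)) *\<^sub>R axis j 1"] by simp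
  moreover have "norm ((1 / real (Suc n)) *\<^sub>R axis j (1::real) :: real^3) \<le> 1"
    by (simp add: norm_axis_1 field_simps)
  ultimately have "norm (x + (1 / real (Suc n)) *\<^sub>R axis j 1) > R" "norm x > R"
    using False by linarith+
  then have "diff_quotient j n f x = 0"
    unfolding diff_quotient_def by (simp only: R diff_self mult_zero_right)
  then show ?thesis using False by simp
qed

lemma diff_quotient_continuous:
  assumes "continuous_on UNIV f"
  shows "continuous_on UNIV (diff_quotient j n f)"
  unfolding diff_quotient_def
  by (intro continuous_intros assms continuous_on_compose2[OF assms]) auto

text \<open>The integral of each difference quotient vanishes by translation invariance, and the difference
  quotients converge dominatedly, being bounded by the Lipschitz constant on a fixed ball.\<close>

lemma integral_partial_deriv:
  assumes C1: "times_cont_diff (Suc 0) f" and R: "\<And>x. norm x > R \<Longrightarrow> f x = 0"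
  shows "integrable lborel (partial_deriv j f)" and "(LINT x|lborel. partial_deriv j f x) = 0"
proof -
  have d: "\<And>x. f differentiable (at x)" and c: "continuous_on UNIV (partial_deriv j f)"
    using C1 by simp_all
  have cf: "continuous_on UNIV f"
    using times_cont_diff_SucD[OF C1] by simp
  show "integrable lborel (partial_deriv j f)"
    by (rule integrable_compact_support[OF c partial_deriv_vanishes[OF R]])
  obtain L where L: "L \<ge> 0" "\<And>x. norm (partial_deriv j f x) \<le> L"
    by (rule bounded_compact_support[OF c, of R]) (auto intro: partial_deriv_vanishes[OF R])
  have int: "integrable lborel f"
    by (rule integrable_compact_support[OF cf R])
  have [measurable]: "f \<in> borel_measurable borel" "partial_deriv j f \<in> borel_measurable borel"
    "\<And>n. diff_quotient j n f \<in> borel_measurable borel"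
    using cf c by (auto intro!: borel_measurable_continuous_onI diff_quotient_continuous)
  have "(\<lambda>n. LINT x|lborel. diff_quotient j n f x) \<longlonglongrightarrow> (LINT x|lborel. partial_deriv j f x)"
  proof (rule integral_dominated_convergence)
    show "integrable lborel (\<lambda>x. L * indicator (cball (0::real^3) (R + 1)) x :: real)"
      by (intro integrable_mult_right integrable_real_indicator emeasure_lborel_cball_finite) simp
    show "AE x in lborel. (\<lambda>n. diff_quotient j n f x) \<longlonglongrightarrow> partial_deriv j f x"
      using diff_quotient_tendsto[OF d] by simp
    show "AE x in lborel. norm (diff_quotient j n f x) \<le> L * indicator (cball 0 (R + 1)) x" for n
      using diff_quotient_bound[OF d L(2) R] by simp
  qed simp_all
  moreover have "(LINT x|lborel. diff_quotient j n f x) = 0" for n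
  proof -
    have i2: "integrable lborel (\<lambda>x. f (x + a))" for a
    proof (rule integrable_compact_support)
      show "continuous_on UNIV (\<lambda>x. f (x + a))"
        by (rule continuous_on_compose2[OF cf]) (auto intro!: continuous_intros)
      show "f (x + a) = 0" if "norm x > R + norm a" for x
        using norm_triangle_ineq4[of "x + a" a] that by (intro R) simp
    qed
    show ?thesis
      unfolding diff_quotient_def using int i2 integral_translation[of f]
      by (simp add: Bochner_Integration.integral_diff)
  qed
  ultimately show "(LINT x|lborel. partial_deriv j f x) = 0"
    using LIMSEQ_unique[OF _ tendsto_const] by fastforce
qed

section \<open>Square-integrable functions\<close>

definition sqnorm :: "wavefunction \<Rightarrow> real" where
  "sqnorm f = (LINT x|lborel. (cmod (f x))\<^sup>2)"

lemma sqnorm_nonneg: "sqnorm f \<ge> 0"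
  unfolding sqnorm_def by simp

lemma cnj_borel_measurable [measurable]: "cnj \<in> borel_measurable borel"
  by (intro borel_measurable_continuous_onI continuous_intros)

lemma L2_D:
  assumes "f \<in> L2"
  shows "f \<in> borel_measurable borel" "integrable lborel (\<lambda>x. (cmod (f x))\<^sup>2)"
  using assms unfolding L2_def by auto

lemma L2_I:
  assumes "f \<in> borel_measurable borel" "integrable lborel (\<lambda>x. (cmod (f x))\<^sup>2)"
  shows "f \<in> L2"
  using assms unfolding L2_def by auto

lemma prod_le_half_sum_squares: "a * b \<le> ((a::real)\<^sup>2 + b\<^sup>2) / 2"
  using zero_le_power2[of "a - b"] by (simp add: power2_diff)

lemma integrable_norm_mult:
  assumes "f \<in> L2" "g \<in> L2"
  shows "integrable lborel (\<lambda>x. cmod (f x) * cmod (g x))"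
proof (rule Bochner_Integration.integrable_bound)
  note [measurable] = L2_D(1)[OF assms(1)] L2_D(1)[OF assms(2)]
  show "(\<lambda>x. cmod (f x) * cmod (g x)) \<in> borel_measurable lborel" by measurable
  show "integrable lborel (\<lambda>x. ((cmod (f x))\<^sup>2 + (cmod (g x))\<^sup>2) / 2)"
    using L2_D(2)[OF assms(1)] L2_D(2)[OF assms(2)] by simp
  show "AE x in lborel. norm (cmod (f x) * cmod (g x)) \<le> norm (((cmod (f x))\<^sup>2 + (cmod (g x))\<^sup>2) / 2)"
    using prod_le_half_sum_squares by simp
qed

lemma integrable_cnj_mult:
  assumes "f \<in> L2" "g \<in> L2"
  shows "integrable lborel (\<lambda>x. cnj (f x) * g x)"
proof (rule Bochner_Integration.integrable_bound[OF integrable_norm_mult[OF assms]])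
  note [measurable] = L2_D(1)[OF assms(1)] L2_D(1)[OF assms(2)]
  show "(\<lambda>x. cnj (f x) * g x) \<in> borel_measurable lborel" by measurable
qed (simp add: norm_mult)

lemma L2_add:
  assumes "f \<in> L2" "g \<in> L2"
  shows "(\<lambda>x. f x + c * g x) \<in> L2"
proof (rule L2_I)
  note [measurable] = L2_D(1)[OF assms(1)] L2_D(1)[OF assms(2)]
  show "(\<lambda>x. f x + c * g x) \<in> borel_measurable borel" by measurable
  show "integrable lborel (\<lambda>x. (cmod (f x + c * g x))\<^sup>2)"
  proof (rule Bochner_Integration.integrable_bound)
    show "integrable lborel (\<lambda>x. 2 * (cmod (f x))\<^sup>2 + 2 * (cmod c)\<^sup>2 * (cmod (g x))\<^sup>2)"
      using L2_D(2)[OF assms(1)] L2_D(2)[OF assms(2)] by simp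
    have "(cmod (a + c * b))\<^sup>2 \<le> 2 * (cmod a)\<^sup>2 + 2 * (cmod c)\<^sup>2 * (cmod b)\<^sup>2" for a b
    proof -
      have "(cmod (a + c * b))\<^sup>2 \<le> (cmod a + cmod c * cmod b)\<^sup>2"
        by (intro power_mono order_trans[OF norm_triangle_ineq]) (auto simp: norm_mult)
      also have "\<dots> \<le> 2 * (cmod a)\<^sup>2 + 2 * (cmod c)\<^sup>2 * (cmod b)\<^sup>2"
        using prod_le_half_sum_squares[of "cmod a" "cmod c * cmod b"]
        by (simp add: power2_sum power_mult_distrib algebra_simps)
      finally show ?thesis .
    qed
    then show "AE x in lborel. norm ((cmod (f x + c * g x))\<^sup>2) \<le>
        norm (2 * (cmod (f x))\<^sup>2 + 2 * (cmod c)\<^sup>2 * (cmod (g x))\<^sup>2)"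
      by simp
  qed measurable
qed

lemma L2_cmult: "f \<in> L2 \<Longrightarrow> (\<lambda>x. c * f x) \<in> L2"
  using L2_add[of "\<lambda>_. 0" f c] by (simp add: L2_def)

lemma L2_inner_add_right:
  assumes "f \<in> L2" "g \<in> L2" "h \<in> L2"
  shows "L2_inner f (\<lambda>x. g x + c * h x) = L2_inner f g + c * L2_inner f h"
proof -
  have "L2_inner f (\<lambda>x. g x + c * h x) = (LINT x|lborel. cnj (f x) * g x + c * (cnj (f x) * h x))"
    unfolding L2_inner_def by (simp add: algebra_simps)
  then show ?thesis
    unfolding L2_inner_def using integrable_cnj_mult[OF assms(1,2)] integrable_cnj_mult[OF assms(1,3)]
    by simp
qed

lemma L2_inner_cnj: "L2_inner g f = cnj (L2_inner f g)"
proof -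
  have "cnj (L2_inner f g) = (LINT x|lborel. cnj (cnj (f x) * g x))"
    unfolding L2_inner_def by (rule Bochner_Integration.integral_cnj[symmetric])
  then show ?thesis unfolding L2_inner_def by (simp add: mult.commute)
qed

lemma L2_inner_add_left:
  assumes "f \<in> L2" "g \<in> L2" "h \<in> L2"
  shows "L2_inner (\<lambda>x. f x + c * g x) h = L2_inner f h + cnj c * L2_inner g h"
  using L2_inner_add_right[OF assms(3,1,2), of c]
  by (metis L2_inner_cnj complex_cnj_add complex_cnj_mult)

lemma L2_inner_self: "L2_inner f f = complex_of_real (sqnorm f)"
proof -
  have "cnj (f x) * f x = complex_of_real ((cmod (f x))\<^sup>2)" for x
    unfolding complex_norm_square by (rule mult.commute)
  then show ?thesis
    unfolding L2_inner_def sqnorm_def by (simp only: integral_complex_of_real)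
qed

text \<open>The optimal weight \<open>t = s / a\<close> turns a weighted arithmetic mean bound into a bound by the
  geometric mean; for \<open>a = 0\<close> a large \<open>t\<close> forces \<open>s \<le> 0\<close>.\<close>

lemma power2_le_mult_of_weighted_mean:
  fixes a b s :: real
  assumes "a \<ge> 0" "b \<ge> 0" "s \<ge> 0" and *: "\<And>t. t > 0 \<Longrightarrow> 2 * s \<le> t * a + b / t"
  shows "s\<^sup>2 \<le> a * b"
proof (cases "a > 0")
  case True
  show ?thesis
  proof (cases "s > 0")
    case True
    have "2 * s \<le> s / a * a + b / (s / a)"
      using *[OF divide_pos_pos[OF True \<open>a > 0\<close>]] .
    moreover have "s / a * a = s" using \<open>a > 0\<close> by simp
    ultimately have "s \<le> b / (s / a)" by linarith
    then have "s \<le> b * a / s" by (simp only: divide_divide_eq_right)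
    then show ?thesis using True by (simp add: field_simps power2_eq_square)
  qed (use assms in auto)
next
  case False
  then have a: "a = 0" using assms by simp
  have "s \<le> 0"
  proof (rule ccontr)
    assume "\<not> s \<le> 0"
    then have "2 * s \<le> b / ((b + 1) / s)" using *[of "(b + 1) / s"] a assms by simp
    also have "\<dots> = s * (b / (b + 1))" by simp
    also have "\<dots> \<le> s * 1" using assms by (intro mult_left_mono) auto
    finally show False using \<open>\<not> s \<le> 0\<close> by simp
  qed
  then show ?thesis using assms a by simp
qed

lemma Cauchy_Schwarz_norm_mult:
  assumes "f \<in> L2" "g \<in> L2"
  shows "(LINT x|lborel. cmod (f x) * cmod (g x))\<^sup>2 \<le> sqnorm f * sqnorm g"
proof (rule power2_le_mult_of_weighted_mean)
  fix t :: real assume t: "t > 0"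
  have "2 * (cmod (f x) * cmod (g x)) \<le> t * (cmod (f x))\<^sup>2 + (cmod (g x))\<^sup>2 / t" for x
  proof -
    have "2 * (sqrt t * cmod (f x) * (cmod (g x) / sqrt t)) \<le> (sqrt t * cmod (f x))\<^sup>2 + (cmod (g x) / sqrt t)\<^sup>2"
      using prod_le_half_sum_squares[of "sqrt t * cmod (f x)" "cmod (g x) / sqrt t"] by simp
    then show ?thesis using t by (simp add: power_mult_distrib power_divide)
  qed
  then have "(LINT x|lborel. 2 * (cmod (f x) * cmod (g x))) \<le>
      (LINT x|lborel. t * (cmod (f x))\<^sup>2 + (cmod (g x))\<^sup>2 / t)"
    using integrable_norm_mult[OF assms] L2_D(2)[OF assms(1)] L2_D(2)[OF assms(2)]
    by (intro integral_mono) auto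
  then show "2 * (LINT x|lborel. cmod (f x) * cmod (g x)) \<le> t * sqnorm f + sqnorm g / t"
    using L2_D(2)[OF assms(1)] L2_D(2)[OF assms(2)] by (simp add: sqnorm_def)
qed (simp_all add: sqnorm_nonneg)

lemma Cauchy_Schwarz_L2:
  assumes "f \<in> L2" "g \<in> L2"
  shows "(cmod (L2_inner f g))\<^sup>2 \<le> sqnorm f * sqnorm g"
proof -
  have "cmod (L2_inner f g) \<le> (LINT x|lborel. cmod (cnj (f x) * g x))"
    unfolding L2_inner_def by simp
  then have "cmod (L2_inner f g) \<le> (LINT x|lborel. cmod (f x) * cmod (g x))"
    by (simp add: norm_mult)
  then have "(cmod (L2_inner f g))\<^sup>2 \<le> (LINT x|lborel. cmod (f x) * cmod (g x))\<^sup>2"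
    by (intro power_mono) auto
  with Cauchy_Schwarz_norm_mult[OF assms] show ?thesis by linarith
qed

section \<open>Integration by parts for test functions\<close>

lemma test_smooth: "f \<in> test_functions \<Longrightarrow> smooth f"
  by (simp add: test_function_iff)

lemma test_support:
  assumes "f \<in> test_functions"
  obtains R where "R > 0" "\<And>x. norm x > R \<Longrightarrow> f x = 0"
proof -
  obtain R where "\<forall>x. norm x > R \<longrightarrow> f x = 0"
    using assms by (auto simp: test_function_iff)
  then show ?thesis by (intro that[of "max R 1"]) auto
qed

lemma test_continuous: "f \<in> test_functions \<Longrightarrow> continuous_on UNIV f"
  by (intro smooth_continuous test_smooth)

lemma test_differentiable: "f \<in> test_functions \<Longrightarrow> f differentiable (at x)"
  by (intro smooth_differentiable test_smooth)

lemma test_borel: "f \<in> test_functions \<Longrightarrow> f \<in> borel_measurable borel"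
  by (intro borel_measurable_continuous_onI test_continuous)

lemma test_add:
  assumes "f \<in> test_functions" "g \<in> test_functions"
  shows "(\<lambda>x. f x + c * g x) \<in> test_functions"
proof -
  obtain R S where "\<And>x. norm x > R \<Longrightarrow> f x = 0" "\<And>x. norm x > S \<Longrightarrow> g x = 0"
    using assms test_support by metis
  then have "\<forall>x. norm x > max R S \<longrightarrow> f x + c * g x = 0" by simp
  then show ?thesis
    using assms unfolding test_function_iff
    by (intro conjI exI[of _ "max R S"] smooth_add smooth_mult smooth_const) auto
qed

lemma test_mult:
  assumes "smooth g" "f \<in> test_functions"
  shows "(\<lambda>x. g x * f x) \<in> test_functions"
proof -
  obtain R where "\<And>x. norm x > R \<Longrightarrow> f x = 0" using assms test_support by metis
  then have "\<forall>x. norm x > R \<longrightarrow> g x * f x = 0" by simp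
  then show ?thesis using assms unfolding test_function_iff by (blast intro: smooth_mult)
qed

lemma test_partial_deriv: "f \<in> test_functions \<Longrightarrow> partial_deriv j f \<in> test_functions"
  unfolding test_function_iff using smooth_partial_deriv partial_deriv_vanishes by metis

lemma test_integrable:
  assumes "f \<in> test_functions" shows "integrable lborel f"
proof -
  obtain R where R: "\<And>x. norm x > R \<Longrightarrow> f x = 0" using assms test_support by metis
  show ?thesis by (rule integrable_compact_support[OF test_continuous[OF assms] R])
qed

lemma test_cnj: "f \<in> test_functions \<Longrightarrow> (\<lambda>x. cnj (f x)) \<in> test_functions"
  unfolding test_function_iff using smooth_cnj by auto

lemma test_L2:
  assumes "f \<in> test_functions" shows "f \<in> L2"
proof (rule L2_I[OF test_borel[OF assms]])
  have "integrable lborel (\<lambda>x. cnj (f x) * f x)"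
    by (intro test_integrable test_mult smooth_cnj test_smooth assms)
  from integrable_norm[OF this] show "integrable lborel (\<lambda>x. (cmod (f x))\<^sup>2)"
    by (simp add: norm_mult power2_eq_square)
qed

lemma test_integral_partial_deriv:
  assumes "f \<in> test_functions"
  shows "(LINT x|lborel. partial_deriv j f x) = 0"
proof -
  obtain R where R: "\<And>x. norm x > R \<Longrightarrow> f x = 0" using assms test_support by metis
  show ?thesis using integral_partial_deriv(2)[OF smooth_C1[OF test_smooth[OF assms]] R] .
qed

lemma L2_inner_partial_deriv:
  assumes "f \<in> test_functions" "g \<in> test_functions"
  shows "L2_inner (partial_deriv j f) g = - L2_inner f (partial_deriv j g)"
proof -
  have d: "f differentiable (at x)" "g differentiable (at x)" "(\<lambda>x. cnj (f x)) differentiable (at x)" for x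
    using assms test_cnj by (auto intro: test_differentiable)
  have "(LINT x|lborel. partial_deriv j (\<lambda>x. cnj (f x) * g x) x) = 0"
    by (intro test_integral_partial_deriv test_mult smooth_cnj test_smooth assms)
  then have "(LINT x|lborel. cnj (partial_deriv j f x) * g x + cnj (f x) * partial_deriv j g x) = 0"
    by (simp add: partial_deriv_mult partial_deriv_cnj d)
  then have "L2_inner (partial_deriv j f) g + L2_inner f (partial_deriv j g) = 0"
    unfolding L2_inner_def
    by (subst (asm) Bochner_Integration.integral_add)
      (auto intro!: integrable_cnj_mult test_L2 test_partial_deriv assms)
  then show ?thesis by (simp add: eq_neg_iff_add_eq_0)
qed

lemma diff_quotient_test:
  assumes "f \<in> test_functions"
  shows "times_cont_diff (Suc 0) (diff_quotient j n f)"
    and "partial_deriv i (diff_quotient j n f) = diff_quotient j n (partial_deriv i f)"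
proof -
  let ?a = "(1 / real (Suc n)) *\<^sub>R axis j 1 :: real^3"
  let ?c = "complex_of_real (real (Suc n))"
  have D: "((\<lambda>x. ?c * (f (x + ?a) - f x)) has_derivative
      (\<lambda>h. ?c * (frechet_derivative f (at (x + ?a)) h - frechet_derivative f (at x) h))) (at x)" for x
  proof -
    have "((\<lambda>x. f (x + ?a)) has_derivative (\<lambda>h. frechet_derivative f (at (x + ?a)) h)) (at x)"
    proof (rule has_derivative_compose[of "\<lambda>x. x + ?a" "\<lambda>h. h"])
      show "((\<lambda>x. x + ?a) has_derivative (\<lambda>h. h)) (at x)"
        by (auto intro!: derivative_eq_intros)
      show "(f has_derivative frechet_derivative f (at (x + ?a))) (at (x + ?a))"
        using test_differentiable[OF assms] frechet_derivative_works by blast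
    qed
    moreover have "(f has_derivative frechet_derivative f (at x)) (at x)"
      using test_differentiable[OF assms] frechet_derivative_works by blast
    ultimately show ?thesis
      by (intro has_derivative_mult_right has_derivative_diff)
  qed
  show eq: "partial_deriv i (diff_quotient j n f) = diff_quotient j n (partial_deriv i f)" for i
  proof
    fix x
    have "partial_deriv i (\<lambda>x. ?c * (f (x + ?a) - f x)) x = ?c * (partial_deriv i f (x + ?a) - partial_deriv i f x)"
      unfolding partial_deriv_eq[OF D] by (simp only: partial_deriv_def)
    then show "partial_deriv i (diff_quotient j n f) x = diff_quotient j n (partial_deriv i f) x"
      by (simp only: diff_quotient_def[abs_def])
  qed
  have "continuous_on UNIV (diff_quotient j n (partial_deriv i f))" for i
    by (intro diff_quotient_continuous test_continuous test_partial_deriv assms)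
  moreover have "diff_quotient j n f differentiable (at x)" for x
    unfolding diff_quotient_def[abs_def] using D differentiable_def by blast
  ultimately show "times_cont_diff (Suc 0) (diff_quotient j n f)"
    by (simp add: eq)
qed

lemma L2_inner_diff_quotient_tendsto:
  assumes "f \<in> test_functions" "g \<in> test_functions"
  shows "(\<lambda>n. L2_inner f (diff_quotient j n g)) \<longlonglongrightarrow> L2_inner f (partial_deriv j g)"
proof -
  obtain R where R: "\<And>x. norm x > R \<Longrightarrow> g x = 0" using assms test_support by metis
  have R': "\<And>x. norm x > R \<Longrightarrow> partial_deriv j g x = 0"
    by (rule partial_deriv_vanishes[OF R])
  obtain L where L: "L \<ge> 0" "\<And>x. norm (partial_deriv j g x) \<le> L"
    using bounded_compact_support[OF test_continuous[OF test_partial_deriv[OF assms(2)]] R'] by blast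
  note [measurable] = test_borel[OF assms(1)] test_borel[OF test_partial_deriv[OF assms(2)]]
    borel_measurable_continuous_onI[OF diff_quotient_continuous[OF test_continuous[OF assms(2)]]]
  show ?thesis unfolding L2_inner_def
  proof (rule integral_dominated_convergence)
    show "integrable lborel (\<lambda>x. cmod (f x) * L)"
      using test_integrable[OF assms(1)] by simp
    show "AE x in lborel. (\<lambda>n. cnj (f x) * diff_quotient j n g x) \<longlonglongrightarrow> cnj (f x) * partial_deriv j g x"
      by (auto intro!: tendsto_intros diff_quotient_tendsto test_differentiable assms)
    have "norm (diff_quotient j n g x) \<le> L" for n x
    proof -
      have "norm (diff_quotient j n g x) \<le> L * indicator (cball 0 (R + 1)) x"
        by (rule diff_quotient_bound) (auto intro: test_differentiable assms(2) L(2) R)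
      also have "\<dots> \<le> L" using L(1) by (simp add: indicator_def)
      finally show ?thesis .
    qed
    then show "AE x in lborel. cmod (cnj (f x) * diff_quotient j n g x) \<le> cmod (f x) * L" for n
      by (auto simp: norm_mult intro!: mult_left_mono)
  qed measurable
qed

text \<open>Mixed derivatives commute in the weak sense because a difference quotient in one direction
  commutes with the derivative in another.\<close>

lemma L2_inner_partial_deriv_swap:
  assumes f: "f \<in> test_functions" and g: "g \<in> test_functions"
  shows "L2_inner (partial_deriv i f) (partial_deriv j g) = L2_inner (partial_deriv j f) (partial_deriv i g)"
proof -
  have d: "f differentiable (at x)" "(\<lambda>x. cnj (f x)) differentiable (at x)" for x
    using f test_cnj by (auto intro: test_differentiable)
  obtain R where R: "\<And>x. norm x > R \<Longrightarrow> f x = 0" using f test_support by metis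
  have *: "L2_inner (partial_deriv i f) (diff_quotient j n g) = - L2_inner f (diff_quotient j n (partial_deriv i g))" for n
  proof -
    let ?g = "diff_quotient j n g"
    have C1: "times_cont_diff (Suc 0) ?g" by (rule diff_quotient_test(1)[OF g])
    have dg: "?g differentiable (at x)" for x using C1 by simp
    have c: "continuous_on UNIV ?g" using times_cont_diff_SucD[OF C1] by simp
    have c': "continuous_on UNIV (partial_deriv i ?g)" using C1 by simp
    have "(LINT x|lborel. partial_deriv i (\<lambda>x. cnj (f x) * ?g x) x) = 0"
      by (rule integral_partial_deriv(2)[of _ R, OF times_cont_diff_mult[OF _ C1]])
        (auto simp: R simp del: times_cont_diff.simps intro!: smooth_C1 smooth_cnj test_smooth[OF f])
    then have "(LINT x|lborel. cnj (partial_deriv i f x) * ?g x + cnj (f x) * partial_deriv i ?g x) = 0"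
      by (simp add: partial_deriv_mult partial_deriv_cnj d dg)
    moreover have "integrable lborel (\<lambda>x. cnj (partial_deriv i f x) * ?g x)"
      by (rule integrable_compact_support[of _ R])
        (auto simp: partial_deriv_vanishes[OF R]
          intro!: continuous_on_mult continuous_on_cnj c test_continuous[OF test_partial_deriv[OF f]])
    moreover have "integrable lborel (\<lambda>x. cnj (f x) * partial_deriv i ?g x)"
      by (rule integrable_compact_support[of _ R])
        (auto simp: R intro!: continuous_on_mult continuous_on_cnj c' test_continuous[OF f])
    ultimately have "L2_inner (partial_deriv i f) ?g + L2_inner f (partial_deriv i ?g) = 0"
      unfolding L2_inner_def by simp
    then show ?thesis by (simp add: eq_neg_iff_add_eq_0 diff_quotient_test(2)[OF g])
  qed
  \<comment> \<open>Both sides of the identity for difference quotients converge.\<close>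
  have "(\<lambda>n. L2_inner (partial_deriv i f) (diff_quotient j n g)) \<longlonglongrightarrow> L2_inner (partial_deriv i f) (partial_deriv j g)"
    by (intro L2_inner_diff_quotient_tendsto test_partial_deriv f g)
  moreover have "(\<lambda>n. - L2_inner f (diff_quotient j n (partial_deriv i g))) \<longlonglongrightarrow>
      - L2_inner f (partial_deriv j (partial_deriv i g))"
    by (intro tendsto_minus L2_inner_diff_quotient_tendsto test_partial_deriv f g)
  ultimately have "L2_inner (partial_deriv i f) (partial_deriv j g) = - L2_inner f (partial_deriv j (partial_deriv i g))"
    unfolding * by (rule LIMSEQ_unique)
  also have "\<dots> = L2_inner (partial_deriv j f) (partial_deriv i g)"
    using L2_inner_partial_deriv[OF f test_partial_deriv[OF g]] by simp
  finally show ?thesis .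
qed

section \<open>The quadratic form of the Zeeman Hamiltonian\<close>

lemma smooth_linear2: "smooth (\<lambda>x. complex_of_real (c * x $ i + d * x $ k))"
proof -
  have "smooth (\<lambda>x. complex_of_real c * complex_of_real (x $ i) + complex_of_real d * complex_of_real (x $ k))"
    by (intro smooth_add smooth_mult smooth_const smooth_coord)
  then show ?thesis by simp
qed

lemma smooth_vector_potential: "smooth (\<lambda>x. complex_of_real (((1/2) *\<^sub>R cross3 x Bv) $ j))"
proof -
  consider "j = 1" | "j = 2" | "j = 3" using exhaust_3 by blast
  then show ?thesis
  proof cases
    case 1
    then show ?thesis
      using smooth_linear2[of "Bv $ 3 / 2" 2 "- Bv $ 2 / 2" 3] by (simp add: cross3_def field_simps)
  next
    case 2
    then show ?thesis
      using smooth_linear2[of "Bv $ 1 / 2" 3 "- Bv $ 3 / 2" 1] by (simp add: cross3_def field_simps)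
  next
    case 3
    then show ?thesis
      using smooth_linear2[of "Bv $ 2 / 2" 1 "- Bv $ 1 / 2" 2] by (simp add: cross3_def field_simps)
  qed
qed

lemma kinetic_momentum_linear:
  assumes "f differentiable (at x)" "g differentiable (at x)"
  shows "kinetic_momentum Bv j (\<lambda>x. f x + c * g x) x = kinetic_momentum Bv j f x + c * kinetic_momentum Bv j g x"
proof -
  have "(\<lambda>x. c * g x) differentiable (at x)"
    using assms(2) by (intro differentiable_mult) auto
  then show ?thesis
    unfolding kinetic_momentum_def using assms
    by (simp add: partial_deriv_add partial_deriv_cmult algebra_simps)
qed

lemma kinetic_momentum_test:
  assumes "f \<in> test_functions"
  shows "kinetic_momentum Bv j f \<in> test_functions"
proof -
  have "(\<lambda>x. complex_of_real (((1/2) *\<^sub>R cross3 x Bv) $ j) * f x + - \<i> * partial_deriv j f x) \<in> test_functions"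
    by (intro test_add test_mult smooth_vector_potential test_partial_deriv assms)
  then show ?thesis unfolding kinetic_momentum_def[abs_def] by (simp add: add.commute)
qed

text \<open>The derivative part is symmetric because of the factor \<open>- \<i>\<close>, the vector potential because it is
  real.\<close>

lemma kinetic_momentum_symmetric:
  assumes f: "f \<in> test_functions" and g: "g \<in> test_functions"
  shows "L2_inner f (kinetic_momentum Bv j g) = L2_inner (kinetic_momentum Bv j f) g"
proof -
  let ?A = "\<lambda>x. complex_of_real (((1/2) *\<^sub>R cross3 x Bv) $ j)"
  have L2: "f \<in> L2" "g \<in> L2" "partial_deriv j f \<in> L2" "partial_deriv j g \<in> L2"
      "(\<lambda>x. ?A x * f x) \<in> L2" "(\<lambda>x. ?A x * g x) \<in> L2"
    by (intro test_L2 test_partial_deriv test_mult[OF smooth_vector_potential] f g)+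
  have 1: "kinetic_momentum Bv j h = (\<lambda>x. ?A x * h x + - \<i> * partial_deriv j h x)" for h
    by (simp add: kinetic_momentum_def fun_eq_iff)
  have 2: "L2_inner f (\<lambda>x. ?A x * g x) = L2_inner (\<lambda>x. ?A x * f x) g"
    unfolding L2_inner_def by (simp add: algebra_simps)
  show ?thesis unfolding 1
    by (simp only: L2_inner_add_left[OF L2(5,3,2)] L2_inner_add_right[OF L2(1,6,4)] 2
        L2_inner_partial_deriv[OF f g]) simp
qed

definition kinetic_energy :: "real^3 \<Rightarrow> wavefunction \<Rightarrow> real" where
  "kinetic_energy Bv f = (1/2) * (\<Sum>j\<in>UNIV. sqnorm (kinetic_momentum Bv j f))"

lemma kinetic_energy_nonneg: "kinetic_energy Bv f \<ge> 0"
  unfolding kinetic_energy_def by (intro mult_nonneg_nonneg sum_nonneg sqnorm_nonneg) simp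

lemma smooth_power2_norm: "smooth (\<lambda>x::real^3. complex_of_real ((norm x)\<^sup>2))"
proof -
  have "smooth (\<lambda>x. complex_of_real (x $ 1) * complex_of_real (x $ 1) +
      complex_of_real (x $ 2) * complex_of_real (x $ 2) + complex_of_real (x $ 3) * complex_of_real (x $ 3))"
    by (intro smooth_add smooth_mult smooth_coord)
  then show ?thesis by (simp add: power2_norm_eq_inner inner_vec_def sum_3)
qed

lemma norm_power2_3: "(norm (x::real^3))\<^sup>2 = (\<Sum>j\<in>UNIV. (x $ j)\<^sup>2)"
  unfolding power2_norm_eq_inner inner_vec_def by (simp add: power2_eq_square)

lemma partial_deriv_power2_norm:
  "partial_deriv j (\<lambda>x. complex_of_real ((norm x)\<^sup>2)) x = complex_of_real (2 * x $ j)"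
proof -
  have "((\<lambda>x::real^3. (norm x)\<^sup>2) has_derivative (\<lambda>h. 2 * (x \<bullet> h))) (at x)"
    unfolding power2_norm_eq_inner by (auto intro!: derivative_eq_intros simp: inner_commute)
  from bounded_linear.has_derivative[OF bounded_linear_of_real this, THEN partial_deriv_eq]
  show ?thesis by (simp add: inner_axis)
qed

lemma smooth_inverse:
  fixes p :: "real^3 \<Rightarrow> real"
  assumes "smooth (\<lambda>x. complex_of_real (p x))" "\<And>x. p x \<noteq> 0"
  shows "smooth (\<lambda>x. complex_of_real (1 / p x))"
proof -
  have "smooth (\<lambda>x. complex_of_real ((- 1) ^ 0 * fact 0 / p x ^ Suc 0))"
  proof (rule smooth_of_real_comp[OF assms(1), where H = "\<lambda>n t. (- 1) ^ n * fact n / t ^ Suc n"])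
    fix n x
    have "((\<lambda>t. t ^ Suc n) has_real_derivative real (Suc n) * p x ^ n) (at (p x))"
      using DERIV_pow[of "Suc n" "p x"] by simp
    from DERIV_cmult[OF DERIV_inverse_fun[OF this], of "(- 1) ^ n * fact n"]
    have "((\<lambda>t. (- 1) ^ n * fact n / t ^ Suc n) has_real_derivative
        (- 1) ^ n * fact n * - (real (Suc n) * p x ^ n * inverse ((p x ^ Suc n) ^ Suc (Suc 0)))) (at (p x))"
      using assms(2)[of x] by (simp add: divide_inverse)
    moreover have "(- 1) ^ n * fact n * - (real (Suc n) * p x ^ n * inverse ((p x ^ Suc n) ^ Suc (Suc 0)))
        = (- 1) ^ Suc n * fact (Suc n) / p x ^ Suc (Suc n)"
      using assms(2)[of x] by (simp add: field_simps del: of_nat_Suc)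
    ultimately show "((\<lambda>t. (- 1) ^ n * fact n / t ^ Suc n) has_real_derivative
        (- 1) ^ Suc n * fact (Suc n) / p x ^ Suc (Suc n)) (at (p x))"
      by (simp only:)
  qed
  then show ?thesis by simp
qed

lemma partial_deriv_weighted_density:
  assumes f: "f differentiable (at x)" and g: "g differentiable (at x)"
  shows "partial_deriv j (\<lambda>x. g x * (cnj (f x) * f x)) x =
    partial_deriv j g x * complex_of_real ((cmod (f x))\<^sup>2)
      + g x * complex_of_real (2 * Re (cnj (f x) * partial_deriv j f x))"
proof -
  have cf: "(\<lambda>x. cnj (f x)) differentiable (at x)"
    using f has_derivative_cnj unfolding differentiable_def by blast
  have 1: "cnj (partial_deriv j f x) * f x + cnj (f x) * partial_deriv j f x
      = complex_of_real (2 * Re (cnj (f x) * partial_deriv j f x))"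
    by (simp add: complex_eq_iff)
  have 2: "cnj (f x) * f x = complex_of_real ((cmod (f x))\<^sup>2)"
    unfolding complex_norm_square by (rule mult.commute)
  show ?thesis
    unfolding partial_deriv_mult[OF g differentiable_mult[OF cf f]] partial_deriv_mult[OF cf f]
      partial_deriv_cnj[OF f] 1 2 ..
qed

lemma integral_lincomb3:
  fixes u v w :: "'a \<Rightarrow> real"
  assumes "integrable M u" "integrable M v" "integrable M w"
  shows "(LINT x|M. a * u x + b * v x + c * w x) =
    a * (LINT x|M. u x) + b * (LINT x|M. v x) + c * (LINT x|M. w x)"
  using assms by simp

text \<open>Hardy's inequality, from the divergence of the field \<open>|f|\<^sup>2 x / (|x|\<^sup>2 + e)\<close>; since the vector
  potential is real, it drops out of the derivative of \<open>|f|\<^sup>2\<close> and the gradient may be replaced by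
  the kinetic momentum.\<close>

lemma Hardy_regularized:
  assumes f: "f \<in> test_functions" and e: "e > 0"
  shows "integrable lborel (\<lambda>x. (cmod (f x))\<^sup>2 / ((norm x)\<^sup>2 + e))"
    and "(LINT x|lborel. (cmod (f x))\<^sup>2 / ((norm x)\<^sup>2 + e)) \<le> 8 * kinetic_energy Bv f"
proof -
  let ?p = "\<lambda>x::real^3. (norm x)\<^sup>2 + e"
  define w where "w x = 1 / ?p x" for x
  have p: "?p x > 0" for x using e by (simp add: add_nonneg_pos)
  have w_pos: "w x > 0" for x using p by (simp add: w_def)
  have sp: "smooth (\<lambda>x. complex_of_real (?p x))"
    using smooth_add[OF smooth_power2_norm smooth_const[of "complex_of_real e"]] by simp
  have dp: "partial_deriv j (\<lambda>x. complex_of_real (?p x)) x = complex_of_real (2 * x $ j)" for j x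
    unfolding of_real_add
      partial_deriv_add[OF smooth_differentiable[OF smooth_power2_norm] smooth_differentiable[OF smooth_const]]
      partial_deriv_power2_norm partial_deriv_const by simp
  have sw: "smooth (\<lambda>x. complex_of_real (w x))"
    unfolding w_def by (rule smooth_inverse[OF sp]) (use p in \<open>metis less_irrefl\<close>)
  have dw: "partial_deriv j (\<lambda>x. complex_of_real (w x)) x = complex_of_real (- ((w x)\<^sup>2) * (2 * x $ j))" for j x
  proof -
    have "((\<lambda>t. 1 / t) has_real_derivative - ((1 / ?p x)\<^sup>2)) (at (?p x))"
      using p[of x] by (auto intro!: derivative_eq_intros simp: power2_eq_square)
    from of_real_comp_chain(2)[OF smooth_differentiable[OF sp] this]
    show ?thesis unfolding dp w_def of_real_mult .
  qed
  \<comment> \<open>The components of the vector field; \<open>G j\<close> is the \<open>j\<close>-th term of its divergence.\<close>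
  let ?F = "\<lambda>j x. complex_of_real (x $ j) * complex_of_real (w x) * (cnj (f x) * f x)"
  have d: "f differentiable (at x)" "(\<lambda>x. cnj (f x)) differentiable (at x)"
      "(\<lambda>x. complex_of_real (x $ j)) differentiable (at x)"
      "(\<lambda>x. complex_of_real (w x)) differentiable (at x)" for x j
    by (rule test_differentiable[OF f] test_differentiable[OF test_cnj[OF f]]
        smooth_differentiable[OF smooth_coord] smooth_differentiable[OF sw])+
  have F: "?F j \<in> test_functions" for j
    by (intro test_mult smooth_mult smooth_coord sw smooth_cnj test_smooth f)
  define G where "G j x = Re (partial_deriv j (?F j) x)" for j x
  have G: "G j x = 2 * Re (cnj (f x) * partial_deriv j f x) * (x $ j * w x)
      + (cmod (f x))\<^sup>2 * (w x - 2 * (x $ j * w x)\<^sup>2)" for j x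
  proof -
    have g: "partial_deriv j (\<lambda>x. complex_of_real (x $ j) * complex_of_real (w x)) x =
        complex_of_real (w x + x $ j * (- ((w x)\<^sup>2) * (2 * x $ j)))"
      unfolding partial_deriv_mult[OF d(3,4)] dw partial_deriv_coord by simp
    have "partial_deriv j (?F j) x = complex_of_real
      ((w x + x $ j * (- ((w x)\<^sup>2) * (2 * x $ j))) * (cmod (f x))\<^sup>2
        + x $ j * w x * (2 * Re (cnj (f x) * partial_deriv j f x)))"
      unfolding partial_deriv_weighted_density[OF d(1) differentiable_mult[OF d(3,4)]] g by simp
    then have "G j x = (w x + x $ j * (- ((w x)\<^sup>2) * (2 * x $ j))) * (cmod (f x))\<^sup>2
        + x $ j * w x * (2 * Re (cnj (f x) * partial_deriv j f x))"
      unfolding G_def by (simp only: Re_complex_of_real)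
    then show ?thesis by (simp add: algebra_simps power2_eq_square)
  qed
  have intG: "integrable lborel (G j)" "(LINT x|lborel. G j x) = 0" for j
  proof -
    have i: "integrable lborel (partial_deriv j (?F j))"
      by (intro test_integrable test_partial_deriv F)
    then show "integrable lborel (G j)" unfolding G_def by simp
    show "(LINT x|lborel. G j x) = 0"
      unfolding G_def using i test_integral_partial_deriv[OF F] by simp
  qed
  have intK: "integrable lborel (\<lambda>x. (cmod (kinetic_momentum Bv j f x))\<^sup>2)" for j
    by (intro L2_D test_L2 kinetic_momentum_test f)
  have "(\<lambda>x. complex_of_real (w x) * (cnj (f x) * f x)) \<in> test_functions"
    by (intro test_mult sw smooth_cnj test_smooth f)
  from integrable_norm[OF test_integrable[OF this]]
  have "integrable lborel (\<lambda>x. \<bar>w x\<bar> * (cmod (f x) * cmod (f x)))"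
    unfolding norm_mult norm_of_real complex_mod_cnj .
  then have int: "integrable lborel (\<lambda>x. (cmod (f x))\<^sup>2 * w x)"
    using w_pos by (simp add: power2_eq_square abs_of_pos mult_ac)
  then show "integrable lborel (\<lambda>x. (cmod (f x))\<^sup>2 / ?p x)"
    by (simp add: w_def)
  have G_ge: "G j x \<ge> (cmod (f x))\<^sup>2 * (w x - 5 / 2 * (x $ j * w x)\<^sup>2)
      - 2 * (cmod (kinetic_momentum Bv j f x))\<^sup>2" for j x
  proof -
    let ?k = "cmod (kinetic_momentum Bv j f x)"
    let ?A = "((1/2) *\<^sub>R cross3 x Bv) $ j"
    define y where "y = Re (cnj (f x) * partial_deriv j f x)"
    define t where "t = x $ j * w x"
    have "cnj (f x) * partial_deriv j f x = \<i> * (cnj (f x) * kinetic_momentum Bv j f x) - \<i> * complex_of_real (?A * (cmod (f x))\<^sup>2)"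
      unfolding kinetic_momentum_def of_real_mult complex_norm_square by (simp add: algebra_simps)
    then have "y = Re (\<i> * (cnj (f x) * kinetic_momentum Bv j f x))"
      unfolding y_def by (simp del: complex_mult_cnj)
    then have "\<bar>y\<bar> \<le> cmod (f x) * ?k"
      using abs_Re_le_cmod[of "\<i> * (cnj (f x) * kinetic_momentum Bv j f x)"] by (simp add: norm_mult)
    then have "\<bar>2 * y * t\<bar> \<le> 2 * (cmod (f x) * ?k) * \<bar>t\<bar>"
      unfolding abs_mult by (intro mult_right_mono) auto
    also have "\<dots> = 2 * ((cmod (f x) * \<bar>t\<bar> / sqrt 2) * (sqrt 2 * ?k))" by simp
    also have "\<dots> \<le> (cmod (f x) * \<bar>t\<bar> / sqrt 2)\<^sup>2 + (sqrt 2 * ?k)\<^sup>2"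
      using sum_squares_bound[of "cmod (f x) * \<bar>t\<bar> / sqrt 2" "sqrt 2 * ?k"]
      by (simp only: mult.assoc)
    also have "\<dots> = (cmod (f x))\<^sup>2 * (1 / 2 * t\<^sup>2) + 2 * ?k\<^sup>2"
      by (simp add: power_mult_distrib power_divide)
    finally show ?thesis
      unfolding G y_def[symmetric] t_def[symmetric] by (simp add: algebra_simps)
  qed
  have "(LINT x|lborel. (cmod (f x))\<^sup>2 * w x * (1 / 2) - 2 * (\<Sum>j\<in>UNIV. (cmod (kinetic_momentum Bv j f x))\<^sup>2))
      \<le> (LINT x|lborel. (\<Sum>j\<in>UNIV. G j x))"
  proof (rule integral_mono)
    show "integrable lborel (\<lambda>x. (cmod (f x))\<^sup>2 * w x * (1 / 2) - 2 * (\<Sum>j\<in>UNIV. (cmod (kinetic_momentum Bv j f x))\<^sup>2))"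
      by (intro Bochner_Integration.integrable_diff integrable_mult_right integrable_mult_left
          Bochner_Integration.integrable_sum int intK)
    show "integrable lborel (\<lambda>x. (\<Sum>j\<in>UNIV. G j x))"
      by (intro Bochner_Integration.integrable_sum intG)
    fix x
    have "(norm x)\<^sup>2 * w x \<le> 1"
      using p[of x] e by (simp add: w_def)
    then have "((norm x)\<^sup>2 * w x) * w x \<le> 1 * w x"
      using w_pos[of x] by (intro mult_right_mono) auto
    then have q: "(norm x)\<^sup>2 * (w x)\<^sup>2 \<le> w x" by (simp add: power2_eq_square)
    have "(cmod (f x))\<^sup>2 * w x * (1 / 2) \<le> (cmod (f x))\<^sup>2 * (3 * w x - 5 / 2 * ((norm x)\<^sup>2 * (w x)\<^sup>2))"
      unfolding mult.assoc using q by (intro mult_left_mono) auto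
    also have "\<dots> = (\<Sum>j\<in>UNIV. (cmod (f x))\<^sup>2 * (w x - 5 / 2 * (x $ j * w x)\<^sup>2))"
      unfolding norm_power2_3[of x] sum_3 by (simp add: algebra_simps power_mult_distrib)
    finally have "(cmod (f x))\<^sup>2 * w x * (1 / 2) - 2 * (\<Sum>j\<in>UNIV. (cmod (kinetic_momentum Bv j f x))\<^sup>2)
      \<le> (\<Sum>j\<in>UNIV. (cmod (f x))\<^sup>2 * (w x - 5 / 2 * (x $ j * w x)\<^sup>2)
          - 2 * (cmod (kinetic_momentum Bv j f x))\<^sup>2)"
      by (simp only: sum_subtractf sum_distrib_left[symmetric])
    also have "\<dots> \<le> (\<Sum>j\<in>UNIV. G j x)"
      by (intro sum_mono G_ge)
    finally show "(cmod (f x))\<^sup>2 * w x * (1 / 2) - 2 * (\<Sum>j\<in>UNIV. (cmod (kinetic_momentum Bv j f x))\<^sup>2) \<le> (\<Sum>j\<in>UNIV. G j x)" .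
  qed
  also have "(LINT x|lborel. (\<Sum>j\<in>UNIV. G j x)) = 0"
    using intG by simp
  finally have "(LINT x|lborel. (cmod (f x))\<^sup>2 * w x * (1 / 2) - 2 * (\<Sum>j\<in>UNIV. (cmod (kinetic_momentum Bv j f x))\<^sup>2)) \<le> 0" .
  moreover have "(LINT x|lborel. (cmod (f x))\<^sup>2 * w x * (1 / 2) - 2 * (\<Sum>j\<in>UNIV. (cmod (kinetic_momentum Bv j f x))\<^sup>2))
      = (LINT x|lborel. (cmod (f x))\<^sup>2 * w x) * (1 / 2) - 2 * (\<Sum>j\<in>UNIV. sqnorm (kinetic_momentum Bv j f))"
  proof -
    define h where "h x = (cmod (f x))\<^sup>2 * w x" for x
    have "integrable lborel h" using int unfolding h_def .
    then show ?thesis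
      unfolding h_def[symmetric] sqnorm_def using intK by simp
  qed
  moreover have "(LINT x|lborel. (cmod (f x))\<^sup>2 * w x) = (LINT x|lborel. (cmod (f x))\<^sup>2 / ?p x)"
    by (simp add: w_def)
  ultimately show "(LINT x|lborel. (cmod (f x))\<^sup>2 / ?p x) \<le> 8 * kinetic_energy Bv f"
    unfolding kinetic_energy_def by linarith
qed

text \<open>The parameter \<open>e\<close> tends to 0 by Fatou's lemma. At the origin the quotient is 0 by convention.\<close>

lemma Hardy:
  assumes f: "f \<in> test_functions"
  shows "integrable lborel (\<lambda>x. (cmod (f x))\<^sup>2 / (norm x)\<^sup>2)"
    and "(LINT x|lborel. (cmod (f x))\<^sup>2 / (norm x)\<^sup>2) \<le> 8 * kinetic_energy Bv f"
proof -
  let ?u = "\<lambda>n x. ennreal ((cmod (f x))\<^sup>2 / ((norm x)\<^sup>2 + 1 / real (Suc n)))"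
  note [measurable] = test_borel[OF f]
  have bound: "(\<integral>\<^sup>+x. ?u n x \<partial>lborel) \<le> ennreal (8 * kinetic_energy Bv f)" for n Bv
  proof -
    have "(\<integral>\<^sup>+x. ?u n x \<partial>lborel) = ennreal (LINT x|lborel. (cmod (f x))\<^sup>2 / ((norm x)\<^sup>2 + 1 / real (Suc n)))"
      by (intro nn_integral_eq_integral Hardy_regularized f) auto
    also have "\<dots> \<le> ennreal (8 * kinetic_energy Bv f)"
      by (intro ennreal_leI Hardy_regularized f) auto
    finally show ?thesis .
  qed
  have nn: "(\<integral>\<^sup>+x. ennreal ((cmod (f x))\<^sup>2 / (norm x)\<^sup>2) \<partial>lborel) \<le> ennreal (8 * kinetic_energy Bv f)" for Bv
  proof -
    have "ennreal ((cmod (f x))\<^sup>2 / (norm x)\<^sup>2) \<le> liminf (\<lambda>n. ?u n x)" for x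
    proof (cases "x = 0")
      case False
      have "(\<lambda>n. (cmod (f x))\<^sup>2 / ((norm x)\<^sup>2 + 1 / real (Suc n))) \<longlonglongrightarrow> (cmod (f x))\<^sup>2 / ((norm x)\<^sup>2 + 0)"
        using False LIMSEQ_inverse_real_of_nat by (intro tendsto_intros) (auto simp: inverse_eq_divide)
      then have "(\<lambda>n. ?u n x) \<longlonglongrightarrow> ennreal ((cmod (f x))\<^sup>2 / (norm x)\<^sup>2)"
        by (intro tendsto_ennrealI) simp
      from lim_imp_Liminf[OF _ this] show ?thesis by simp
    qed simp
    then have "(\<integral>\<^sup>+x. ennreal ((cmod (f x))\<^sup>2 / (norm x)\<^sup>2) \<partial>lborel) \<le> (\<integral>\<^sup>+x. liminf (\<lambda>n. ?u n x) \<partial>lborel)"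
      by (intro nn_integral_mono)
    also have "\<dots> \<le> liminf (\<lambda>n. \<integral>\<^sup>+x. ?u n x \<partial>lborel)"
      by (rule nn_integral_liminf) measurable
    also have "\<dots> \<le> ennreal (8 * kinetic_energy Bv f)"
      using bound by (intro Liminf_le) auto
    finally show ?thesis .
  qed
  show int: "integrable lborel (\<lambda>x. (cmod (f x))\<^sup>2 / (norm x)\<^sup>2)"
    by (rule integrableI_bounded) (use nn in \<open>auto intro: le_less_trans[OF nn]\<close>)
  have "ennreal (LINT x|lborel. (cmod (f x))\<^sup>2 / (norm x)\<^sup>2) \<le> ennreal (8 * kinetic_energy Bv f)"
    using nn by (subst nn_integral_eq_integral[OF int, symmetric]) auto
  then show "(LINT x|lborel. (cmod (f x))\<^sup>2 / (norm x)\<^sup>2) \<le> 8 * kinetic_energy Bv f"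
    using kinetic_energy_nonneg[of Bv f] by simp
qed

section \<open>Coulomb energy and the sesquilinear form\<close>

definition coulomb :: "wavefunction \<Rightarrow> wavefunction" where
  "coulomb f x = complex_of_real (1 / norm x) * f x"

lemma coulomb_L2:
  assumes "f \<in> test_functions"
  shows "coulomb f \<in> L2"
proof (rule L2_I)
  note [measurable] = test_borel[OF assms]
  show "coulomb f \<in> borel_measurable borel"
    unfolding coulomb_def[abs_def] by measurable
  show "integrable lborel (\<lambda>x. (cmod (coulomb f x))\<^sup>2)"
    using Hardy(1)[OF assms] by (simp add: coulomb_def norm_mult norm_divide power_divide)
qed

lemma zeeman_expression_eq:
  "zeeman_expression Bv f =
    (\<lambda>x. (1/2) * (\<Sum>j\<in>UNIV. kinetic_momentum Bv j (kinetic_momentum Bv j f) x) + - 1 * coulomb f x)"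
  by (simp add: zeeman_expression_def coulomb_def fun_eq_iff)

lemma zeeman_kinetic_test:
  assumes "f \<in> test_functions"
  shows "(\<lambda>x. (1/2) * (\<Sum>j\<in>UNIV. kinetic_momentum Bv j (kinetic_momentum Bv j f) x)) \<in> test_functions"
proof -
  let ?k = "\<lambda>j. kinetic_momentum Bv j (kinetic_momentum Bv j f)"
  have "(\<lambda>x. (1/2) * (?k 1 x + 1 * ?k 2 x + 1 * ?k 3 x)) \<in> test_functions"
    by (intro test_mult smooth_const test_add kinetic_momentum_test assms)
  then show ?thesis by (simp add: sum_3)
qed

lemma zeeman_L2:
  assumes "f \<in> test_functions"
  shows "zeeman_expression Bv f \<in> L2"
  unfolding zeeman_expression_eq
  by (intro L2_add coulomb_L2 test_L2 zeeman_kinetic_test assms)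

lemma zeeman_vanishes:
  assumes "\<And>x. norm x > R \<Longrightarrow> f x = 0" "norm x > R"
  shows "zeeman_expression Bv f x = 0"
proof -
  have 1: "kinetic_momentum Bv j f y = 0" if "norm y > R" for y j
    using assms(1)[OF that] partial_deriv_vanishes[OF assms(1) that] by (simp add: kinetic_momentum_def)
  have "kinetic_momentum Bv j (kinetic_momentum Bv j f) x = 0" for j
    using 1[OF assms(2)] partial_deriv_vanishes[OF 1 assms(2)] by (subst kinetic_momentum_def) simp
  then show ?thesis
    using assms by (simp add: zeeman_expression_def)
qed

lemma zeeman_linear:
  assumes f: "f \<in> test_functions" and g: "g \<in> test_functions"
  shows "zeeman_expression Bv (\<lambda>x. f x + c * g x) =
    (\<lambda>x. zeeman_expression Bv f x + c * zeeman_expression Bv g x)"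
proof -
  have 1: "kinetic_momentum Bv j (\<lambda>x. f x + c * g x) =
      (\<lambda>x. kinetic_momentum Bv j f x + c * kinetic_momentum Bv j g x)" for j
    by (intro ext kinetic_momentum_linear test_differentiable f g)
  have 2: "kinetic_momentum Bv j (\<lambda>x. kinetic_momentum Bv j f x + c * kinetic_momentum Bv j g x) =
      (\<lambda>x. kinetic_momentum Bv j (kinetic_momentum Bv j f) x + c * kinetic_momentum Bv j (kinetic_momentum Bv j g) x)" for j
    by (intro ext kinetic_momentum_linear test_differentiable kinetic_momentum_test f g)
  show ?thesis
    unfolding zeeman_expression_eq 1 2
    by (simp add: coulomb_def fun_eq_iff sum_3 algebra_simps)
qed

lemma L2_inner_zeeman:
  assumes f: "f \<in> test_functions" and g: "g \<in> test_functions"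
  shows "L2_inner f (zeeman_expression Bv g) =
    (1/2) * (\<Sum>j\<in>UNIV. L2_inner (kinetic_momentum Bv j f) (kinetic_momentum Bv j g)) - L2_inner f (coulomb g)"
proof -
  let ?k = "\<lambda>j. kinetic_momentum Bv j (kinetic_momentum Bv j g)"
  have k: "?k j \<in> L2" for j
    by (intro test_L2 kinetic_momentum_test g)
  have "L2_inner f (zeeman_expression Bv g) =
      L2_inner f (\<lambda>x. (1/2) * (\<Sum>j\<in>UNIV. ?k j x)) + - 1 * L2_inner f (coulomb g)"
    unfolding zeeman_expression_eq
    by (intro L2_inner_add_right coulomb_L2 test_L2 zeeman_kinetic_test f g)
  also have "L2_inner f (\<lambda>x. (1/2) * (\<Sum>j\<in>UNIV. ?k j x)) = (1/2) * (\<Sum>j\<in>UNIV. L2_inner f (?k j))"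
  proof -
    have "L2_inner f (\<lambda>x. (1/2) * (\<Sum>j\<in>UNIV. ?k j x)) =
        (LINT x|lborel. (1/2) * (\<Sum>j\<in>UNIV. cnj (f x) * ?k j x))"
      unfolding L2_inner_def by (simp add: sum_distrib_left mult_ac)
    then show ?thesis
      unfolding L2_inner_def using integrable_cnj_mult[OF test_L2[OF f] k]
      by simp
  qed
  also have "(\<Sum>j\<in>UNIV. L2_inner f (?k j)) = (\<Sum>j\<in>UNIV. L2_inner (kinetic_momentum Bv j f) (kinetic_momentum Bv j g))"
    by (intro sum.cong refl kinetic_momentum_symmetric kinetic_momentum_test f g)
  finally show ?thesis by simp
qed

lemma zeeman_symmetric:
  assumes f: "f \<in> test_functions" and g: "g \<in> test_functions"
  shows "L2_inner g (zeeman_expression Bv f) = cnj (L2_inner f (zeeman_expression Bv g))"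
proof -
  have "L2_inner g (coulomb f) = L2_inner (coulomb g) f"
    unfolding L2_inner_def coulomb_def by (simp add: mult_ac)
  also have "\<dots> = cnj (L2_inner f (coulomb g))" by (rule L2_inner_cnj)
  finally show ?thesis
    unfolding L2_inner_zeeman[OF f g] L2_inner_zeeman[OF g f]
    by (simp add: L2_inner_cnj[of "kinetic_momentum Bv _ g"])
qed

definition coulomb_energy :: "wavefunction \<Rightarrow> real" where
  "coulomb_energy f = (LINT x|lborel. (cmod (f x))\<^sup>2 / norm x)"

definition energy :: "real^3 \<Rightarrow> wavefunction \<Rightarrow> real" where
  "energy Bv f = kinetic_energy Bv f - coulomb_energy f"

lemma L2_inner_zeeman_self:
  assumes f: "f \<in> test_functions"
  shows "L2_inner f (zeeman_expression Bv f) = complex_of_real (energy Bv f)"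
proof -
  have "cnj (f x) * coulomb f x = complex_of_real ((cmod (f x))\<^sup>2 / norm x)" for x
    unfolding coulomb_def of_real_divide complex_norm_square by (simp add: mult_ac)
  then have "L2_inner f (coulomb f) = complex_of_real (coulomb_energy f)"
    unfolding L2_inner_def coulomb_energy_def by (simp only: integral_complex_of_real)
  then show ?thesis
    unfolding L2_inner_zeeman[OF f f] energy_def kinetic_energy_def by (simp add: L2_inner_self)
qed

lemma coulomb_integrable:
  assumes f: "f \<in> test_functions"
  shows "integrable lborel (\<lambda>x. (cmod (f x))\<^sup>2 / norm x)"
  using integrable_norm_mult[OF test_L2[OF f] coulomb_L2[OF f]]
  by (simp add: coulomb_def norm_mult norm_divide power2_eq_square)

text \<open>Near the nucleus the Coulomb energy is controlled by the Hardy term, far away by the small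
  size of \<open>1/r\<close>; only a bounded region in between contributes substantially.\<close>

lemma inverse_norm_split:
  fixes x :: "real^3"
  assumes "d > 0" "R > 0"
  shows "1 / norm x \<le> d * (1 / (norm x)\<^sup>2) + 1 / R + indicator (cball 0 R) x / d"
proof -
  consider "x = 0" | "x \<noteq> 0" "norm x \<le> d" | "x \<noteq> 0" "norm x > R" | "x \<noteq> 0" "norm x \<le> R" "norm x > d" by force
  then show ?thesis
  proof cases
    case 2
    then have "1 / norm x \<le> d * (1 / (norm x)\<^sup>2)"
      by (simp add: field_simps power2_eq_square)
    moreover have "0 \<le> 1 / R" "0 \<le> indicator (cball 0 R) x / d" using assms by simp_all
    ultimately show ?thesis by linarith
  next
    case 3
    then have "1 / norm x \<le> 1 / R" using assms by (simp add: field_simps)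
    moreover have "0 \<le> d * (1 / (norm x)\<^sup>2)" "0 \<le> indicator (cball 0 R) x / d" using assms by simp_all
    ultimately show ?thesis by linarith
  next
    case 4
    then have "1 / norm x \<le> indicator (cball 0 R) x / d" using assms by (simp add: field_simps)
    moreover have "0 \<le> d * (1 / (norm x)\<^sup>2)" "0 \<le> 1 / R" using assms by simp_all
    ultimately show ?thesis by linarith
  qed (use assms in auto)
qed

text \<open>Used twice: with a fixed radius to bound the energy from below, and with a small \<open>d\<close> and a large
  \<open>R\<close> to locate mass.\<close>

lemma coulomb_energy_split:
  assumes f: "f \<in> test_functions" and d: "d > 0" and R: "R > 0"
  shows "coulomb_energy f \<le> 8 * d * kinetic_energy Bv f + sqnorm f / R
    + (LINT x|lborel. indicator (cball 0 R) x * (cmod (f x))\<^sup>2) / d"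
proof -
  let ?F = "\<lambda>x. (cmod (f x))\<^sup>2"
  have int: "integrable lborel ?F" "integrable lborel (\<lambda>x. ?F x / (norm x)\<^sup>2)" "integrable lborel (\<lambda>x. ?F x / norm x)"
    using L2_D(2)[OF test_L2[OF f]] Hardy(1)[OF f] coulomb_integrable[OF f] by simp_all
  have intb: "integrable lborel (\<lambda>x. indicator (cball 0 R) x * ?F x)"
    using integrable_mult_indicator[OF _ int(1), of "cball 0 R"] by simp
  have "coulomb_energy f \<le> (LINT x|lborel. d * (?F x / (norm x)\<^sup>2) + (1 / R) * ?F x + (1 / d) * (indicator (cball 0 R) x * ?F x))"
    unfolding coulomb_energy_def
  proof (rule integral_mono)
    show "integrable lborel (\<lambda>x. d * (?F x / (norm x)\<^sup>2) + (1 / R) * ?F x + (1 / d) * (indicator (cball 0 R) x * ?F x))"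
      by (intro Bochner_Integration.integrable_add integrable_mult_right int intb)
    fix x :: "real^3"
    show "?F x / norm x \<le> d * (?F x / (norm x)\<^sup>2) + (1 / R) * ?F x + (1 / d) * (indicator (cball 0 R) x * ?F x)"
      using mult_left_mono[OF inverse_norm_split[OF d R, of x], of "?F x"]
      by (simp add: algebra_simps)
  qed (rule int)
  also have "\<dots> = d * (LINT x|lborel. ?F x / (norm x)\<^sup>2) + (1 / R) * sqnorm f
      + (1 / d) * (LINT x|lborel. indicator (cball 0 R) x * ?F x)"
    unfolding sqnorm_def by (rule integral_lincomb3[OF int(2) int(1) intb])
  also have "\<dots> \<le> d * (8 * kinetic_energy Bv f) + (1 / R) * sqnorm f
      + (1 / d) * (LINT x|lborel. indicator (cball 0 R) x * ?F x)"
    using Hardy(2)[OF f] d by (intro add_right_mono mult_left_mono) auto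
  finally show ?thesis by simp
qed

lemma kinetic_energy_le_energy:
  assumes f: "f \<in> test_functions"
  shows "kinetic_energy Bv f \<le> 2 * energy Bv f + 34 * sqnorm f"
proof -
  have "(LINT x|lborel. indicator (cball 0 1) x * (cmod (f x))\<^sup>2) \<le> sqnorm f"
    unfolding sqnorm_def
    using L2_D(2)[OF test_L2[OF f]] integrable_mult_indicator[OF _ L2_D(2)[OF test_L2[OF f]], of "cball 0 1"]
    by (intro integral_mono) (auto simp: indicator_def)
  \<comment> \<open>With \<open>d = 1 / 16\<close> the Coulomb energy takes at most half of the kinetic energy.\<close>
  with coulomb_energy_split[OF f, of "1/16" 1 Bv]
  have "coulomb_energy f \<le> kinetic_energy Bv f / 2 + 17 * sqnorm f" by simp
  then show ?thesis unfolding energy_def right_diff_distrib by linarith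
qed

section \<open>The magnetic lower bound\<close>

lemma Re_mult_real: "Re (complex_of_real a * z) = a * Re z"
  by simp

text \<open>Integration by parts in \<open>\<integral> x\<^sub>i \<partial>\<^sub>i |f|\<^sup>2 = - \<integral> |f|\<^sup>2\<close>; this is what the linear vector potential
  contributes to the commutator of the momenta.\<close>

lemma integral_coord_Re_partial_deriv:
  assumes f: "f \<in> test_functions"
  shows "(LINT x|lborel. x $ i * Re (cnj (f x) * partial_deriv i f x)) = - sqnorm f / 2"
    and "integrable lborel (\<lambda>x. x $ i * Re (cnj (f x) * partial_deriv i f x))"
proof -
  let ?F = "\<lambda>x. complex_of_real (x $ i) * (cnj (f x) * f x)"
  let ?G = "\<lambda>x. x $ i * Re (cnj (f x) * partial_deriv i f x)"
  have F: "?F \<in> test_functions"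
    by (intro test_mult smooth_coord smooth_cnj test_smooth f)
  have d: "f differentiable (at x)" "(\<lambda>x. cnj (f x)) differentiable (at x)"
      "(\<lambda>x. complex_of_real (x $ i)) differentiable (at x)" for x
    by (rule test_differentiable[OF f] test_differentiable[OF test_cnj[OF f]]
        smooth_differentiable[OF smooth_coord])+
  have pd: "partial_deriv i ?F x = complex_of_real ((cmod (f x))\<^sup>2 + 2 * ?G x)" for x
  proof -
    show ?thesis
      unfolding partial_deriv_weighted_density[OF d(1,3)] partial_deriv_coord by simp
  qed
  have G: "(\<lambda>x. complex_of_real (x $ i) * (cnj (f x) * partial_deriv i f x)) \<in> test_functions"
    by (intro test_mult smooth_coord smooth_cnj test_smooth test_partial_deriv f)
  have "integrable lborel (\<lambda>x. Re (complex_of_real (x $ i) * (cnj (f x) * partial_deriv i f x)))"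
    using integrable_Re[OF test_integrable[OF G]] .
  then show int: "integrable lborel ?G" unfolding Re_mult_real .
  have "(LINT x|lborel. complex_of_real ((cmod (f x))\<^sup>2 + 2 * ?G x)) = 0"
    using test_integral_partial_deriv[OF F, of i] unfolding pd .
  then have "(LINT x|lborel. (cmod (f x))\<^sup>2 + 2 * ?G x) = 0"
    unfolding integral_complex_of_real of_real_eq_0_iff .
  moreover have "(LINT x|lborel. (cmod (f x))\<^sup>2 + 2 * ?G x) = sqnorm f + 2 * (LINT x|lborel. ?G x)"
    unfolding sqnorm_def
    by (subst Bochner_Integration.integral_add)
      (intro integrable_mult_right int L2_D test_L2 f | simp only: integral_mult_right_zero)+
  ultimately show "(LINT x|lborel. ?G x) = - sqnorm f / 2" by linarith
qed

lemma vector_potential_axis: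
  "((1/2) *\<^sub>R cross3 x (B *\<^sub>R axis 3 1)) $ 1 = B / 2 * x $ 2"
  "((1/2) *\<^sub>R cross3 x (B *\<^sub>R axis 3 1)) $ 2 = - B / 2 * x $ 1"
  "((1/2) *\<^sub>R cross3 x (B *\<^sub>R axis 3 1)) $ 3 = 0"
  by (simp_all add: cross3_def axis_def)

text \<open>The two transversal momenta have commutator \<open>i B\<close>, so the uncertainty relation bounds the
  kinetic energy from below by that of the lowest Landau level.\<close>

lemma Landau_lower_bound:
  assumes f: "f \<in> test_functions"
  shows "B / 2 * sqnorm f \<le> kinetic_energy (B *\<^sub>R axis 3 1) f"
proof -
  let ?K = "\<lambda>j. kinetic_momentum (B *\<^sub>R axis 3 1) j f"
  let ?G = "\<lambda>i x. x $ i * Re (cnj (f x) * partial_deriv i f x)"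
  let ?D = "\<lambda>x. cnj (partial_deriv 1 f x) * partial_deriv 2 f x"
  have K2: "?K j \<in> L2" for j by (intro test_L2 kinetic_momentum_test f)
  have D: "integrable lborel ?D"
    by (intro integrable_cnj_mult test_L2 test_partial_deriv f)
  have pt: "Im (cnj (?K 1 x) * ?K 2 x) = 1 * Im (?D x) + - (B / 2) * ?G 1 x + - (B / 2) * ?G 2 x" for x
    unfolding kinetic_momentum_def vector_potential_axis
    by (simp add: algebra_simps add_divide_distrib)
  have "Im (LINT x|lborel. ?D x) = 0"
  proof -
    have "(LINT x|lborel. ?D x) = cnj (LINT x|lborel. ?D x)"
      using L2_inner_partial_deriv_swap[OF f f, of 1 2] L2_inner_cnj[of "partial_deriv 2 f" "partial_deriv 1 f"]
      unfolding L2_inner_def by metis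
    then show ?thesis by (simp add: complex_eq_iff)
  qed
  then have "(LINT x|lborel. Im (?D x)) = 0" unfolding integral_Im[OF D] .
  then have "B / 2 * sqnorm f = (LINT x|lborel. Im (cnj (?K 1 x) * ?K 2 x))"
    unfolding pt integral_lincomb3[OF integrable_Im[OF D] integral_coord_Re_partial_deriv(2,2)[OF f]]
      integral_coord_Re_partial_deriv(1)[OF f]
    by simp
  also have "\<dots> \<le> (LINT x|lborel. ((cmod (?K 1 x))\<^sup>2 + (cmod (?K 2 x))\<^sup>2) / 2)"
  proof (rule integral_mono)
    show "integrable lborel (\<lambda>x. Im (cnj (?K 1 x) * ?K 2 x))"
      by (intro integrable_Im integrable_cnj_mult K2)
    show "integrable lborel (\<lambda>x. ((cmod (?K 1 x))\<^sup>2 + (cmod (?K 2 x))\<^sup>2) / 2)"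
      using L2_D(2)[OF K2] by simp
    fix x
    have "Im (cnj (?K 1 x) * ?K 2 x) \<le> cmod (?K 1 x) * cmod (?K 2 x)"
      using abs_Im_le_cmod[of "cnj (?K 1 x) * ?K 2 x"] by (simp add: norm_mult)
    then show "Im (cnj (?K 1 x) * ?K 2 x) \<le> ((cmod (?K 1 x))\<^sup>2 + (cmod (?K 2 x))\<^sup>2) / 2"
      using prod_le_half_sum_squares order_trans by blast
  qed
  also have "\<dots> = (sqnorm (?K 1) + sqnorm (?K 2)) / 2"
    using L2_D(2)[OF K2] by (simp add: sqnorm_def)
  also have "\<dots> \<le> kinetic_energy (B *\<^sub>R axis 3 1) f"
    using sqnorm_nonneg[of "?K 3"] unfolding kinetic_energy_def sum_3 by simp
  finally show ?thesis .
qed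

section \<open>Local compactness\<close>

lemma cball_borel [measurable]: "cball (c :: 'a::metric_space) r \<in> sets borel"
  by (simp add: borel_closed)

text \<open>The squared \<open>L\<^sup>2\<close> distance on a ball. Its values are extended nonnegative reals, so that
  measurability suffices for the triangle inequality, Fatou's lemma and Tonelli's theorem.\<close>

definition local_sqdist :: "real \<Rightarrow> wavefunction \<Rightarrow> wavefunction \<Rightarrow> ennreal" where
  "local_sqdist R f g = (\<integral>\<^sup>+x. indicator (cball 0 R) x * ennreal ((cmod (f x - g x))\<^sup>2) \<partial>lborel)"

definition sqgrad :: "wavefunction \<Rightarrow> real^3 \<Rightarrow> real" where
  "sqgrad f x = (\<Sum>j\<in>UNIV. (cmod (partial_deriv j f x))\<^sup>2)"

definition local_dirichlet :: "real \<Rightarrow> wavefunction \<Rightarrow> ennreal" where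
  "local_dirichlet R f = (\<integral>\<^sup>+x. indicator (cball 0 R) x * ennreal (sqgrad f x) \<partial>lborel)"

lemma sqgrad_nonneg: "sqgrad f x \<ge> 0"
  unfolding sqgrad_def by (simp add: sum_nonneg)

lemma local_sqdist_commute: "local_sqdist R f g = local_sqdist R g f"
  unfolding local_sqdist_def by (simp add: norm_minus_commute)

lemma local_sqdist_triangle:
  assumes [measurable]: "f \<in> borel_measurable borel" "g \<in> borel_measurable borel" "h \<in> borel_measurable borel"
  shows "local_sqdist R f h \<le> 2 * local_sqdist R f g + 2 * local_sqdist R g h"
proof -
  have pt: "ennreal ((cmod (f x - h x))\<^sup>2) \<le> 2 * ennreal ((cmod (f x - g x))\<^sup>2) + 2 * ennreal ((cmod (g x - h x))\<^sup>2)" for x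
  proof -
    have "cmod (f x - h x) \<le> cmod (f x - g x) + cmod (g x - h x)"
      using norm_triangle_ineq[of "f x - g x" "g x - h x"] by simp
    then have "(cmod (f x - h x))\<^sup>2 \<le> (cmod (f x - g x) + cmod (g x - h x))\<^sup>2"
      by (intro power_mono) auto
    also have "\<dots> \<le> 2 * (cmod (f x - g x))\<^sup>2 + 2 * (cmod (g x - h x))\<^sup>2"
      using sum_squares_bound[of "cmod (f x - g x)" "cmod (g x - h x)"] by (simp add: power2_sum)
    finally have "ennreal ((cmod (f x - h x))\<^sup>2) \<le> ennreal (2 * (cmod (f x - g x))\<^sup>2 + 2 * (cmod (g x - h x))\<^sup>2)"
      by (rule ennreal_leI)
    then show ?thesis by (simp add: ennreal_mult)
  qed
  have "local_sqdist R f h \<le> (\<integral>\<^sup>+x. 2 * (indicator (cball 0 R) x * ennreal ((cmod (f x - g x))\<^sup>2))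
      + 2 * (indicator (cball 0 R) x * ennreal ((cmod (g x - h x))\<^sup>2)) \<partial>lborel)"
    unfolding local_sqdist_def
  proof (rule nn_integral_mono)
    fix x :: "real^3"
    have "indicator (cball 0 R) x * ennreal ((cmod (f x - h x))\<^sup>2) \<le>
        indicator (cball 0 R) x * (2 * ennreal ((cmod (f x - g x))\<^sup>2) + 2 * ennreal ((cmod (g x - h x))\<^sup>2))"
      by (intro mult_left_mono pt) simp
    then show "indicator (cball 0 R) x * ennreal ((cmod (f x - h x))\<^sup>2) \<le>
        2 * (indicator (cball 0 R) x * ennreal ((cmod (f x - g x))\<^sup>2))
      + 2 * (indicator (cball 0 R) x * ennreal ((cmod (g x - h x))\<^sup>2))"
      by (simp add: algebra_simps)
  qed
  also have "\<dots> = 2 * local_sqdist R f g + 2 * local_sqdist R g h"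
  proof -
    define u v where "u x = indicator (cball 0 R) x * ennreal ((cmod (f x - g x))\<^sup>2)"
      and "v x = indicator (cball 0 R) x * ennreal ((cmod (g x - h x))\<^sup>2)" for x
    have [measurable]: "u \<in> borel_measurable lborel" "v \<in> borel_measurable lborel"
      unfolding u_def[abs_def] v_def[abs_def] by measurable
    show ?thesis
      unfolding local_sqdist_def u_def[symmetric] v_def[symmetric]
      by (simp add: nn_integral_add nn_integral_cmult)
  qed
  finally show ?thesis .
qed

lemma norm_integral_square_le:
  fixes u :: "'a \<Rightarrow> complex"
  assumes A: "A \<in> sets M" "emeasure M A < \<infinity>" and [measurable]: "u \<in> borel_measurable M"
    and u: "integrable M (\<lambda>x. indicator A x * (cmod (u x))\<^sup>2)"
  shows "integrable M (\<lambda>x. indicator A x *\<^sub>R u x)"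
    and "(cmod (LINT x|M. indicator A x *\<^sub>R u x))\<^sup>2 \<le> measure M A * (LINT x|M. indicator A x * (cmod (u x))\<^sup>2)"
proof -
  note [measurable] = A(1)
  have iA: "integrable M (indicator A :: 'a \<Rightarrow> real)"
    using A by (rule integrable_real_indicator)
  have young: "indicator A x * cmod (u x) \<le> (t * (indicator A x * (cmod (u x))\<^sup>2) + indicator A x / t) / 2"
    if "t > 0" for t x
  proof -
    have "2 * (sqrt t * cmod (u x)) * (1 / sqrt t) \<le> (sqrt t * cmod (u x))\<^sup>2 + (1 / sqrt t)\<^sup>2"
      by (rule sum_squares_bound)
    then have "2 * cmod (u x) \<le> t * (cmod (u x))\<^sup>2 + 1 / t"
      using that by (simp add: power_mult_distrib power_divide)
    then show ?thesis by (simp add: indicator_def)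
  qed
  have int: "integrable M (\<lambda>x. indicator A x * cmod (u x))"
  proof (rule Bochner_Integration.integrable_bound)
    show "integrable M (\<lambda>x. (1 * (indicator A x * (cmod (u x))\<^sup>2) + indicator A x / 1) / 2)"
      using u iA by simp
    show "AE x in M. norm (indicator A x * cmod (u x)) \<le>
        norm ((1 * (indicator A x * (cmod (u x))\<^sup>2) + indicator A x / 1) / 2)"
      using young[of 1] by (simp add: abs_mult)
  qed measurable
  show iu: "integrable M (\<lambda>x. indicator A x *\<^sub>R u x)"
  proof (rule Bochner_Integration.integrable_bound[OF int])
    show "(\<lambda>x. indicator A x *\<^sub>R u x) \<in> borel_measurable M" by measurable
  qed simp
  have le: "(LINT x|M. indicator A x * cmod (u x))\<^sup>2 \<le> (LINT x|M. indicator A x * (cmod (u x))\<^sup>2) * measure M A"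
  proof (rule power2_le_mult_of_weighted_mean)
    fix t :: real assume t: "t > 0"
    have "(LINT x|M. indicator A x * cmod (u x)) \<le>
        (LINT x|M. (t * (indicator A x * (cmod (u x))\<^sup>2) + indicator A x / t) / 2)"
      using int u iA by (intro integral_mono young t) auto
    also have "\<dots> = (t * (LINT x|M. indicator A x * (cmod (u x))\<^sup>2) + measure M A / t) / 2"
      using u iA A by (simp add: Int_absorb2 sets.sets_into_space)
    finally show "2 * (LINT x|M. indicator A x * cmod (u x)) \<le>
        t * (LINT x|M. indicator A x * (cmod (u x))\<^sup>2) + measure M A / t" by simp
  qed (auto intro!: Bochner_Integration.integral_nonneg)
  have "cmod (LINT x|M. indicator A x *\<^sub>R u x) \<le> (LINT x|M. indicator A x * cmod (u x))"
    using integral_norm_bound[of M "\<lambda>x. indicator A x *\<^sub>R u x"] by simp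
  then have "(cmod (LINT x|M. indicator A x *\<^sub>R u x))\<^sup>2 \<le> (LINT x|M. indicator A x * cmod (u x))\<^sup>2"
    by (intro power_mono) auto
  from order_trans[OF this le]
  show "(cmod (LINT x|M. indicator A x *\<^sub>R u x))\<^sup>2 \<le> measure M A * (LINT x|M. indicator A x * (cmod (u x))\<^sup>2)"
    by (simp only: mult.commute)
qed

lemma nn_norm_integral_square_le:
  fixes u :: "'a::euclidean_space \<Rightarrow> complex"
  assumes "compact A" "continuous_on UNIV u"
  shows "ennreal ((cmod (LINT x|lborel. indicator A x *\<^sub>R u x))\<^sup>2)
    \<le> ennreal (measure lborel A) * (\<integral>\<^sup>+x. indicator A x * ennreal ((cmod (u x))\<^sup>2) \<partial>lborel)"
proof -
  have c2: "continuous_on A (\<lambda>x. (cmod (u x))\<^sup>2)"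
    using assms(2) by (intro continuous_intros) (auto intro: continuous_on_subset)
  have int: "integrable lborel (\<lambda>x. indicator A x * (cmod (u x))\<^sup>2)"
    using borel_integrable_compact[OF assms(1) c2] by simp
  have "(cmod (LINT x|lborel. indicator A x *\<^sub>R u x))\<^sup>2 \<le> measure lborel A * (LINT x|lborel. indicator A x * (cmod (u x))\<^sup>2)"
    using assms by (intro norm_integral_square_le int emeasure_bounded_finite compact_imp_bounded)
      (auto intro: borel_compact borel_measurable_continuous_onI)
  then have "ennreal ((cmod (LINT x|lborel. indicator A x *\<^sub>R u x))\<^sup>2)
      \<le> ennreal (measure lborel A) * ennreal (LINT x|lborel. indicator A x * (cmod (u x))\<^sup>2)"
    by (simp add: ennreal_leI flip: ennreal_mult)
  also have "ennreal (LINT x|lborel. indicator A x * (cmod (u x))\<^sup>2) =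
      (\<integral>\<^sup>+x. ennreal (indicator A x * (cmod (u x))\<^sup>2) \<partial>lborel)"
    by (rule nn_integral_eq_integral[OF int, symmetric]) simp
  also have "\<dots> = (\<integral>\<^sup>+x. indicator A x * ennreal ((cmod (u x))\<^sup>2) \<partial>lborel)"
    by (intro nn_integral_cong) (simp add: indicator_def)
  finally show ?thesis .
qed

lemma frechet_derivative_coords:
  assumes "f differentiable (at x)"
  shows "frechet_derivative f (at x) t = (\<Sum>j\<in>UNIV. complex_of_real (t $ j) * partial_deriv j f x)"
proof -
  have lin: "linear (frechet_derivative f (at x))"
    using assms by (rule linear_frechet_derivative)
  have "t = (\<Sum>j\<in>UNIV. (t $ j) *\<^sub>R axis j 1)"
    by (simp add: vec_eq_iff axis_def if_distrib[of "(*) _"] cong: if_cong)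
  then have "frechet_derivative f (at x) t = frechet_derivative f (at x) (\<Sum>j\<in>UNIV. (t $ j) *\<^sub>R axis j 1)"
    by simp
  also have "\<dots> = (\<Sum>j\<in>UNIV. (t $ j) *\<^sub>R frechet_derivative f (at x) (axis j 1))"
    using lin by (simp add: linear_sum linear_cmul)
  finally show ?thesis by (simp add: partial_deriv_def scaleR_conv_of_real)
qed

lemma norm_directional_derivative_square_le:
  "(cmod (\<Sum>j\<in>UNIV. complex_of_real (t $ j) * partial_deriv j f x))\<^sup>2 \<le> (norm t)\<^sup>2 * sqgrad f x"
proof -
  have "cmod (\<Sum>j\<in>UNIV. complex_of_real (t $ j) * partial_deriv j f x)
      \<le> (\<Sum>j\<in>UNIV. \<bar>t $ j\<bar> * cmod (partial_deriv j f x))"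
    by (rule order_trans[OF norm_sum]) (simp add: norm_mult)
  then have "(cmod (\<Sum>j\<in>UNIV. complex_of_real (t $ j) * partial_deriv j f x))\<^sup>2
      \<le> (\<Sum>j\<in>UNIV. \<bar>t $ j\<bar> * cmod (partial_deriv j f x))\<^sup>2"
    by (intro power_mono) auto
  also have "\<dots> \<le> (\<Sum>j\<in>UNIV. \<bar>t $ j\<bar>\<^sup>2) * (\<Sum>j\<in>UNIV. (cmod (partial_deriv j f x))\<^sup>2)"
    by (rule Cauchy_Schwarz_ineq_sum)
  finally show ?thesis
    unfolding sqgrad_def norm_power2_3 by simp
qed

text \<open>The fundamental theorem of calculus along a segment, followed by the Cauchy--Schwarz
  inequality on the unit interval.\<close>

lemma increment_square_le_line_integral:
  assumes C1: "times_cont_diff (Suc 0) f"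
  shows "ennreal ((cmod (f (x + t) - f x))\<^sup>2) \<le>
    (\<integral>\<^sup>+s. indicator {0..1} s * (ennreal ((norm t)\<^sup>2) * ennreal (sqgrad f (x + s *\<^sub>R t))) \<partial>lborel)"
proof -
  define G where "G s = (\<Sum>j\<in>UNIV. complex_of_real (t $ j) * partial_deriv j f (x + s *\<^sub>R t))" for s :: real
  have d: "f differentiable (at y)" for y using C1 by simp
  have c: "continuous_on UNIV (partial_deriv j f)" for j using C1 by simp
  have cG: "continuous_on UNIV G"
    unfolding G_def by (intro continuous_intros continuous_on_compose2[OF c]) auto
  have der: "((\<lambda>s. f (x + s *\<^sub>R t)) has_vector_derivative G s) (at s)" for s
  proof -
    let ?D = "frechet_derivative f (at (x + s *\<^sub>R t))"
    have D: "(f has_derivative ?D) (at (x + s *\<^sub>R t))"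
      using d frechet_derivative_works by blast
    have l: "((\<lambda>s. x + s *\<^sub>R t) has_derivative (\<lambda>h. h *\<^sub>R t)) (at s)"
      by (auto intro!: derivative_eq_intros)
    have "((\<lambda>s. f (x + s *\<^sub>R t)) has_derivative (\<lambda>h. ?D (h *\<^sub>R t))) (at s)"
      using has_derivative_compose[OF l D] .
    moreover have "?D (h *\<^sub>R t) = h *\<^sub>R G s" for h
      using has_derivative_linear[OF D] frechet_derivative_coords[OF d]
      by (simp add: linear_cmul G_def sum_distrib_left scaleR_conv_of_real[where 'a = complex] mult.assoc)
    ultimately show ?thesis unfolding has_vector_derivative_def by simp
  qed
  have "(LINT s|lborel. indicator {0..1} s *\<^sub>R G s) = f (x + 1 *\<^sub>R t) - f (x + 0 *\<^sub>R t)"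
    by (rule integral_FTC_atLeastAtMost[of 0 1])
      (auto intro: has_vector_derivative_at_within der continuous_on_subset[OF cG])
  then have "ennreal ((cmod (f (x + t) - f x))\<^sup>2) = ennreal ((cmod (LINT s|lborel. indicator {0..1} s *\<^sub>R G s))\<^sup>2)"
    by simp
  also have "\<dots> \<le> ennreal (measure lborel {0..1::real}) * (\<integral>\<^sup>+s. indicator {0..1} s * ennreal ((cmod (G s))\<^sup>2) \<partial>lborel)"
    by (rule nn_norm_integral_square_le[OF compact_Icc cG])
  also have "\<dots> = (\<integral>\<^sup>+s. indicator {0..1} s * ennreal ((cmod (G s))\<^sup>2) \<partial>lborel)" by simp
  also have "\<dots> \<le> (\<integral>\<^sup>+s. indicator {0..1} s * (ennreal ((norm t)\<^sup>2) * ennreal (sqgrad f (x + s *\<^sub>R t))) \<partial>lborel)"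
  proof (intro nn_integral_mono mult_left_mono)
    fix s
    have "ennreal ((cmod (G s))\<^sup>2) \<le> ennreal ((norm t)\<^sup>2 * sqgrad f (x + s *\<^sub>R t))"
      unfolding G_def by (intro ennreal_leI norm_directional_derivative_square_le)
    then show "ennreal ((cmod (G s))\<^sup>2) \<le> ennreal ((norm t)\<^sup>2) * ennreal (sqgrad f (x + s *\<^sub>R t))"
      by (simp add: ennreal_mult sqgrad_nonneg)
  qed simp
  finally show ?thesis .
qed

lemma sqgrad_measurable:
  assumes "times_cont_diff (Suc 0) f"
  shows "sqgrad f \<in> borel_measurable borel"
proof -
  have "continuous_on UNIV (sqgrad f)"
    unfolding sqgrad_def[abs_def] using assms by (intro continuous_intros) auto
  then show ?thesis by (rule borel_measurable_continuous_onI)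
qed

text \<open>Integrating the pointwise bound over \<open>x\<close> and exchanging integrals leaves translates of the
  gradient, which live on a ball enlarged by \<open>|t|\<close>.\<close>

lemma L2_translation_le_dirichlet:
  assumes C1: "times_cont_diff (Suc 0) f"
  shows "(\<integral>\<^sup>+x. indicator (cball 0 R) x * ennreal ((cmod (f (x + t) - f x))\<^sup>2) \<partial>lborel)
    \<le> ennreal ((norm t)\<^sup>2) * local_dirichlet (R + norm t) f"
proof -
  note [measurable] = sqgrad_measurable[OF C1]
  let ?h = "\<lambda>(s::real) (x::real^3). indicator (cball 0 R) x * (indicator {0..1} s * (ennreal ((norm t)\<^sup>2) * ennreal (sqgrad f (x + s *\<^sub>R t))))"
  have "(\<integral>\<^sup>+x. indicator (cball 0 R) x * ennreal ((cmod (f (x + t) - f x))\<^sup>2) \<partial>lborel)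
      \<le> (\<integral>\<^sup>+x. indicator (cball 0 R) x * (\<integral>\<^sup>+s. indicator {0..1} s * (ennreal ((norm t)\<^sup>2) * ennreal (sqgrad f (x + s *\<^sub>R t))) \<partial>lborel) \<partial>lborel)"
    by (intro nn_integral_mono mult_left_mono increment_square_le_line_integral C1) simp
  also have "\<dots> = (\<integral>\<^sup>+x. (\<integral>\<^sup>+s. ?h s x \<partial>lborel) \<partial>lborel)"
    by (subst nn_integral_cmult) auto
  also have "\<dots> = (\<integral>\<^sup>+s. (\<integral>\<^sup>+x. ?h s x \<partial>lborel) \<partial>lborel)"
    by (rule lborel_pair.Fubini') measurable
  also have "\<dots> \<le> (\<integral>\<^sup>+s. indicator {0..1::real} s * (ennreal ((norm t)\<^sup>2) * local_dirichlet (R + norm t) f) \<partial>lborel)"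
  proof (rule nn_integral_mono)
    fix s :: real
    show "(\<integral>\<^sup>+x. ?h s x \<partial>lborel) \<le> indicator {0..1} s * (ennreal ((norm t)\<^sup>2) * local_dirichlet (R + norm t) f)"
    proof (cases "s \<in> {0..1}")
      case True
      let ?g = "\<lambda>y::real^3. ennreal ((norm t)\<^sup>2) * (indicator (cball 0 (R + norm t)) y * ennreal (sqgrad f y))"
      have "(\<integral>\<^sup>+x. ?h s x \<partial>lborel) \<le> (\<integral>\<^sup>+x. ?g (x + s *\<^sub>R t) \<partial>lborel)"
      proof (rule nn_integral_mono)
        fix x :: "real^3"
        have "norm (x + s *\<^sub>R t) \<le> R + norm t" if "norm x \<le> R"
        proof -
          have "norm (s *\<^sub>R t) \<le> 1 * norm t"
            using True unfolding norm_scaleR by (intro mult_right_mono) auto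
          then show ?thesis using norm_triangle_ineq[of x "s *\<^sub>R t"] that by simp
        qed
        then show "?h s x \<le> ?g (x + s *\<^sub>R t)"
          using True by (auto simp: indicator_def)
      qed
      also have "\<dots> = (\<integral>\<^sup>+x. ?g x \<partial>lborel)"
        by (rule nn_integral_translation) measurable
      also have "\<dots> = ennreal ((norm t)\<^sup>2) * local_dirichlet (R + norm t) f"
        unfolding local_dirichlet_def by (rule nn_integral_cmult) measurable
      finally show ?thesis using True by simp
    qed simp
  qed
  also have "\<dots> = ennreal ((norm t)\<^sup>2) * local_dirichlet (R + norm t) f"
    by (subst nn_integral_multc) auto
  finally show ?thesis .
qed

text \<open>The dyadic cells of side \<open>1 / 2 ^ k\<close>. Neighbouring cells share faces, but \<open>cell_index\<close> assigns exactly
  one cell to each point.\<close>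

definition cell :: "nat \<Rightarrow> int^3 \<Rightarrow> (real^3) set" where
  "cell k z = cbox (\<chi> i. of_int (z $ i) / 2 ^ k) (\<chi> i. (of_int (z $ i) + 1) / 2 ^ k)"

definition cell_index :: "nat \<Rightarrow> real^3 \<Rightarrow> int^3" where
  "cell_index k x = (\<chi> i. \<lfloor>x $ i * 2 ^ k\<rfloor>)"

definition cell_integral :: "wavefunction \<Rightarrow> nat \<times> (int^3) \<Rightarrow> complex" where
  "cell_integral f = (\<lambda>(k, z). LINT y|lborel. indicator (cell k z) y *\<^sub>R f y)"

definition cell_average :: "nat \<Rightarrow> wavefunction \<Rightarrow> wavefunction" where
  "cell_average k f x = 8 ^ k * cell_integral f (k, cell_index k x)"

lemma measure_cell: "measure lborel (cell k z) = 1 / 8 ^ k"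
proof -
  have "cell k z \<noteq> {}"
    unfolding cell_def interval_ne_empty_cart by (simp add: divide_right_mono)
  then have "measure lborel (cell k z) = (\<Prod>i\<in>(UNIV::3 set). (of_int (z $ i) + 1) / 2 ^ k - of_int (z $ i) / 2 ^ k)"
    unfolding cell_def by (subst content_cbox_cart) simp_all
  also have "\<dots> = (\<Prod>i\<in>(UNIV::3 set). 1 / 2 ^ k)"
    by (intro prod.cong refl) (simp add: add_divide_distrib)
  also have "\<dots> = 1 / 8 ^ k"
    by (simp add: power_divide flip: power_mult) (simp add: mult.commute[of k] power_mult)
  finally show ?thesis .
qed

lemma compact_cell: "compact (cell k z)"
  unfolding cell_def by (rule compact_cbox)

lemma mem_cell_index: "y \<in> cell k (cell_index k x) \<longleftrightarrow>
    (\<forall>i. of_int \<lfloor>x $ i * 2 ^ k\<rfloor> \<le> y $ i * 2 ^ k \<and> y $ i * 2 ^ k \<le> of_int \<lfloor>x $ i * 2 ^ k\<rfloor> + 1)"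
  unfolding cell_def cell_index_def mem_box_cart by (simp add: field_simps)

lemma cell_diff:
  assumes "y \<in> cell k (cell_index k x)"
  shows "\<bar>y $ i - x $ i\<bar> \<le> 1 / 2 ^ k"
proof -
  have "\<bar>y $ i * 2 ^ k - x $ i * 2 ^ k\<bar> \<le> 1"
  proof -
    have "of_int \<lfloor>x $ i * 2 ^ k\<rfloor> \<le> y $ i * 2 ^ k \<and> y $ i * 2 ^ k \<le> of_int \<lfloor>x $ i * 2 ^ k\<rfloor> + 1"
      using assms unfolding mem_cell_index by blast
    moreover have "of_int \<lfloor>x $ i * 2 ^ k\<rfloor> \<le> x $ i * 2 ^ k" "x $ i * 2 ^ k \<le> of_int \<lfloor>x $ i * 2 ^ k\<rfloor> + 1"
      by linarith+
    ultimately show ?thesis unfolding abs_le_iff by linarith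
  qed
  then have "\<bar>y $ i - x $ i\<bar> * 2 ^ k \<le> 1"
    by (simp add: abs_mult flip: left_diff_distrib)
  then show ?thesis by (simp add: field_simps)
qed

lemma cell_average_measurable [measurable]:
  assumes [measurable]: "f \<in> borel_measurable borel"
  shows "cell_average k f \<in> borel_measurable borel"
proof -
  have 1: "indicator (cell k (cell_index k x)) y *\<^sub>R f y =
    (if (\<forall>i\<in>UNIV. of_int \<lfloor>x $ i * 2 ^ k\<rfloor> \<le> y $ i * 2 ^ k \<and> y $ i * 2 ^ k \<le> of_int \<lfloor>x $ i * 2 ^ k\<rfloor> + 1) then f y else 0)" for x y :: "real^3"
    using mem_cell_index[of y k x] by (simp add: indicator_def)
  have [measurable]: "(\<lambda>x::real^3. x $ i) \<in> borel_measurable borel" for i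
    by (intro borel_measurable_continuous_onI continuous_intros)
  have "(\<lambda>x::real^3. LINT y|lborel. (if (\<forall>i\<in>UNIV. of_int \<lfloor>x $ i * 2 ^ k\<rfloor> \<le> y $ i * 2 ^ k \<and> y $ i * 2 ^ k \<le> of_int \<lfloor>x $ i * 2 ^ k\<rfloor> + 1) then f y else 0))
      \<in> borel_measurable borel"
    by measurable
  then show ?thesis
    unfolding cell_average_def[abs_def] cell_integral_def 1[symmetric] by simp
qed

text \<open>The difference to the average over a cell is an average of increments \<open>f x - f y\<close>. Each \<open>y\<close> in the
  cell of \<open>x\<close> is \<open>x + t\<close> with \<open>t\<close> in the cube \<open>Q\<close>, so the translation bound applies for every \<open>t\<close>.
  The factor 32 is 8 from the volume of \<open>Q\<close> relative to a cell times 4 from \<open>|t|\<^sup>2 \<le> 4 / 4 ^ k\<close>, and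
  \<open>|t| \<le> 2\<close> accounts for the enlarged radius.\<close>

lemma L2_cell_average_le_dirichlet:
  assumes C1: "times_cont_diff (Suc 0) f"
  shows "local_sqdist R f (cell_average k f) \<le> ennreal (32 / 4 ^ k) * local_dirichlet (R + 2) f"
proof -
  have cf: "continuous_on UNIV f" using times_cont_diff_SucD[OF C1] by simp
  note [measurable] = borel_measurable_continuous_onI[OF cf]
  define Q :: "(real^3) set" where "Q = cbox (\<chi> i. - (1 / 2 ^ k)) (\<chi> i. 1 / 2 ^ k)"
  have Q_meas [measurable]: "Q \<in> sets borel" unfolding Q_def by simp
  have mQ: "emeasure lborel Q = ennreal (8 / 8 ^ k)"
  proof -
    have "Q \<noteq> {}"
      unfolding Q_def interval_ne_empty_cart by simp
    then have "measure lborel Q = (\<Prod>i\<in>(UNIV::3 set). 1 / 2 ^ k - - (1 / 2 ^ k))"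
      unfolding Q_def by (subst content_cbox_cart) simp_all
    also have "\<dots> = (\<Prod>i\<in>(UNIV::3 set). 2 / 2 ^ k)" by simp
    also have "\<dots> = 8 / 8 ^ k"
      by (simp add: power_divide flip: power_mult) (simp add: mult.commute[of k] power_mult)
    finally have "measure lborel Q = 8 / 8 ^ k" .
    moreover have "emeasure lborel Q = ennreal (measure lborel Q)"
      unfolding Q_def
      by (intro emeasure_eq_ennreal_measure) (metis emeasure_lborel_cbox_finite infinity_ennreal_def less_irrefl)
    ultimately show ?thesis by simp
  qed
  have Q_norm: "norm t \<le> 2 / 2 ^ k" if "t \<in> Q" for t
  proof -
    have "(t $ i)\<^sup>2 \<le> (1 / 2 ^ k)\<^sup>2" for i
    proof -
      have "\<bar>t $ i\<bar> \<le> 1 / 2 ^ k"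
        using that unfolding Q_def mem_box_cart by (auto simp: abs_le_iff dest: spec[of _ i])
      then show ?thesis by (metis abs_ge_zero power2_abs power_mono)
    qed
    then have "(norm t)\<^sup>2 \<le> (\<Sum>i\<in>(UNIV::3 set). (1 / 2 ^ k)\<^sup>2)"
      unfolding norm_power2_3 by (intro sum_mono) simp
    also have "\<dots> \<le> (2 / 2 ^ k)\<^sup>2" by (simp add: power_divide divide_right_mono)
    finally show ?thesis by (rule power2_le_imp_le) simp
  qed
  have pt: "ennreal ((cmod (f x - cell_average k f x))\<^sup>2) \<le>
      ennreal (8 ^ k) * (\<integral>\<^sup>+t. indicator Q t * ennreal ((cmod (f (x + t) - f x))\<^sup>2) \<partial>lborel)" for x
  proof -
    let ?C = "cell k (cell_index k x)"
    have C: "?C \<in> sets lborel" "emeasure lborel ?C < \<infinity>"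
      using compact_cell emeasure_lborel_cbox_finite unfolding cell_def by auto
    have if': "integrable lborel (\<lambda>y. indicator ?C y *\<^sub>R f y)"
      by (intro borel_integrable_compact compact_cell continuous_on_subset[OF cf]) auto
    have ic: "integrable lborel (\<lambda>y. indicator ?C y *\<^sub>R f x)"
      by (intro borel_integrable_compact compact_cell continuous_intros)
    have I: "(LINT y|lborel. indicator ?C y *\<^sub>R (f x - f y)) = (1 / 8 ^ k) *\<^sub>R f x - cell_integral f (k, cell_index k x)"
      unfolding cell_integral_def scaleR_diff_right using if' ic C
      by (simp add: measure_cell)
    have "f x - cell_average k f x = 8 ^ k * (LINT y|lborel. indicator ?C y *\<^sub>R (f x - f y))"
      unfolding I by (simp add: cell_average_def scaleR_conv_of_real right_diff_distrib)
    then have "(cmod (f x - cell_average k f x))\<^sup>2 = (8 ^ k)\<^sup>2 * (cmod (LINT y|lborel. indicator ?C y *\<^sub>R (f x - f y)))\<^sup>2"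
      by (simp add: norm_mult norm_power power_mult_distrib)
    then have "ennreal ((cmod (f x - cell_average k f x))\<^sup>2) = ennreal ((8 ^ k)\<^sup>2) * ennreal ((cmod (LINT y|lborel. indicator ?C y *\<^sub>R (f x - f y)))\<^sup>2)"
      by (simp add: ennreal_mult)
    also have "\<dots> \<le> ennreal ((8 ^ k)\<^sup>2) * (ennreal (measure lborel ?C) *
        (\<integral>\<^sup>+y. indicator ?C y * ennreal ((cmod (f x - f y))\<^sup>2) \<partial>lborel))"
      by (intro mult_left_mono nn_norm_integral_square_le compact_cell continuous_intros cf) simp
    also have "\<dots> = ennreal (8 ^ k) * (\<integral>\<^sup>+y. indicator ?C y * ennreal ((cmod (f x - f y))\<^sup>2) \<partial>lborel)"
      unfolding mult.assoc[symmetric] measure_cell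
      by (subst ennreal_mult[symmetric]) (simp_all add: power2_eq_square)
    also have "\<dots> \<le> ennreal (8 ^ k) * (\<integral>\<^sup>+y. indicator Q (y - x) * ennreal ((cmod (f (x + (y - x)) - f x))\<^sup>2) \<partial>lborel)"
    proof (intro mult_left_mono nn_integral_mono)
      fix y
      have "y - x \<in> Q" if "y \<in> ?C"
      proof -
        have "- (1 / 2 ^ k) \<le> y $ i - x $ i \<and> y $ i - x $ i \<le> 1 / 2 ^ k" for i
          using cell_diff[OF that, of i] unfolding abs_le_iff by linarith
        then show ?thesis unfolding Q_def mem_box_cart by simp
      qed
      then show "indicator ?C y * ennreal ((cmod (f x - f y))\<^sup>2) \<le> indicator Q (y - x) * ennreal ((cmod (f (x + (y - x)) - f x))\<^sup>2)"
        by (auto simp: indicator_def norm_minus_commute)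
    qed simp
    also have "(\<integral>\<^sup>+y. indicator Q (y - x) * ennreal ((cmod (f (x + (y - x)) - f x))\<^sup>2) \<partial>lborel)
        = (\<integral>\<^sup>+t. indicator Q t * ennreal ((cmod (f (x + t) - f x))\<^sup>2) \<partial>lborel)"
      using nn_integral_translation[of "\<lambda>t. indicator Q t * ennreal ((cmod (f (x + t) - f x))\<^sup>2)" "- x"] by simp
    finally show ?thesis .
  qed
  let ?h = "\<lambda>x t. ennreal (8 ^ k) * (indicator Q t * (indicator (cball 0 R) x * ennreal ((cmod (f (x + t) - f x))\<^sup>2)))"
  have "local_sqdist R f (cell_average k f) \<le>
      (\<integral>\<^sup>+x. indicator (cball 0 R) x * (ennreal (8 ^ k) * (\<integral>\<^sup>+t. indicator Q t * ennreal ((cmod (f (x + t) - f x))\<^sup>2) \<partial>lborel)) \<partial>lborel)"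
    unfolding local_sqdist_def by (intro nn_integral_mono mult_left_mono pt) simp
  also have "\<dots> = (\<integral>\<^sup>+x. (\<integral>\<^sup>+t. ?h x t \<partial>lborel) \<partial>lborel)"
    by (intro nn_integral_cong) (simp add: mult_ac flip: nn_integral_cmult)
  also have "\<dots> = (\<integral>\<^sup>+t. (\<integral>\<^sup>+x. ?h x t \<partial>lborel) \<partial>lborel)"
    by (rule lborel_pair.Fubini'[symmetric]) measurable
  also have "\<dots> \<le> (\<integral>\<^sup>+t. indicator Q t * (ennreal (8 ^ k) * (ennreal (4 / 4 ^ k) * local_dirichlet (R + 2) f)) \<partial>lborel)"
  proof (rule nn_integral_mono)
    fix t :: "real^3"
    show "(\<integral>\<^sup>+x. ?h x t \<partial>lborel) \<le> indicator Q t * (ennreal (8 ^ k) * (ennreal (4 / 4 ^ k) * local_dirichlet (R + 2) f))"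
    proof (cases "t \<in> Q")
      case True
      have "(norm t)\<^sup>2 \<le> (2 / 2 ^ k)\<^sup>2" using Q_norm[OF True] by (intro power_mono) auto
      also have "\<dots> = 4 / 4 ^ k" by (simp add: power_divide flip: power_mult) (simp add: mult.commute[of k] power_mult)
      finally have 1: "(norm t)\<^sup>2 \<le> 4 / 4 ^ k" .
      have "norm t \<le> 2 / 2 ^ k" by (rule Q_norm[OF True])
      also have "\<dots> \<le> 2 / 1" by (intro divide_left_mono) auto
      finally have 2: "cball 0 (R + norm t) \<subseteq> cball (0::real^3) (R + 2)" by auto
      have "(\<integral>\<^sup>+x. ?h x t \<partial>lborel) = ennreal (8 ^ k) * (\<integral>\<^sup>+x. indicator (cball 0 R) x * ennreal ((cmod (f (x + t) - f x))\<^sup>2) \<partial>lborel)"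
      proof -
        have "(\<lambda>x. indicator (cball 0 R) x * ennreal ((cmod (f (x + t) - f x))\<^sup>2)) \<in> borel_measurable lborel"
          by measurable
        from nn_integral_cmult[OF this, of "ennreal (8 ^ k)"] show ?thesis using True by simp
      qed
      also have "\<dots> \<le> ennreal (8 ^ k) * (ennreal ((norm t)\<^sup>2) * local_dirichlet (R + norm t) f)"
        by (intro mult_left_mono L2_translation_le_dirichlet C1) simp
      also have "\<dots> \<le> ennreal (8 ^ k) * (ennreal (4 / 4 ^ k) * local_dirichlet (R + 2) f)"
        unfolding local_dirichlet_def using 1 2
        by (intro mult_left_mono mult_mono ennreal_leI nn_integral_mono mult_right_mono)
          (auto simp: indicator_def)
      finally show ?thesis using True by simp
    qed simp
  qed
  also have "\<dots> = ennreal (8 / 8 ^ k) * (ennreal (8 ^ k) * (ennreal (4 / 4 ^ k) * local_dirichlet (R + 2) f))"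
    by (subst nn_integral_multc) (auto simp: mQ)
  also have "\<dots> = ennreal (32 / 4 ^ k) * local_dirichlet (R + 2) f"
  proof -
    have "ennreal (8 / 8 ^ k) * ennreal (8 ^ k) * ennreal (4 / 4 ^ k) = ennreal (8 / 8 ^ k * 8 ^ k * (4 / 4 ^ k))"
      by (simp only: ennreal_mult divide_nonneg_nonneg mult_nonneg_nonneg zero_le_power zero_le_numeral)
    then show ?thesis unfolding mult.assoc[symmetric] by simp
  qed
  finally show ?thesis .
qed

lemma ennreal_le_of_vanishing_error:
  fixes X A :: ennreal
  assumes "\<And>n. X \<le> A + ennreal c * e n" "e \<longlonglongrightarrow> 0"
  shows "X \<le> A"
proof -
  have "(\<lambda>n. A + ennreal c * e n) \<longlonglongrightarrow> A + ennreal c * 0"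
    by (intro tendsto_add tendsto_const ennreal_tendsto_cmult assms) simp
  from LIMSEQ_le_const[OF this, of X] show ?thesis using assms(1) by simp
qed

text \<open>The bound holds for every \<open>k\<close>; letting first \<open>n\<close> and then \<open>k\<close> tend to infinity bounds the limit
  superior by 0.\<close>

lemma ennreal_tendsto_0_of_double_limit:
  fixes s :: "nat \<Rightarrow> ennreal"
  assumes le: "\<And>k n. s n \<le> b k + ennreal c * e k n" and e: "\<And>k. e k \<longlonglongrightarrow> 0" and b: "b \<longlonglongrightarrow> 0"
  shows "s \<longlonglongrightarrow> 0"
proof -
  have "limsup s \<le> b k" for k
  proof -
    have "(\<lambda>n. b k + ennreal c * e k n) \<longlonglongrightarrow> b k + ennreal c * 0"
      by (intro tendsto_add tendsto_const ennreal_tendsto_cmult e) simp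
    then have "limsup (\<lambda>n. b k + ennreal c * e k n) = b k"
      using lim_imp_Limsup[of sequentially] by fastforce
    moreover have "limsup s \<le> limsup (\<lambda>n. b k + ennreal c * e k n)"
      by (intro Limsup_mono always_eventually allI le)
    ultimately show ?thesis by simp
  qed
  then have "limsup s \<le> 0"
    using LIMSEQ_le_const[OF b] by blast
  then have "limsup s = 0" by simp
  moreover have "liminf s \<le> limsup s" by (rule Liminf_le_Limsup) simp
  ultimately show ?thesis
    by (intro Liminf_eq_Limsup) auto
qed

lemma summable_of_weighted_squares:
  fixes d :: "nat \<Rightarrow> real"
  assumes "summable (\<lambda>k. 2 ^ k * (d k)\<^sup>2)" "\<And>k. d k \<ge> 0"
  shows "summable d"
proof (rule summable_comparison_test')
  show "summable (\<lambda>k. (2 ^ k * (d k)\<^sup>2 + (1 / 2) ^ k) / 2)"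
    by (intro summable_divide summable_add assms summable_geometric) simp
  fix k
  have "2 * (sqrt (2 ^ k) * d k) * (1 / sqrt (2 ^ k)) \<le> (sqrt (2 ^ k) * d k)\<^sup>2 + (1 / sqrt (2 ^ k))\<^sup>2"
    by (rule sum_squares_bound)
  then have "2 * d k \<le> 2 ^ k * (d k)\<^sup>2 + 1 / 2 ^ k"
    by (simp add: power_mult_distrib power_divide)
  then show "norm (d k) \<le> (2 ^ k * (d k)\<^sup>2 + (1 / 2) ^ k) / 2"
    using assms(2)[of k] by (simp add: power_one_over)
qed

lemma convergent_of_summable_increments:
  fixes F :: "nat \<Rightarrow> complex"
  assumes "summable (\<lambda>k. cmod (F (Suc k) - F k))"
  shows "convergent F"
proof -
  have "summable (\<lambda>k. F (Suc k) - F k)"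
    using assms by (rule summable_norm_cancel)
  then have "convergent (\<lambda>n. \<Sum>k<n. F (Suc k) - F k)"
    by (simp add: summable_iff_convergent)
  then have "convergent (\<lambda>n. (F n - F 0) + F 0)"
    unfolding sum_lessThan_telescope by (intro convergent_add convergent_const)
  then show ?thesis by simp
qed

text \<open>Completeness of \<open>L\<^sup>2\<close> on balls. The geometric rate makes the weighted squared increments
  \<open>2 ^ k |F (k + 1) - F k|\<^sup>2\<close> summable almost everywhere, hence the sequence converges pointwise; by
  Fatou's lemma the rate passes to the limit.\<close>

lemma local_L2_complete:
  assumes [measurable]: "\<And>k. F k \<in> borel_measurable borel"
    and cauchy: "\<And>R k m. k \<le> m \<Longrightarrow> local_sqdist R (F m) (F k) \<le> ennreal (C R / 4 ^ k)"
    and C: "\<And>R. C R \<ge> 0"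
  obtains \<psi> where "\<psi> \<in> borel_measurable borel"
    and "\<And>R k. local_sqdist R (F k) \<psi> \<le> ennreal (C R / 4 ^ k)"
proof -
  define \<psi> where "\<psi> x = lim (\<lambda>k. F k x)" for x
  have \<psi> [measurable]: "\<psi> \<in> borel_measurable borel"
    unfolding \<psi>_def[abs_def] by (rule borel_measurable_lim_metric) measurable
  have conv: "AE x in lborel. x \<in> cball 0 R \<longrightarrow> (\<lambda>k. F k x) \<longlonglongrightarrow> \<psi> x" for R
  proof -
    let ?u = "\<lambda>k x. indicator (cball 0 R) x * ennreal ((cmod (F (Suc k) x - F k x))\<^sup>2)"
    have "(\<integral>\<^sup>+x. (\<Sum>k. ennreal (2 ^ k) * ?u k x) \<partial>lborel) = (\<Sum>k. \<integral>\<^sup>+x. ennreal (2 ^ k) * ?u k x \<partial>lborel)"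
      by (rule nn_integral_suminf) measurable
    also have "\<dots> = (\<Sum>k. ennreal (2 ^ k) * local_sqdist R (F (Suc k)) (F k))"
      unfolding local_sqdist_def by (intro suminf_cong nn_integral_cmult) measurable
    also have "\<dots> \<le> (\<Sum>k. ennreal (C R * (1 / 2) ^ k))"
    proof (intro suminf_le allI)
      fix k
      have "ennreal (2 ^ k) * local_sqdist R (F (Suc k)) (F k) \<le> ennreal (2 ^ k) * ennreal (C R / 4 ^ k)"
        by (intro mult_left_mono cauchy) auto
      also have "\<dots> = ennreal (2 ^ k * (C R / 4 ^ k))"
        using C[of R] by (intro ennreal_mult[symmetric]) auto
      also have "2 ^ k * (C R / 4 ^ k) = C R * (1 / 2) ^ k"
      proof -
        have "(4::real) ^ k = 2 ^ k * 2 ^ k" by (simp flip: power_mult_distrib)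
        then show ?thesis by (simp add: power_one_over)
      qed
      finally show "ennreal (2 ^ k) * local_sqdist R (F (Suc k)) (F k) \<le> ennreal (C R * (1 / 2) ^ k)" .
    qed auto
    also have "\<dots> = ennreal (\<Sum>k. C R * (1 / 2) ^ k)"
      using C[of R] by (intro suminf_ennreal2 summable_mult summable_geometric) auto
    also have "\<dots> < \<infinity>" by simp
    finally have "(\<integral>\<^sup>+x. (\<Sum>k. ennreal (2 ^ k) * ?u k x) \<partial>lborel) \<noteq> \<infinity>" by simp
    then have "AE x in lborel. (\<Sum>k. ennreal (2 ^ k) * ?u k x) \<noteq> \<infinity>"
      by (intro nn_integral_PInf_AE) auto
    then show ?thesis
    proof eventually_elim
      case (elim x)
      show ?case
      proof
        assume x: "x \<in> cball 0 R"
        have "(\<Sum>k. ennreal (2 ^ k * (cmod (F (Suc k) x - F k x))\<^sup>2)) \<noteq> \<infinity>"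
          using elim x by (simp add: ennreal_mult)
        then have "summable (\<lambda>k. 2 ^ k * (cmod (F (Suc k) x - F k x))\<^sup>2)"
          by (intro summable_suminf_not_top) auto
        then have "summable (\<lambda>k. cmod (F (Suc k) x - F k x))"
          by (rule summable_of_weighted_squares) simp
        then have "convergent (\<lambda>k. F k x)"
          by (rule convergent_of_summable_increments)
        then show "(\<lambda>k. F k x) \<longlonglongrightarrow> \<psi> x"
          unfolding \<psi>_def by (simp add: convergent_LIMSEQ_iff)
      qed
    qed
  qed
  have "local_sqdist R (F k) \<psi> \<le> ennreal (C R / 4 ^ k)" for R k
  proof -
    let ?v = "\<lambda>m x. indicator (cball 0 R) x * ennreal ((cmod (F k x - F m x))\<^sup>2)"
    have "local_sqdist R (F k) \<psi> \<le> (\<integral>\<^sup>+x. liminf (\<lambda>m. ?v m x) \<partial>lborel)"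
      unfolding local_sqdist_def
    proof (rule nn_integral_mono_AE)
      show "AE x in lborel. indicator (cball 0 R) x * ennreal ((cmod (F k x - \<psi> x))\<^sup>2) \<le> liminf (\<lambda>m. ?v m x)"
        using conv[of R]
      proof eventually_elim
        case (elim x)
        show ?case
        proof (cases "x \<in> cball 0 R")
          case True
          then have "(\<lambda>m. ennreal ((cmod (F k x - F m x))\<^sup>2)) \<longlonglongrightarrow> ennreal ((cmod (F k x - \<psi> x))\<^sup>2)"
            using elim by (intro tendsto_ennrealI tendsto_intros) auto
          from lim_imp_Liminf[OF _ this] True show ?thesis by simp
        qed simp
      qed
    qed
    also have "\<dots> \<le> liminf (\<lambda>m. \<integral>\<^sup>+x. ?v m x \<partial>lborel)"
      by (rule nn_integral_liminf) measurable
    also have "\<dots> = liminf (\<lambda>m. local_sqdist R (F m) (F k))"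
      by (simp add: local_sqdist_def norm_minus_commute)
    also have "\<dots> \<le> liminf (\<lambda>m. ennreal (C R / 4 ^ k))"
      using cauchy by (intro Liminf_mono eventually_sequentiallyI[of k])
    also have "\<dots> = ennreal (C R / 4 ^ k)" by (simp add: Liminf_const)
    finally show ?thesis .
  qed
  with \<psi> show ?thesis by (rule that)
qed

lemma cell_integral_le_1:
  assumes cf: "continuous_on UNIV f" and L2: "(\<integral>\<^sup>+x. ennreal ((cmod (f x))\<^sup>2) \<partial>lborel) \<le> 1"
  shows "cmod (cell_integral f p) \<le> 1"
proof -
  obtain k z where p: "p = (k, z)" by (cases p)
  have "ennreal ((cmod (cell_integral f p))\<^sup>2) \<le>
      ennreal (measure lborel (cell k z)) * (\<integral>\<^sup>+x. indicator (cell k z) x * ennreal ((cmod (f x))\<^sup>2) \<partial>lborel)"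
    unfolding p cell_integral_def prod.case by (rule nn_norm_integral_square_le[OF compact_cell cf])
  also have "\<dots> \<le> ennreal 1 * (\<integral>\<^sup>+x. ennreal ((cmod (f x))\<^sup>2) \<partial>lborel)"
    unfolding measure_cell
    by (intro mult_mono ennreal_leI nn_integral_mono) (auto simp: indicator_def)
  also have "\<dots> \<le> 1" using L2 by simp
  finally have "(cmod (cell_integral f p))\<^sup>2 \<le> 1" by simp
  then show ?thesis by (simp add: power2_le_iff_abs_le abs_square_le_1)
qed

text \<open>Rellich's theorem. There are countably many dyadic cells, so along a diagonal subsequence the
  integrals over all of them converge, and the cell averages at each fixed scale converge in \<open>L\<^sup>2\<close> of
  every ball. The Dirichlet bound keeps each function close to its averages at fine scales,
  uniformly along the sequence.\<close>

theorem local_Rellich: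
  fixes f :: "nat \<Rightarrow> wavefunction"
  assumes C1: "\<And>n. times_cont_diff (Suc 0) (f n)"
    and L2: "\<And>n. (\<integral>\<^sup>+x. ennreal ((cmod (f n x))\<^sup>2) \<partial>lborel) \<le> 1"
    and grad: "\<And>R n. local_dirichlet R (f n) \<le> ennreal (D R)"
  obtains \<kappa> \<psi> where "strict_mono \<kappa>" "\<psi> \<in> borel_measurable borel"
    "(\<integral>\<^sup>+x. ennreal ((cmod (\<psi> x))\<^sup>2) \<partial>lborel) \<le> 2"
    "\<And>R. (\<lambda>n. local_sqdist R (f (\<kappa> n)) \<psi>) \<longlonglongrightarrow> 0"
proof -
  have cf: "continuous_on UNIV (f n)" for n using times_cont_diff_SucD[OF C1] by simp
  note [measurable] = borel_measurable_continuous_onI[OF cf]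
  obtain \<kappa> where \<kappa>: "strict_mono (\<kappa> :: nat \<Rightarrow> nat)"
    and lim: "\<And>p. p \<in> UNIV \<Longrightarrow> \<exists>l. (\<lambda>n. cell_integral (f (\<kappa> n)) p) \<longlonglongrightarrow> l"
    by (rule function_convergent_subsequence[of "UNIV :: (nat \<times> (int^3)) set" "\<lambda>n. cell_integral (f n)" 1])
      (auto intro: cell_integral_le_1 cf L2)
  define g where "g n = f (\<kappa> n)" for n
  have C1g: "times_cont_diff (Suc 0) (g n)" for n unfolding g_def by (rule C1)
  have cg: "continuous_on UNIV (g n)" for n unfolding g_def by (rule cf)
  have g [measurable]: "g n \<in> borel_measurable borel" for n unfolding g_def by measurable
  have L2g: "(\<integral>\<^sup>+x. ennreal ((cmod (g n x))\<^sup>2) \<partial>lborel) \<le> 1" for n unfolding g_def by (rule L2)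
  define F where "F k x = lim (\<lambda>n. cell_average k (g n) x)" for k x
  have F_lim: "(\<lambda>n. cell_average k (g n) x) \<longlonglongrightarrow> F k x" for k x
  proof -
    have "convergent (\<lambda>n. cell_integral (g n) (k, cell_index k x))"
      using lim unfolding convergent_def g_def by blast
    then have "convergent (\<lambda>n. cell_average k (g n) x)"
      unfolding cell_average_def by (intro convergent_mult convergent_const)
    then show ?thesis unfolding F_def by (simp add: convergent_LIMSEQ_iff)
  qed
  have F [measurable]: "F k \<in> borel_measurable borel" for k
    by (rule borel_measurable_LIMSEQ_metric[OF _ F_lim]) measurable
  have avg_le: "cmod (cell_average k (g n) x) \<le> 8 ^ k" for k n x
    using cell_integral_le_1[OF cg L2g, of n "(k, cell_index k x)"]
    by (simp add: cell_average_def norm_mult norm_power)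
  have F_le: "cmod (F k x) \<le> 8 ^ k" for k x
    by (rule LIMSEQ_le_const2[OF tendsto_norm[OF F_lim]]) (use avg_le in auto)
  have avg_F: "(\<lambda>n. local_sqdist R (cell_average k (g n)) (F k)) \<longlonglongrightarrow> 0" for R k
  proof -
    have "(\<lambda>n. local_sqdist R (cell_average k (g n)) (F k)) \<longlonglongrightarrow> (\<integral>\<^sup>+x. 0 \<partial>(lborel :: (real^3) measure))"
      unfolding local_sqdist_def
    proof (rule nn_integral_dominated_convergence)
      let ?w = "\<lambda>x::real^3. ennreal ((2 * 8 ^ k)\<^sup>2) * indicator (cball 0 R) x"
      show "(\<integral>\<^sup>+x. ?w x \<partial>lborel) < \<infinity>"
        using emeasure_lborel_cball_finite[of "0::real^3" R]
        by (simp add: nn_integral_cmult_indicator ennreal_mult_less_top)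
      have "(cmod (cell_average k (g n) x - F k x))\<^sup>2 \<le> (2 * 8 ^ k)\<^sup>2" for n x
        using norm_triangle_ineq4[of "cell_average k (g n) x" "F k x"] avg_le[of k n x] F_le[of k x]
        by (intro power_mono) auto
      then show "AE x in lborel. indicator (cball 0 R) x * ennreal ((cmod (cell_average k (g n) x - F k x))\<^sup>2) \<le> ?w x" for n
        by (auto simp: indicator_def intro!: ennreal_leI)
      have "(\<lambda>n. ennreal ((cmod (cell_average k (g n) x - F k x))\<^sup>2)) \<longlonglongrightarrow> ennreal ((cmod (F k x - F k x))\<^sup>2)" for x
        by (intro tendsto_ennrealI tendsto_intros F_lim)
      then show "AE x in lborel. (\<lambda>n. indicator (cball 0 R) x * ennreal ((cmod (cell_average k (g n) x - F k x))\<^sup>2)) \<longlonglongrightarrow> 0"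
        by (auto simp: indicator_def)
    qed measurable
    then show ?thesis by simp
  qed
  define a where "a R k = 32 * \<bar>D (R + 2)\<bar> / 4 ^ k" for R k
  have a_nonneg: "a R k \<ge> 0" for R k by (simp add: a_def)
  have g_avg: "local_sqdist R (g n) (cell_average k (g n)) \<le> ennreal (a R k)" for R n k
  proof -
    have "local_sqdist R (g n) (cell_average k (g n)) \<le> ennreal (32 / 4 ^ k) * local_dirichlet (R + 2) (g n)"
      by (rule L2_cell_average_le_dirichlet[OF C1g])
    also have "\<dots> \<le> ennreal (32 / 4 ^ k) * ennreal \<bar>D (R + 2)\<bar>"
      using grad[of "R + 2" "\<kappa> n"] unfolding g_def
      by (intro mult_left_mono order_trans[OF grad] ennreal_leI) auto
    also have "\<dots> = ennreal (a R k)" by (simp add: a_def flip: ennreal_mult)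
    finally show ?thesis .
  qed
  have g_F: "local_sqdist R (g n) (F k) \<le> ennreal (2 * a R k) + ennreal 2 * local_sqdist R (cell_average k (g n)) (F k)" for R n k
  proof -
    have "local_sqdist R (g n) (F k) \<le> 2 * local_sqdist R (g n) (cell_average k (g n)) + 2 * local_sqdist R (cell_average k (g n)) (F k)"
      by (rule local_sqdist_triangle) measurable
    also have "\<dots> \<le> 2 * ennreal (a R k) + 2 * local_sqdist R (cell_average k (g n)) (F k)"
      by (intro add_right_mono mult_left_mono g_avg) simp
    finally show ?thesis using a_nonneg by (simp add: ennreal_mult)
  qed
  \<comment> \<open>Two limits of averages are compared through \<open>g n\<close> itself, with \<open>n\<close> tending to infinity.\<close>
  have F_F: "local_sqdist R (F m) (F k) \<le> ennreal (8 * a R 0 / 4 ^ k)" if "k \<le> m" for R k m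
  proof -
    have 1: "local_sqdist R (F m) (F k) \<le> ennreal (4 * a R m + 4 * a R k) +
        ennreal 4 * (local_sqdist R (cell_average m (g n)) (F m) + local_sqdist R (cell_average k (g n)) (F k))" for n
    proof -
      have "local_sqdist R (F m) (F k) \<le> 2 * local_sqdist R (F m) (g n) + 2 * local_sqdist R (g n) (F k)"
        by (rule local_sqdist_triangle) measurable
      also have "\<dots> = 2 * local_sqdist R (g n) (F m) + 2 * local_sqdist R (g n) (F k)"
        by (simp add: local_sqdist_commute[of R "F m"])
      also have "\<dots> \<le> 2 * (ennreal (2 * a R m) + ennreal 2 * local_sqdist R (cell_average m (g n)) (F m))
          + 2 * (ennreal (2 * a R k) + ennreal 2 * local_sqdist R (cell_average k (g n)) (F k))"
        by (intro add_mono mult_left_mono g_F) auto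
      also have "\<dots> = ennreal (4 * a R m + 4 * a R k) +
        ennreal 4 * (local_sqdist R (cell_average m (g n)) (F m) + local_sqdist R (cell_average k (g n)) (F k))"
        using a_nonneg[of R m] a_nonneg[of R k] by (simp add: ennreal_mult distrib_left mult.assoc[symmetric] add_ac)
      finally show ?thesis .
    qed
    have "local_sqdist R (F m) (F k) \<le> ennreal (4 * a R m + 4 * a R k)"
    proof (rule ennreal_le_of_vanishing_error[OF 1])
      show "(\<lambda>n. local_sqdist R (cell_average m (g n)) (F m) + local_sqdist R (cell_average k (g n)) (F k)) \<longlonglongrightarrow> 0"
        using tendsto_add[OF avg_F avg_F] by simp
    qed
    also have "\<dots> \<le> ennreal (8 * a R 0 / 4 ^ k)"
    proof (rule ennreal_leI)
      have "a R m \<le> a R k"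
        unfolding a_def using that by (intro divide_left_mono) (auto intro: power_increasing)
      then show "4 * a R m + 4 * a R k \<le> 8 * a R 0 / 4 ^ k"
        by (simp add: a_def)
    qed
    finally show ?thesis .
  qed
  obtain \<psi> where \<psi> [measurable]: "\<psi> \<in> borel_measurable borel"
    and F_\<psi>: "\<And>R k. local_sqdist R (F k) \<psi> \<le> ennreal (8 * a R 0 / 4 ^ k)"
    using local_L2_complete[of F "\<lambda>R. 8 * a R 0", OF F F_F] a_nonneg by auto
  have conv: "(\<lambda>n. local_sqdist R (g n) \<psi>) \<longlonglongrightarrow> 0" for R
  proof (rule ennreal_tendsto_0_of_double_limit)
    show "local_sqdist R (g n) \<psi> \<le> ennreal (20 * a R 0 / 4 ^ k) + ennreal 4 * local_sqdist R (cell_average k (g n)) (F k)" for k n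
    proof -
      define y where "y = 8 * a R 0 / 4 ^ k"
      have y: "y \<ge> 0" using a_nonneg[of R 0] by (simp add: y_def)
      have F_y: "local_sqdist R (F k) \<psi> \<le> ennreal y"
        unfolding y_def by (rule F_\<psi>)
      have "local_sqdist R (g n) \<psi> \<le> 2 * local_sqdist R (g n) (F k) + 2 * local_sqdist R (F k) \<psi>"
        by (rule local_sqdist_triangle) measurable
      also have "\<dots> \<le> 2 * (ennreal (2 * a R k) + ennreal 2 * local_sqdist R (cell_average k (g n)) (F k)) + 2 * ennreal y"
        by (intro add_mono mult_left_mono g_F F_y) auto
      also have "\<dots> = ennreal (2 * (2 * a R k) + 2 * y) + ennreal 4 * local_sqdist R (cell_average k (g n)) (F k)"
        using a_nonneg[of R k] y by (simp add: ennreal_mult distrib_left mult.assoc[symmetric] add_ac)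
      also have "2 * (2 * a R k) + 2 * y = 20 * a R 0 / 4 ^ k"
        by (simp add: a_def y_def)
      finally show ?thesis .
    qed
    show "(\<lambda>k. ennreal (20 * a R 0 / 4 ^ k)) \<longlonglongrightarrow> 0"
    proof -
      have "(\<lambda>k. 20 * a R 0 * (1 / 4) ^ k) \<longlonglongrightarrow> 20 * a R 0 * 0"
        by (intro tendsto_mult tendsto_const LIMSEQ_power_zero) simp
      then have "(\<lambda>k. ennreal (20 * a R 0 / 4 ^ k)) \<longlonglongrightarrow> ennreal 0"
        by (intro tendsto_ennrealI) (simp add: power_one_over)
      then show ?thesis by simp
    qed
  qed (rule avg_F)
  have \<psi>2: "(\<integral>\<^sup>+x. ennreal ((cmod (\<psi> x))\<^sup>2) \<partial>lborel) \<le> 2"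
  proof -
    let ?v = "\<lambda>m x. indicator (cball 0 (real m)) x * ennreal ((cmod (\<psi> x))\<^sup>2)"
    have loc: "(\<integral>\<^sup>+x. ?v m x \<partial>lborel) \<le> 2" for m
    proof (rule ennreal_le_of_vanishing_error[OF _ conv])
      fix n
      have "(\<integral>\<^sup>+x. ?v m x \<partial>lborel) = local_sqdist (real m) \<psi> (\<lambda>_. 0)"
        unfolding local_sqdist_def by simp
      also have "\<dots> \<le> 2 * local_sqdist (real m) \<psi> (g n) + 2 * local_sqdist (real m) (g n) (\<lambda>_. 0)"
        by (rule local_sqdist_triangle) measurable
      also have "local_sqdist (real m) (g n) (\<lambda>_. 0) \<le> (\<integral>\<^sup>+x. ennreal ((cmod (g n x))\<^sup>2) \<partial>lborel)"
        unfolding local_sqdist_def by (intro nn_integral_mono) (auto simp: indicator_def)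
      also have "\<dots> \<le> 1" by (rule L2g)
      finally show "(\<integral>\<^sup>+x. ?v m x \<partial>lborel) \<le> 2 + ennreal 2 * local_sqdist (real m) (g n) \<psi>"
        by (simp add: local_sqdist_commute[of _ \<psi>] add.commute add_mono mult_left_mono)
    qed
    have "(\<integral>\<^sup>+x. ennreal ((cmod (\<psi> x))\<^sup>2) \<partial>lborel) \<le> (\<integral>\<^sup>+x. liminf (\<lambda>m. ?v m x) \<partial>lborel)"
    proof (rule nn_integral_mono)
      fix x :: "real^3"
      have "eventually (\<lambda>m. ?v m x = ennreal ((cmod (\<psi> x))\<^sup>2)) sequentially"
        using eventually_ge_at_top[of "nat \<lceil>norm x\<rceil>"]
        by eventually_elim (auto simp: indicator_def nat_le_iff ceiling_le_iff)
      then have "(\<lambda>m. ?v m x) \<longlonglongrightarrow> ennreal ((cmod (\<psi> x))\<^sup>2)"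
        by (rule tendsto_eventually)
      from lim_imp_Liminf[OF _ this]
      show "ennreal ((cmod (\<psi> x))\<^sup>2) \<le> liminf (\<lambda>m. ?v m x)" by simp
    qed
    also have "\<dots> \<le> liminf (\<lambda>m. \<integral>\<^sup>+x. ?v m x \<partial>lborel)"
      by (rule nn_integral_liminf) measurable
    also have "\<dots> \<le> 2" using loc by (intro Liminf_le) auto
    finally show ?thesis .
  qed
  show ?thesis
    by (rule that[OF \<kappa> \<psi> \<psi>2 conv[unfolded g_def]])
qed

section \<open>A smooth bump function\<close>

lemma smooth_exp:
  assumes "smooth (\<lambda>x. complex_of_real (p x))"
  shows "smooth (\<lambda>x. complex_of_real (exp (p x)))"
  by (rule smooth_of_real_comp[OF assms, where H = "\<lambda>_. exp" and n = 0]) (rule DERIV_exp)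

lemma smooth_sqrt:
  assumes sp: "smooth (\<lambda>x. complex_of_real (p x))" and pos: "\<And>x. p x > 0"
  shows "smooth (\<lambda>x. complex_of_real (sqrt (p x)))"
proof -
  let ?H = "\<lambda>n t. (\<Prod>i<n. 1 / 2 - real i) * t powr (1 / 2 - real n)"
  have "smooth (\<lambda>x. complex_of_real (?H 0 (p x)))"
  proof (rule smooth_of_real_comp[OF sp, where H = ?H])
    fix n x
    show "(?H n has_real_derivative ?H (Suc n) (p x)) (at (p x))"
      using pos[of x] by (auto intro!: derivative_eq_intros simp: algebra_simps)
  qed
  then show ?thesis using pos by (simp add: powr_half_sqrt less_imp_le)
qed

text \<open>The \<open>n\<close>-th derivative of \<open>exp (- 1 / t)\<close> is a polynomial in \<open>1 / t\<close> times \<open>exp (- 1 / t)\<close>; these are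
  the polynomials.\<close>

fun bump_poly :: "nat \<Rightarrow> real poly" where
  "bump_poly 0 = 1"
| "bump_poly (Suc n) = [:0, 0, 1:] * (bump_poly n - pderiv (bump_poly n))"

definition bump :: "nat \<Rightarrow> real \<Rightarrow> real" where
  "bump n t = (if t > 0 then poly (bump_poly n) (1 / t) * exp (- 1 / t) else 0)"

lemma poly_times_exp_tendsto_0: "((\<lambda>y::real. poly q y * exp (- y)) \<longlongrightarrow> 0) at_top"
proof -
  have "((\<lambda>y::real. \<Sum>i\<le>degree q. coeff q i * (y ^ i / exp y)) \<longlongrightarrow> (\<Sum>i\<le>degree q. coeff q i * 0)) at_top"
    by (intro tendsto_sum tendsto_mult tendsto_const tendsto_power_div_exp_0)
  then show ?thesis
    by (simp add: poly_altdef sum_distrib_right exp_minus divide_inverse mult.assoc)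
qed

text \<open>At 0 the difference quotient from the right is of the form \<open>q (1 / h) exp (- 1 / h)\<close>, which tends
  to 0 because the exponential dominates every polynomial.\<close>

lemma bump_has_derivative: "(bump n has_real_derivative bump (Suc n) t) (at t)"
proof -
  consider "t > 0" | "t < 0" | "t = 0" by linarith
  then show ?thesis
  proof cases
    case 1
    have "((\<lambda>t. poly (bump_poly n) (1 / t) * exp (- 1 / t)) has_real_derivative bump (Suc n) t) (at t)"
      using 1 by (auto intro!: derivative_eq_intros
          simp: bump_def field_simps power2_eq_square)
    moreover have "eventually (\<lambda>s. bump n s = poly (bump_poly n) (1 / s) * exp (- 1 / s)) (nhds t)"
      using eventually_nhds_in_open[of "{0<..}" t] 1 by (auto simp: bump_def elim: eventually_mono)
    ultimately show ?thesis by (subst DERIV_cong_ev[OF refl _ refl])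
  next
    case 2
    have "eventually (\<lambda>s. bump n s = 0) (nhds t)"
      using eventually_nhds_in_open[of "{..<0}" t] 2 by (auto simp: bump_def elim: eventually_mono)
    then have "(bump n has_real_derivative 0) (at t)"
      by (subst DERIV_cong_ev[OF refl _ refl]) auto
    then show ?thesis using 2 by (simp add: bump_def)
  next
    case 3
    have "((\<lambda>h. (bump n (0 + h) - bump n 0) / h) \<longlongrightarrow> 0) (at 0)"
      unfolding filterlim_at_split
    proof
      have "eventually (\<lambda>h::real. (bump n (0 + h) - bump n 0) / h = 0) (at_left 0)"
        by (auto simp: eventually_at_filter bump_def)
      then show "((\<lambda>h. (bump n (0 + h) - bump n 0) / h) \<longlongrightarrow> 0) (at_left 0)"
        by (rule tendsto_eventually)
      have "((\<lambda>h. poly (pCons 0 (bump_poly n)) (inverse h) * exp (- inverse h)) \<longlongrightarrow> 0) (at_right (0::real))"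
        by (rule filterlim_compose[OF poly_times_exp_tendsto_0 filterlim_inverse_at_top_right])
      moreover have "eventually (\<lambda>h::real. poly (pCons 0 (bump_poly n)) (inverse h) * exp (- inverse h)
          = (bump n (0 + h) - bump n 0) / h) (at_right 0)"
        by (auto simp: eventually_at_filter bump_def divide_inverse)
      ultimately show "((\<lambda>h. (bump n (0 + h) - bump n 0) / h) \<longlongrightarrow> 0) (at_right 0)"
        by (rule Lim_transform_eventually)
    qed
    then show ?thesis using 3 by (simp add: DERIV_def bump_def)
  qed
qed

lemma bump_bounds:
  "bump 0 t \<ge> 0" "bump 0 t \<le> 1" "\<bar>bump (Suc 0) t\<bar> \<le> 2"
  "t \<le> 0 \<Longrightarrow> bump n t = 0" "t \<ge> 3 / 4 \<Longrightarrow> bump 0 t \<ge> exp (- (4 / 3))"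
proof -
  show "bump 0 t \<ge> 0" "bump 0 t \<le> 1" "t \<le> 0 \<Longrightarrow> bump n t = 0"
    by (simp_all add: bump_def)
  show "\<bar>bump (Suc 0) t\<bar> \<le> 2"
  proof (cases "t > 0")
    case True
    define y where "y = 1 / t"
    have y: "y > 0" using True by (simp add: y_def)
    have "y\<^sup>2 / 2 \<le> exp y" using exp_lower_Taylor_quadratic[of y] y by linarith
    then have "y\<^sup>2 * exp (- y) \<le> 2" by (simp add: exp_minus field_simps)
    moreover have "bump (Suc 0) t = y\<^sup>2 * exp (- y)"
      using True by (simp add: bump_def y_def power2_eq_square)
    ultimately show ?thesis by simp
  qed (simp add: bump_def)
  show "bump 0 t \<ge> exp (- (4 / 3))" if "t \<ge> 3 / 4"
  proof -
    have "1 / t \<le> 4 / 3" using that by (simp add: field_simps)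
    then show ?thesis using that by (simp add: bump_def)
  qed
qed

lemma smooth_bump:
  assumes "smooth (\<lambda>x. complex_of_real (p x))"
  shows "smooth (\<lambda>x. complex_of_real (bump n (p x)))"
  by (rule smooth_of_real_comp[OF assms]) (rule bump_has_derivative)

section \<open>Energy of a truncated positive function\<close>

text \<open>For real \<open>\<eta>\<close> and \<open>\<phi> = exp (- S)\<close>, integration by parts moves the derivatives off the cutoff \<open>\<eta>\<close>.
  The energy of \<open>\<eta> \<phi>\<close> becomes the mean of the local energy \<open>(H \<phi>) / \<phi>\<close> in the state \<open>\<eta> \<phi>\<close>, plus the
  localization error \<open>\<integral> |\<nabla> \<eta>|\<^sup>2 \<phi>\<^sup>2 / 2\<close>. The lemma gives the contribution of one component of
  the kinetic momentum.\<close>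

lemma sqnorm_kinetic_momentum_truncated:
  fixes \<eta> S dX dS ddS :: "real^3 \<Rightarrow> real" and Bv :: "real^3"
  assumes sX: "smooth (\<lambda>x. complex_of_real (\<eta> x))" and sS: "smooth (\<lambda>x. complex_of_real (S x))"
    and supp: "\<And>x. norm x > R \<Longrightarrow> \<eta> x = 0"
    and dX: "\<And>x. partial_deriv j (\<lambda>x. complex_of_real (\<eta> x)) x = complex_of_real (dX x)"
    and dS: "\<And>x. partial_deriv j (\<lambda>x. complex_of_real (S x)) x = complex_of_real (dS x)"
    and ddS: "\<And>x. partial_deriv j (\<lambda>x. complex_of_real (dS x)) x = complex_of_real (ddS x)"
  defines "u \<equiv> \<lambda>x. complex_of_real (\<eta> x * exp (- S x))"
    and "w \<equiv> \<lambda>x. ((dX x)\<^sup>2 + (ddS x - (dS x)\<^sup>2 + (((1/2) *\<^sub>R cross3 x Bv) $ j)\<^sup>2) * (\<eta> x)\<^sup>2) * (exp (- S x))\<^sup>2"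
  shows "integrable lborel w" and "sqnorm (kinetic_momentum Bv j u) = (LINT x|lborel. w x)"
proof -
  let ?\<phi> = "\<lambda>x. exp (- S x)"
  let ?A = "\<lambda>x. ((1/2) *\<^sub>R cross3 x Bv) $ j"
  have sS': "smooth (\<lambda>x. complex_of_real (- S x))"
    using smooth_mult[OF smooth_const[of "- 1"] sS] by simp
  have s\<phi>: "smooth (\<lambda>x. complex_of_real (?\<phi> x))" by (rule smooth_exp[OF sS'])
  have su: "smooth u" unfolding u_def of_real_mult by (intro smooth_mult sX s\<phi>)
  have u: "u \<in> test_functions"
    unfolding test_function_iff using su supp by (auto simp: u_def)
  have sdS: "smooth (\<lambda>x. complex_of_real (dS x))"
    using smooth_partial_deriv[OF sS, of j] unfolding dS[abs_def] .
  have d\<phi>: "partial_deriv j (\<lambda>x. complex_of_real (?\<phi> x)) x = complex_of_real (- ?\<phi> x * dS x)" for x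
  proof -
    have "partial_deriv j (\<lambda>x. complex_of_real (- S x)) x = complex_of_real (- dS x)"
      using partial_deriv_cmult[OF smooth_differentiable[OF sS], of j "- 1" x] by (simp add: dS)
    then show ?thesis
      using of_real_comp_chain(2)[OF smooth_differentiable[OF sS'] DERIV_exp, of j x] by simp
  qed
  have du: "partial_deriv j u x = complex_of_real ((dX x - \<eta> x * dS x) * ?\<phi> x)" for x
    unfolding u_def of_real_mult
      partial_deriv_mult[OF smooth_differentiable[OF sX] smooth_differentiable[OF s\<phi>]] dX d\<phi>
    by (simp add: algebra_simps)
  \<comment> \<open>The divergence term whose vanishing integral trades \<open>|\<partial>\<^sub>j u|\<^sup>2\<close> for \<open>w\<close>.\<close>
  define V where "V x = complex_of_real (dS x) * (u x * u x)" for x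
  have V: "V \<in> test_functions"
    unfolding V_def[abs_def] by (intro test_mult sdS su u)
  define v where "v x = (ddS x * (\<eta> x)\<^sup>2 + 2 * dS x * \<eta> x * (dX x - \<eta> x * dS x)) * (?\<phi> x)\<^sup>2" for x
  have dV: "partial_deriv j V x = complex_of_real (v x)" for x
  proof -
    have "partial_deriv j V x = complex_of_real (ddS x) * (u x * u x)
        + complex_of_real (dS x) * (partial_deriv j u x * u x + u x * partial_deriv j u x)"
      unfolding V_def[abs_def]
        partial_deriv_mult[OF smooth_differentiable[OF sdS] smooth_differentiable[OF smooth_mult[OF su su]]]
        partial_deriv_mult[OF smooth_differentiable[OF su] smooth_differentiable[OF su]] ddS ..
    also have "\<dots> = complex_of_real (ddS x * (\<eta> x * ?\<phi> x * (\<eta> x * ?\<phi> x))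
        + dS x * ((dX x - \<eta> x * dS x) * ?\<phi> x * (\<eta> x * ?\<phi> x) + \<eta> x * ?\<phi> x * ((dX x - \<eta> x * dS x) * ?\<phi> x)))"
      unfolding du by (simp only: u_def of_real_add of_real_mult)
    also have "ddS x * (\<eta> x * ?\<phi> x * (\<eta> x * ?\<phi> x))
        + dS x * ((dX x - \<eta> x * dS x) * ?\<phi> x * (\<eta> x * ?\<phi> x) + \<eta> x * ?\<phi> x * ((dX x - \<eta> x * dS x) * ?\<phi> x)) = v x"
      by (simp add: v_def algebra_simps power2_eq_square)
    finally show ?thesis .
  qed
  have v: "integrable lborel v" "(LINT x|lborel. v x) = 0"
  proof -
    have "integrable lborel (\<lambda>x. complex_of_real (v x))"
      using test_integrable[OF test_partial_deriv[OF V, of j]] unfolding dV[abs_def] .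
    then show "integrable lborel v" by (simp add: complex_of_real_integrable_eq)
    have "(LINT x|lborel. complex_of_real (v x)) = 0"
      using test_integral_partial_deriv[OF V, of j] unfolding dV[abs_def] .
    then show "(LINT x|lborel. v x) = 0" unfolding integral_complex_of_real of_real_eq_0_iff .
  qed
  have K: "integrable lborel (\<lambda>x. (cmod (kinetic_momentum Bv j u x))\<^sup>2)"
    by (intro L2_D test_L2 kinetic_momentum_test u)
  have eq: "w x = (cmod (kinetic_momentum Bv j u x))\<^sup>2 + v x" for x
  proof -
    have "kinetic_momentum Bv j u x = Complex (?A x * (\<eta> x * ?\<phi> x)) (- ((dX x - \<eta> x * dS x) * ?\<phi> x))"
      unfolding kinetic_momentum_def du by (simp add: u_def complex_eq_iff)
    then have "(cmod (kinetic_momentum Bv j u x))\<^sup>2 = (?A x * (\<eta> x * ?\<phi> x))\<^sup>2 + ((dX x - \<eta> x * dS x) * ?\<phi> x)\<^sup>2"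
      by (simp add: cmod_power2)
    then show ?thesis
      by (simp add: w_def v_def algebra_simps power2_eq_square)
  qed
  show "integrable lborel w"
    unfolding eq[abs_def] by (intro Bochner_Integration.integrable_add K v)
  show "sqnorm (kinetic_momentum Bv j u) = (LINT x|lborel. w x)"
    unfolding eq sqnorm_def using K v by simp
qed

section \<open>The trial function\<close>

text \<open>With \<open>s = \<surd>(r\<^sup>2 + e\<^sup>2)\<close>, two gains are available on the right: \<open>1 / r\<close> exceeds \<open>1 / s + e\<^sup>2 / (2 s\<^sup>3)\<close>,
  and the fraction \<open>1 - a\<close> of \<open>1 / r\<close> remains to absorb the last term. The latter is where
  \<open>e = 2 (1 - a)\<close> comes from, together with \<open>e \<le> s\<close>.\<close>

lemma smoothed_coulomb_inequality:
  fixes a r s :: real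
  assumes a: "0 < a" "a < 1" and r: "r > 0" and s: "s > 0" "s\<^sup>2 = r\<^sup>2 + (2 * (1 - a))\<^sup>2"
  shows "a / s + a * (2 * (1 - a))\<^sup>2 / (2 * s ^ 3) + a\<^sup>2 * (2 * (1 - a))\<^sup>2 / (2 * s\<^sup>2) \<le> 1 / r"
proof -
  define e where "e = 2 * (1 - a)"
  have e: "e > 0" "s\<^sup>2 = r\<^sup>2 + e\<^sup>2" using a s by (simp_all add: e_def)
  have rs: "r \<le> s" by (rule power2_le_imp_le) (use e s in auto)
  have es: "e \<le> s" by (rule power2_le_imp_le) (use e s in auto)
  have 1: "r \<le> s - e\<^sup>2 / (2 * s)"
  proof -
    have "e\<^sup>2 = (s - r) * (s + r)" using e(2) by (simp add: algebra_simps power2_eq_square)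
    also have "\<dots> \<le> (s - r) * (2 * s)" using rs by (intro mult_left_mono) auto
    finally have "e\<^sup>2 / (2 * s) \<le> s - r" using s by (simp add: field_simps)
    then show ?thesis by linarith
  qed
  have "(1 / s + e\<^sup>2 / (2 * s ^ 3)) * r \<le> (1 / s + e\<^sup>2 / (2 * s ^ 3)) * (s - e\<^sup>2 / (2 * s))"
    using s by (intro mult_left_mono 1 add_nonneg_nonneg) auto
  also have "\<dots> = 1 - (e\<^sup>2 / (2 * s\<^sup>2))\<^sup>2"
    using s by (simp add: field_simps power2_eq_square power3_eq_cube)
  also have "\<dots> \<le> 1" by simp
  finally have 2: "1 / s + e\<^sup>2 / (2 * s ^ 3) \<le> 1 / r" using r by (simp add: field_simps)
  have "a * (1 / s + e\<^sup>2 / (2 * s ^ 3)) \<le> a * (1 / r)" using a by (intro mult_left_mono 2) auto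
  moreover have "a\<^sup>2 * e\<^sup>2 / (2 * s\<^sup>2) \<le> (1 - a) * (1 / r)"
  proof -
    have "a\<^sup>2 * e\<^sup>2 / (2 * s\<^sup>2) = a\<^sup>2 * (e / 2) * (e / s) * (1 / s)"
      by (simp add: power2_eq_square)
    also have "e / 2 = 1 - a" by (simp add: e_def)
    also have "a\<^sup>2 * (1 - a) * (e / s) * (1 / s) = a\<^sup>2 * ((1 - a) * (e / s) * (1 / s))"
      by (simp only: mult.assoc)
    also have "\<dots> \<le> 1 * ((1 - a) * 1 * (1 / r))"
      using a e es s r rs
      by (intro mult_mono) (auto simp: power_le_one frac_le intro!: mult_nonneg_nonneg)
    finally show ?thesis by simp
  qed
  ultimately have "a * (1 / s + e\<^sup>2 / (2 * s ^ 3)) + a\<^sup>2 * e\<^sup>2 / (2 * s\<^sup>2) \<le> a * (1 / r) + (1 - a) * (1 / r)"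
    by linarith
  also have "\<dots> = (a + (1 - a)) * (1 / r)" by (simp only: distrib_right)
  also have "\<dots> = 1 / r" by simp
  finally show ?thesis by (simp add: e_def algebra_simps)
qed

definition smoothed_norm :: "real \<Rightarrow> real^3 \<Rightarrow> real" where
  "smoothed_norm a x = sqrt ((norm x)\<^sup>2 + (2 * (1 - a))\<^sup>2)"

text \<open>Writing the Landau exponent \<open>B (x\<^sub>1\<^sup>2 + x\<^sub>2\<^sup>2) / 4\<close> with coefficients that vanish along the field axis
  gives one formula for the derivatives in all three directions.\<close>

definition landau_coeff :: "real \<Rightarrow> 3 \<Rightarrow> real" where
  "landau_coeff B j = (if j = 3 then 0 else B / 2)"

definition trial_exponent :: "real \<Rightarrow> real \<Rightarrow> real^3 \<Rightarrow> real" where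
  "trial_exponent a B x = a * smoothed_norm a x + (\<Sum>j\<in>UNIV. landau_coeff B j * (x $ j)\<^sup>2) / 2"

lemma smoothed_norm_facts:
  assumes "0 < a" "a < 1"
  shows "smoothed_norm a x > 0" "(smoothed_norm a x)\<^sup>2 = (norm x)\<^sup>2 + (2 * (1 - a))\<^sup>2"
    "smoothed_norm a x \<ge> norm x"
proof -
  have "(norm x)\<^sup>2 + (2 * (1 - a))\<^sup>2 > 0" using assms by (intro add_nonneg_pos) auto
  then show "smoothed_norm a x > 0" "(smoothed_norm a x)\<^sup>2 = (norm x)\<^sup>2 + (2 * (1 - a))\<^sup>2"
    by (simp_all add: smoothed_norm_def)
  show "smoothed_norm a x \<ge> norm x"
    unfolding smoothed_norm_def by (rule real_le_rsqrt) simp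
qed

lemma smooth_smoothed_norm:
  assumes a: "0 < a" "a < 1"
  shows "smooth (\<lambda>x. complex_of_real (smoothed_norm a x))"
    and "partial_deriv j (\<lambda>x. complex_of_real (smoothed_norm a x)) x = complex_of_real (x $ j / smoothed_norm a x)"
    and "smooth (\<lambda>x. complex_of_real (1 / smoothed_norm a x))"
    and "partial_deriv j (\<lambda>x. complex_of_real (1 / smoothed_norm a x)) x = complex_of_real (- (x $ j) / smoothed_norm a x ^ 3)"
proof -
  let ?p = "\<lambda>x::real^3. (norm x)\<^sup>2 + (2 * (1 - a))\<^sup>2"
  have p: "?p x > 0" for x using a by (intro add_nonneg_pos) auto
  have sp: "smooth (\<lambda>x. complex_of_real (?p x))"
    using smooth_add[OF smooth_power2_norm smooth_const[of "complex_of_real ((2 * (1 - a))\<^sup>2)"]] by simp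
  have dp: "partial_deriv j (\<lambda>x. complex_of_real (?p x)) x = complex_of_real (2 * x $ j)" for j x
    unfolding of_real_add
      partial_deriv_add[OF smooth_differentiable[OF smooth_power2_norm] smooth_differentiable[OF smooth_const]]
      partial_deriv_power2_norm partial_deriv_const by simp
  show ss: "smooth (\<lambda>x. complex_of_real (smoothed_norm a x))"
    unfolding smoothed_norm_def by (rule smooth_sqrt[OF sp p])
  have "(sqrt has_real_derivative inverse (smoothed_norm a x) / 2) (at (?p x))"
    unfolding smoothed_norm_def by (rule DERIV_real_sqrt[OF p])
  from of_real_comp_chain(2)[OF smooth_differentiable[OF sp] this, of j]
  show ds: "partial_deriv j (\<lambda>x. complex_of_real (smoothed_norm a x)) x = complex_of_real (x $ j / smoothed_norm a x)"
    unfolding dp smoothed_norm_def[symmetric] by (simp add: field_simps)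
  have pos: "smoothed_norm a x > 0" for x by (rule smoothed_norm_facts[OF a])
  show "smooth (\<lambda>x. complex_of_real (1 / smoothed_norm a x))"
    by (rule smooth_inverse[OF ss]) (use pos in \<open>metis less_irrefl\<close>)
  have "((\<lambda>t. 1 / t) has_real_derivative - ((1 / smoothed_norm a x)\<^sup>2)) (at (smoothed_norm a x))"
    using pos[of x] by (auto intro!: derivative_eq_intros simp: power2_eq_square)
  from of_real_comp_chain(2)[OF smooth_differentiable[OF ss] this, of j]
  show "partial_deriv j (\<lambda>x. complex_of_real (1 / smoothed_norm a x)) x = complex_of_real (- (x $ j) / smoothed_norm a x ^ 3)"
    unfolding ds by (simp add: power2_eq_square power3_eq_cube)
qed

definition trial_slope :: "real \<Rightarrow> real \<Rightarrow> 3 \<Rightarrow> real^3 \<Rightarrow> real" where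
  "trial_slope a B j x = x $ j * (a * (1 / smoothed_norm a x) + landau_coeff B j)"

definition trial_curvature :: "real \<Rightarrow> real \<Rightarrow> 3 \<Rightarrow> real^3 \<Rightarrow> real" where
  "trial_curvature a B j x = a / smoothed_norm a x + landau_coeff B j - a * (x $ j)\<^sup>2 / smoothed_norm a x ^ 3"

lemma trial_exponent_derivs:
  assumes a: "0 < a" "a < 1"
  shows "smooth (\<lambda>x. complex_of_real (trial_exponent a B x))"
    and "partial_deriv j (\<lambda>x. complex_of_real (trial_exponent a B x)) x = complex_of_real (trial_slope a B j x)"
    and "partial_deriv j (\<lambda>x. complex_of_real (trial_slope a B j x)) x = complex_of_real (trial_curvature a B j x)"
proof -
  note s = smooth_smoothed_norm[OF a]
  let ?q = "\<lambda>i x. complex_of_real (x $ i) * complex_of_real (x $ i)"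
  let ?c = "\<lambda>i. complex_of_real (landau_coeff B i / 2)"
  have sq: "smooth (?q i)" for i by (intro smooth_mult smooth_coord)
  have dq: "partial_deriv j (?q i) x = (if i = j then complex_of_real (2 * x $ j) else 0)" for i j x
    unfolding partial_deriv_mult[OF smooth_differentiable[OF smooth_coord] smooth_differentiable[OF smooth_coord]] partial_deriv_coord
    by simp
  have e: "(\<lambda>x. complex_of_real (trial_exponent a B x)) =
      (\<lambda>x. complex_of_real a * complex_of_real (smoothed_norm a x) + ?c 1 * ?q 1 x + ?c 2 * ?q 2 x + ?c 3 * ?q 3 x)"
    by (simp add: fun_eq_iff trial_exponent_def sum_3 power2_eq_square add_divide_distrib)
  show "smooth (\<lambda>x. complex_of_real (trial_exponent a B x))"
    unfolding e by (intro smooth_add smooth_mult[OF smooth_const] s sq)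
  have d: "(\<lambda>x. complex_of_real (smoothed_norm a x)) differentiable (at x)" "?q i differentiable (at x)" for x i
    by (rule smooth_differentiable[OF s(1)] smooth_differentiable[OF sq])+
  have cd: "(\<lambda>x. c * f x) differentiable (at x)" if "f differentiable (at x)" for c and f :: wavefunction and x
    using that by (intro differentiable_mult) auto
  have "partial_deriv j (\<lambda>x. complex_of_real (trial_exponent a B x)) x =
      complex_of_real a * complex_of_real (x $ j / smoothed_norm a x) + ?c 1 * (if 1 = j then complex_of_real (2 * x $ j) else 0)
      + ?c 2 * (if 2 = j then complex_of_real (2 * x $ j) else 0) + ?c 3 * (if 3 = j then complex_of_real (2 * x $ j) else 0)"
    unfolding e
    by (simp only: partial_deriv_add differentiable_add cd d partial_deriv_cmult s(2) dq)
  also have "\<dots> = complex_of_real (trial_slope a B j x)"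
    using exhaust_3[of j] by (auto simp: trial_slope_def algebra_simps)
  finally show "partial_deriv j (\<lambda>x. complex_of_real (trial_exponent a B x)) x = complex_of_real (trial_slope a B j x)" .
  have e': "(\<lambda>x. complex_of_real (trial_slope a B j x)) =
     (\<lambda>x. complex_of_real (x $ j) * (complex_of_real a * complex_of_real (1 / smoothed_norm a x) + complex_of_real (landau_coeff B j)))"
    by (simp add: fun_eq_iff trial_slope_def)
  have d3: "(\<lambda>x. complex_of_real (1 / smoothed_norm a x)) differentiable (at x)" "(\<lambda>x. complex_of_real (x $ j)) differentiable (at x)"
      "(\<lambda>_. complex_of_real (landau_coeff B j)) differentiable (at x)" for x :: "real^3"
    by (rule smooth_differentiable[OF s(3)] smooth_differentiable[OF smooth_coord] smooth_differentiable[OF smooth_const])+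
  have "partial_deriv j (\<lambda>x. complex_of_real (trial_slope a B j x)) x =
      1 * (complex_of_real a * complex_of_real (1 / smoothed_norm a x) + complex_of_real (landau_coeff B j))
      + complex_of_real (x $ j) * (complex_of_real a * complex_of_real (- (x $ j) / smoothed_norm a x ^ 3) + 0)"
    unfolding e'
    by (simp only: partial_deriv_mult partial_deriv_add differentiable_add cd d3 partial_deriv_cmult s(4)
        partial_deriv_const partial_deriv_coord simp_thms if_True)
  also have "\<dots> = complex_of_real (trial_curvature a B j x)"
    by (simp add: trial_curvature_def power2_eq_square)
  finally show "partial_deriv j (\<lambda>x. complex_of_real (trial_slope a B j x)) x = complex_of_real (trial_curvature a B j x)" .
qed

text \<open>The local energy of the untruncated trial function. The squares of the Landau slopes cancel the
  diamagnetic term, their second derivatives contribute \<open>B / 2\<close>, and the cross term with the radial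
  slope has the favourable sign; what is left is the smoothed Coulomb inequality.\<close>

lemma trial_local_energy_le:
  assumes a: "0 < a" "a < 1" and B: "B \<ge> 0" and x: "x \<noteq> 0"
  shows "(\<Sum>j\<in>UNIV. trial_curvature a B j x - (trial_slope a B j x)\<^sup>2 + (((1/2) *\<^sub>R cross3 x (B *\<^sub>R axis 3 1)) $ j)\<^sup>2) / 2
    - 1 / norm x \<le> B / 2 - a\<^sup>2 / 2"
proof -
  define s where "s = smoothed_norm a x"
  define r where "r = norm x"
  define \<rho> where "\<rho> = (x $ 1)\<^sup>2 + (x $ 2)\<^sup>2"
  define e where "e = 2 * (1 - a)"
  have s: "s > 0" "s\<^sup>2 = r\<^sup>2 + e\<^sup>2"
    using smoothed_norm_facts[OF a, of x] by (simp_all add: s_def r_def e_def)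
  have r: "r > 0" "r\<^sup>2 = \<rho> + (x $ 3)\<^sup>2"
    using x norm_power2_3[of x] by (simp_all add: r_def \<rho>_def sum_3)
  have r2: "r\<^sup>2 = s\<^sup>2 - e\<^sup>2" using s by simp
  have "(\<Sum>j\<in>UNIV. trial_curvature a B j x - (trial_slope a B j x)\<^sup>2 + (((1/2) *\<^sub>R cross3 x (B *\<^sub>R axis 3 1)) $ j)\<^sup>2)
      = 3 * a / s + B - a * r\<^sup>2 / s ^ 3 - a\<^sup>2 * r\<^sup>2 * (1 / s)\<^sup>2 - a * B * \<rho> * (1 / s)"
    unfolding sum_3 vector_potential_axis trial_curvature_def trial_slope_def s_def[symmetric] landau_coeff_def r(2) \<rho>_def
    by (simp add: power2_eq_square algebra_simps add_divide_distrib diff_divide_distrib)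
  also have "\<dots> \<le> 3 * a / s + B - a * r\<^sup>2 / s ^ 3 - a\<^sup>2 * r\<^sup>2 * (1 / s)\<^sup>2"
    using a B s by (simp add: \<rho>_def)
  also have "\<dots> = B - a\<^sup>2 + 2 * (a / s + a * e\<^sup>2 / (2 * s ^ 3) + a\<^sup>2 * e\<^sup>2 / (2 * s\<^sup>2))"
    unfolding r2 using s(1) by (simp add: field_simps power2_eq_square power3_eq_cube)
  also have "\<dots> \<le> B - a\<^sup>2 + 2 * (1 / r)"
    using smoothed_coulomb_inequality[OF a r(1) s(1)] s(2) unfolding e_def by simp
  finally show ?thesis unfolding r_def by simp
qed

definition cutoff :: "real \<Rightarrow> real^3 \<Rightarrow> real" where
  "cutoff R x = bump 0 (1 - (norm x)\<^sup>2 / R\<^sup>2)"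

definition trial :: "real \<Rightarrow> real \<Rightarrow> real \<Rightarrow> wavefunction" where
  "trial a B R x = complex_of_real (cutoff R x * exp (- trial_exponent a B x))"

definition cutoff_slope :: "real \<Rightarrow> 3 \<Rightarrow> real^3 \<Rightarrow> real" where
  "cutoff_slope R j x = bump (Suc 0) (1 - (norm x)\<^sup>2 / R\<^sup>2) * (- 2 * x $ j / R\<^sup>2)"

lemma cutoff_derivs:
  shows "smooth (\<lambda>x. complex_of_real (cutoff R x))"
    and "partial_deriv j (\<lambda>x. complex_of_real (cutoff R x)) x = complex_of_real (cutoff_slope R j x)"
proof -
  let ?p = "\<lambda>x::real^3. 1 - (norm x)\<^sup>2 / R\<^sup>2"
  have e: "(\<lambda>x. complex_of_real (?p x)) = (\<lambda>x. 1 + complex_of_real (- 1 / R\<^sup>2) * complex_of_real ((norm x)\<^sup>2))"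
    by (simp add: fun_eq_iff)
  have sp: "smooth (\<lambda>x. complex_of_real (?p x))"
    unfolding e by (intro smooth_add smooth_const smooth_mult smooth_power2_norm)
  have dp: "partial_deriv j (\<lambda>x. complex_of_real (?p x)) x = complex_of_real (- 2 * x $ j / R\<^sup>2)" for j x
    unfolding e
      partial_deriv_add[OF smooth_differentiable[OF smooth_const] smooth_differentiable[OF smooth_mult[OF smooth_const smooth_power2_norm]]]
      partial_deriv_cmult[OF smooth_differentiable[OF smooth_power2_norm]] partial_deriv_power2_norm partial_deriv_const
    by simp
  show "smooth (\<lambda>x. complex_of_real (cutoff R x))"
    unfolding cutoff_def by (rule smooth_bump[OF sp])
  show "partial_deriv j (\<lambda>x. complex_of_real (cutoff R x)) x = complex_of_real (cutoff_slope R j x)"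
    unfolding cutoff_def of_real_comp_chain(2)[OF smooth_differentiable[OF sp] bump_has_derivative] dp
    by (simp add: cutoff_slope_def)
qed

lemma cutoff_vanishes: "R > 0 \<Longrightarrow> norm x > R \<Longrightarrow> cutoff R x = 0"
  unfolding cutoff_def by (rule bump_bounds) (simp add: power_mono)

lemma cutoff_slope_bound:
  assumes R: "R > 0"
  shows "(\<Sum>j\<in>UNIV. (cutoff_slope R j x)\<^sup>2) \<le> 16 / R\<^sup>2 * indicator (cball 0 R) x"
proof (cases "norm x \<le> R")
  case True
  let ?b = "bump (Suc 0) (1 - (norm x)\<^sup>2 / R\<^sup>2)"
  have "?b\<^sup>2 \<le> 2\<^sup>2" using bump_bounds(3)[of "1 - (norm x)\<^sup>2 / R\<^sup>2"] by (metis abs_ge_zero power2_abs power_mono)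
  moreover have "(norm x)\<^sup>2 \<le> R\<^sup>2" using True by (intro power_mono) auto
  ultimately have "?b\<^sup>2 * (norm x)\<^sup>2 * (4 / R ^ 4) \<le> 2\<^sup>2 * R\<^sup>2 * (4 / R ^ 4)"
    by (intro mult_right_mono mult_mono) auto
  moreover have "(\<Sum>j\<in>UNIV. (cutoff_slope R j x)\<^sup>2) = ?b\<^sup>2 * (norm x)\<^sup>2 * (4 / R ^ 4)"
  proof -
    define b where "b = ?b"
    show ?thesis
      unfolding cutoff_slope_def b_def[symmetric] norm_power2_3 sum_3
      by (simp add: power_mult_distrib power_divide algebra_simps add_divide_distrib flip: power_mult)
  qed
  moreover have "2\<^sup>2 * R\<^sup>2 * (4 / R ^ 4) = 16 / R\<^sup>2"
    using R by (simp add: power2_eq_square power4_eq_xxxx)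
  ultimately show ?thesis using True by simp
next
  case False
  then have "1 - (norm x)\<^sup>2 / R\<^sup>2 \<le> 0" using R by (simp add: power_mono)
  then show ?thesis using False by (simp add: cutoff_slope_def bump_bounds(4))
qed

lemma trial_test:
  assumes a: "0 < a" "a < 1" and R: "R > 0"
  shows "trial a B R \<in> test_functions"
proof -
  have "smooth (\<lambda>x. complex_of_real (- trial_exponent a B x))"
    using smooth_mult[OF smooth_const[of "- 1"] trial_exponent_derivs(1)[OF a]] by simp
  then have "smooth (trial a B R)"
    unfolding trial_def[abs_def] of_real_mult by (intro smooth_mult cutoff_derivs smooth_exp)
  then show ?thesis
    unfolding test_function_iff using cutoff_vanishes[OF R] by (auto simp: trial_def)
qed

lemma trial_energy:
  assumes a: "0 < a" "a < 1" and R: "R > 0" and B: "B \<ge> 0"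
  shows "energy (B *\<^sub>R axis 3 1) (trial a B R) \<le> (B / 2 - a\<^sup>2 / 2) * sqnorm (trial a B R)
    + 8 / R\<^sup>2 * (LINT x|lborel. indicator (cball 0 R) x * (exp (- trial_exponent a B x))\<^sup>2)"
proof -
  let ?Bv = "B *\<^sub>R axis 3 1 :: real^3"
  let ?u = "trial a B R"
  let ?\<phi>2 = "\<lambda>x. (exp (- trial_exponent a B x))\<^sup>2"
  let ?A = "\<lambda>j x. ((1/2) *\<^sub>R cross3 x ?Bv) $ j"
  define w where "w j x = ((cutoff_slope R j x)\<^sup>2 + (trial_curvature a B j x - (trial_slope a B j x)\<^sup>2 + (?A j x)\<^sup>2) * (cutoff R x)\<^sup>2) * ?\<phi>2 x" for j x
  note trunc = sqnorm_kinetic_momentum_truncated[OF cutoff_derivs(1) trial_exponent_derivs(1)[OF a] cutoff_vanishes[OF R]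
    cutoff_derivs(2) trial_exponent_derivs(2,3)[OF a]]
  have w: "integrable lborel (w j)" for j
    unfolding w_def[abs_def] by (rule trunc(1))
  have Kw: "sqnorm (kinetic_momentum ?Bv j ?u) = (LINT x|lborel. w j x)" for j
    unfolding w_def trial_def[abs_def] by (rule trunc(2))
  have u: "?u \<in> test_functions" by (rule trial_test[OF a R])
  have u2: "(cmod (?u x))\<^sup>2 = (cutoff R x)\<^sup>2 * ?\<phi>2 x" for x
    by (simp add: trial_def norm_mult power_mult_distrib)
  have int\<phi>: "integrable lborel (\<lambda>x. indicator (cball 0 R) x * ?\<phi>2 x)"
  proof -
    have "continuous_on UNIV (\<lambda>x. complex_of_real (trial_exponent a B x))"
      by (rule smooth_continuous[OF trial_exponent_derivs(1)[OF a]])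
    from continuous_on_Re[OF this] have "continuous_on UNIV (trial_exponent a B)" by simp
    then have "continuous_on (cball 0 R) ?\<phi>2"
      by (intro continuous_intros) (auto intro: continuous_on_subset)
    from borel_integrable_compact[OF compact_cball this] show ?thesis by simp
  qed
  have intu: "integrable lborel (\<lambda>x. (cmod (?u x))\<^sup>2)" by (rule L2_D[OF test_L2[OF u]])
  have "energy ?Bv ?u = (LINT x|lborel. (\<Sum>j\<in>UNIV. w j x) / 2 - (cmod (?u x))\<^sup>2 / norm x)"
    unfolding energy_def kinetic_energy_def coulomb_energy_def Kw
    using w coulomb_integrable[OF u] by simp
  also have "\<dots> \<le> (LINT x|lborel. (B / 2 - a\<^sup>2 / 2) * (cmod (?u x))\<^sup>2 + 8 / R\<^sup>2 * (indicator (cball 0 R) x * ?\<phi>2 x))"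
  proof (rule integral_mono_AE)
    show "integrable lborel (\<lambda>x. (\<Sum>j\<in>UNIV. w j x) / 2 - (cmod (?u x))\<^sup>2 / norm x)"
      using w coulomb_integrable[OF u] by simp
    show "integrable lborel (\<lambda>x. (B / 2 - a\<^sup>2 / 2) * (cmod (?u x))\<^sup>2 + 8 / R\<^sup>2 * (indicator (cball 0 R) x * ?\<phi>2 x))"
      by (intro Bochner_Integration.integrable_add integrable_mult_right intu int\<phi>)
    have pt: "(\<Sum>j\<in>UNIV. w j x) / 2 - (cmod (?u x))\<^sup>2 / norm x \<le>
        (B / 2 - a\<^sup>2 / 2) * (cmod (?u x))\<^sup>2 + 8 / R\<^sup>2 * (indicator (cball 0 R) x * ?\<phi>2 x)" if "x \<noteq> 0" for x
    proof -
      let ?W = "\<Sum>j\<in>UNIV. trial_curvature a B j x - (trial_slope a B j x)\<^sup>2 + (?A j x)\<^sup>2"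
      have "(\<Sum>j\<in>UNIV. w j x) = (\<Sum>j\<in>UNIV. (cutoff_slope R j x)\<^sup>2) * ?\<phi>2 x + ?W * ((cutoff R x)\<^sup>2 * ?\<phi>2 x)"
        unfolding w_def by (simp only: sum_distrib_right[symmetric] sum.distrib mult.assoc[symmetric] distrib_right)
      then have "(\<Sum>j\<in>UNIV. w j x) / 2 - (cmod (?u x))\<^sup>2 / norm x =
          (\<Sum>j\<in>UNIV. (cutoff_slope R j x)\<^sup>2) * ?\<phi>2 x / 2 + (?W / 2 - 1 / norm x) * (cmod (?u x))\<^sup>2"
        unfolding u2 by (simp add: algebra_simps add_divide_distrib)
      also have "\<dots> \<le> (16 / R\<^sup>2 * indicator (cball 0 R) x) * ?\<phi>2 x / 2 + (B / 2 - a\<^sup>2 / 2) * (cmod (?u x))\<^sup>2"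
        by (intro add_mono divide_right_mono mult_right_mono cutoff_slope_bound[OF R] trial_local_energy_le[OF a B that]) auto
      finally show ?thesis by (simp add: algebra_simps)
    qed
    have "AE x in lborel. x \<noteq> (0 :: real^3)" by (rule AE_lborel_singleton)
    then show "AE x in lborel. (\<Sum>j\<in>UNIV. w j x) / 2 - (cmod (?u x))\<^sup>2 / norm x \<le>
        (B / 2 - a\<^sup>2 / 2) * (cmod (?u x))\<^sup>2 + 8 / R\<^sup>2 * (indicator (cball 0 R) x * ?\<phi>2 x)"
      by eventually_elim (rule pt)
  qed
  also have "\<dots> = (B / 2 - a\<^sup>2 / 2) * sqnorm ?u + 8 / R\<^sup>2 * (LINT x|lborel. indicator (cball 0 R) x * ?\<phi>2 x)"
    unfolding sqnorm_def
    by (subst Bochner_Integration.integral_add[OF integrable_mult_right[OF intu] integrable_mult_right[OF int\<phi>]])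
      (simp only: integral_mult_right_zero)
  finally show ?thesis .
qed

text \<open>If a lower bound \<open>e\<close> exceeded \<open>B / 2 - a\<^sup>2 / 2\<close> by \<open>\<delta>\<close>, the localization error of every truncated trial
  function would be at least \<open>\<delta>\<close> times its squared norm. That error is \<open>8 / R\<^sup>2\<close> times the mass of
  \<open>\<phi>\<^sup>2\<close> in the ball of radius \<open>R\<close>. The mass within \<open>R / 2\<close> is comparable to the squared norm, and the
  mass outside is exponentially small, so a large \<open>R\<close> gives a contradiction.\<close>

lemma energy_infimum_le:
  assumes B: "B \<ge> 0"
    and le: "\<And>u. u \<in> test_functions \<Longrightarrow> e * sqnorm u \<le> energy (B *\<^sub>R axis 3 1) u"
  shows "e \<le> - 1 / 2 + B / 2"
proof -
  have key: "e \<le> B / 2 - a\<^sup>2 / 2" if a: "0 < a" "a < 1" for a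
  proof (rule ccontr)
    assume "\<not> e \<le> B / 2 - a\<^sup>2 / 2"
    define \<delta> where "\<delta> = e - (B / 2 - a\<^sup>2 / 2)"
    have \<delta>: "\<delta> > 0" using \<open>\<not> e \<le> B / 2 - a\<^sup>2 / 2\<close> by (simp add: \<delta>_def)
    define M where "M = sqrt (1 + (2 * (1 - a))\<^sup>2) + B / 4"
    let ?v = "unit_ball_vol 3"
    let ?E = "exp (8 / 3) :: real"
    let ?\<phi>2 = "\<lambda>x. (exp (- trial_exponent a B x))\<^sup>2"
    define \<kappa> where "\<kappa> = exp (- 2 * M) * ?v"
    have v: "?v > 0" by simp
    have \<kappa>: "\<kappa> > 0" using v by (simp add: \<kappa>_def)
    have vol: "measure lborel (cball (0::real^3) R) = ?v * R ^ 3" if "R \<ge> 0" for R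
      using content_cball[OF that, of "0::real^3"] by simp
    have ind: "integrable lborel (\<lambda>x::real^3. indicator (cball 0 R) x * c :: real)" for R c :: real
      using emeasure_lborel_cball_finite[of "0::real^3" R] by (intro integrable_mult_left integrable_real_indicator) auto
    \<comment> \<open>\<open>M\<close> bounds the exponent on the unit ball, so \<open>\<kappa>\<close> is a lower bound for the mass there; \<open>?E\<close> is
      the inverse square of the least value of the cutoff on the ball of radius \<open>R / 2\<close>.\<close>
    have main: "\<delta> / 2 * (\<kappa> / ?E) \<le> 16 * ?v / (a\<^sup>2 * R)" if R: "R \<ge> 2" "16 * ?E / \<delta> \<le> R" for R
    proof -
      let ?u = "trial a B R"
      have R0: "R > 0" using R by simp
      have u: "?u \<in> test_functions" by (rule trial_test[OF a R0])
      have intu: "integrable lborel (\<lambda>x. (cmod (?u x))\<^sup>2)" by (rule L2_D[OF test_L2[OF u]])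
      have u2: "(cmod (?u x))\<^sup>2 = (cutoff R x)\<^sup>2 * ?\<phi>2 x" for x
        by (simp add: trial_def norm_mult power_mult_distrib)
      have inner: "?\<phi>2 x \<le> ?E * (cmod (?u x))\<^sup>2" if "norm x \<le> R / 2" for x
      proof -
        have "(norm x)\<^sup>2 \<le> (R / 2)\<^sup>2" using that by (intro power_mono) auto
        then have "3 / 4 \<le> 1 - (norm x)\<^sup>2 / R\<^sup>2" using R0 by (simp add: field_simps power2_eq_square)
        then have "exp (- (4 / 3)) \<le> cutoff R x" unfolding cutoff_def by (rule bump_bounds)
        then have "(exp (- (4 / 3)))\<^sup>2 \<le> (cutoff R x)\<^sup>2" by (intro power_mono) auto
        then have "exp (- (8 / 3)) \<le> (cutoff R x)\<^sup>2" by (simp flip: exp_double)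
        then have "exp (8 / 3) * exp (- (8 / 3)) \<le> ?E * (cutoff R x)\<^sup>2" by (intro mult_left_mono) auto
        then have "1 \<le> ?E * (cutoff R x)\<^sup>2" by (simp flip: exp_add)
        then have "1 * ?\<phi>2 x \<le> ?E * (cutoff R x)\<^sup>2 * ?\<phi>2 x" by (intro mult_right_mono) auto
        then show ?thesis unfolding u2 by simp
      qed
      have outer: "?\<phi>2 x \<le> exp (- (a * R))" if "norm x \<ge> R / 2" for x
      proof -
        have "a * (R / 2) \<le> a * smoothed_norm a x"
          using smoothed_norm_facts(3)[OF a, of x] that a by (intro mult_left_mono) auto
        also have "\<dots> \<le> trial_exponent a B x"
          unfolding trial_exponent_def using B by (auto simp: landau_coeff_def intro!: sum_nonneg)
        finally show ?thesis by (simp flip: exp_double)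
      qed
      have lower: "indicator (cball 0 1) x * exp (- 2 * M) \<le> ?E * (cmod (?u x))\<^sup>2" for x
      proof (cases "norm x \<le> 1")
        case True
        have n: "(norm x)\<^sup>2 \<le> 1" using True by (simp add: power_le_one)
        have "smoothed_norm a x \<le> sqrt (1 + (2 * (1 - a))\<^sup>2)"
          unfolding smoothed_norm_def using n by simp
        then have "a * smoothed_norm a x \<le> 1 * sqrt (1 + (2 * (1 - a))\<^sup>2)"
          using a smoothed_norm_facts(1)[OF a, of x] by (intro mult_mono) auto
        moreover have "(\<Sum>j\<in>UNIV. landau_coeff B j * (x $ j)\<^sup>2) \<le> (\<Sum>j\<in>UNIV. B / 2 * (x $ j)\<^sup>2)"
          using B by (intro sum_mono mult_right_mono) (auto simp: landau_coeff_def)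
        moreover have "\<dots> = B / 2 * (norm x)\<^sup>2" unfolding norm_power2_3 by (rule sum_distrib_left[symmetric])
        moreover have "\<dots> \<le> B / 2 * 1" using n B by (intro mult_left_mono) auto
        ultimately have "trial_exponent a B x \<le> M" unfolding trial_exponent_def M_def by linarith
        then have "exp (- 2 * M) \<le> ?\<phi>2 x" by (simp flip: exp_double)
        also have "\<dots> \<le> ?E * (cmod (?u x))\<^sup>2" using True R by (intro inner) auto
        finally show ?thesis using True by simp
      qed simp
      have "(LINT x|lborel. indicator (cball (0::real^3) 1) x * exp (- 2 * M)) \<le> (LINT x|lborel. ?E * (cmod (?u x))\<^sup>2)"
        by (intro integral_mono ind integrable_mult_right intu lower)
      then have low: "\<kappa> / ?E \<le> sqnorm ?u"
        unfolding sqnorm_def \<kappa>_def using vol[of 1] by (simp add: field_simps)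
      have "(LINT x|lborel. indicator (cball 0 R) x * ?\<phi>2 x) \<le>
          (LINT x|lborel. ?E * (cmod (?u x))\<^sup>2 + indicator (cball 0 R) x * exp (- (a * R)))"
      proof (rule integral_mono')
        show "integrable lborel (\<lambda>x. ?E * (cmod (?u x))\<^sup>2 + indicator (cball 0 R) x * exp (- (a * R)))"
          by (intro Bochner_Integration.integrable_add ind integrable_mult_right intu)
        fix x :: "real^3"
        show "0 \<le> ?E * (cmod (?u x))\<^sup>2 + indicator (cball 0 R) x * exp (- (a * R))" by simp
        show "indicator (cball 0 R) x * ?\<phi>2 x \<le> ?E * (cmod (?u x))\<^sup>2 + indicator (cball 0 R) x * exp (- (a * R))"
          using inner[of x] outer[of x]
          by (cases "norm x \<le> R / 2") (auto simp: indicator_def add_increasing add_increasing2)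
      qed
      also have "\<dots> = ?E * sqnorm ?u + ?v * R ^ 3 * exp (- (a * R))"
        unfolding sqnorm_def using vol[of R] R0
        by (subst Bochner_Integration.integral_add[OF integrable_mult_right[OF intu] ind]) simp
      finally have up: "(LINT x|lborel. indicator (cball 0 R) x * ?\<phi>2 x) \<le> ?E * sqnorm ?u + ?v * R ^ 3 * exp (- (a * R))" .
      have "\<delta> * sqnorm ?u \<le> 8 / R\<^sup>2 * (LINT x|lborel. indicator (cball 0 R) x * ?\<phi>2 x)"
        using order_trans[OF le[OF u] trial_energy[OF a R0 B]] by (simp add: \<delta>_def algebra_simps)
      also have "\<dots> \<le> 8 / R\<^sup>2 * (?E * sqnorm ?u + ?v * R ^ 3 * exp (- (a * R)))"
        by (intro mult_left_mono up) simp
      also have "\<dots> = 8 * ?E / R\<^sup>2 * sqnorm ?u + 8 * ?v * (R * exp (- (a * R)))"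
        using R0 by (simp add: field_simps power2_eq_square power3_eq_cube)
      also have "8 * ?E / R\<^sup>2 * sqnorm ?u \<le> \<delta> / 2 * sqnorm ?u"
      proof (intro mult_right_mono sqnorm_nonneg)
        have "16 * ?E \<le> \<delta> * R" using R \<delta> by (simp add: field_simps)
        also have "\<dots> \<le> \<delta> * R\<^sup>2" using R \<delta> by (intro mult_left_mono) (auto simp: power2_eq_square)
        finally show "8 * ?E / R\<^sup>2 \<le> \<delta> / 2" using R0 by (simp add: field_simps)
      qed
      also have "R * exp (- (a * R)) \<le> 2 / (a\<^sup>2 * R)"
      proof -
        have "(a * R)\<^sup>2 / 2 \<le> exp (a * R)"
          using exp_lower_Taylor_quadratic[of "a * R"] a R0 by (smt (verit) mult_nonneg_nonneg)
        then show ?thesis using a R0 by (simp add: exp_minus field_simps power2_eq_square)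
      qed
      finally have "\<delta> / 2 * sqnorm ?u \<le> 8 * ?v * (2 / (a\<^sup>2 * R))"
        using v by (simp add: mult_left_mono)
      moreover have "\<delta> / 2 * (\<kappa> / ?E) \<le> \<delta> / 2 * sqnorm ?u" using \<delta> by (intro mult_left_mono low) auto
      ultimately show ?thesis by simp
    qed
    define c where "c = \<delta> / 2 * (\<kappa> / ?E)"
    have c: "c > 0" using \<delta> \<kappa> by (simp add: c_def)
    define R where "R = max (max 2 (16 * ?E / \<delta>)) (32 * ?v / (a\<^sup>2 * c))"
    have R: "R \<ge> 2" "16 * ?E / \<delta> \<le> R" "32 * ?v / (a\<^sup>2 * c) \<le> R" by (simp_all add: R_def)
    have "c \<le> 16 * ?v / (a\<^sup>2 * R)" using main[OF R(1,2)] by (simp add: c_def)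
    then have "c * (a\<^sup>2 * R) \<le> 16 * ?v" using a R(1) by (simp add: field_simps)
    moreover have "32 * ?v \<le> c * (a\<^sup>2 * R)" using R(3) a c by (simp add: field_simps)
    ultimately show False using v by linarith
  qed
  have "((\<lambda>a. B / 2 - a\<^sup>2 / 2) \<longlongrightarrow> B / 2 - 1\<^sup>2 / 2) (at_left (1::real))"
    by (intro tendsto_intros) simp
  moreover have "eventually (\<lambda>a. e \<le> B / 2 - a\<^sup>2 / 2) (at_left (1::real))"
    using eventually_at_left_real[of 0 "1::real"] by (auto elim!: eventually_mono intro: key)
  ultimately have "e \<le> B / 2 - 1\<^sup>2 / 2"
    by (intro tendsto_lowerbound) auto
  then show ?thesis by simp
qed

section \<open>Minimizing the energy\<close>

lemma energy_add:
  assumes f: "f \<in> test_functions" and g: "g \<in> test_functions"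
  shows "energy Bv (\<lambda>x. f x + c * g x) =
    energy Bv f + 2 * Re (c * L2_inner f (zeeman_expression Bv g)) + (cmod c)\<^sup>2 * energy Bv g"
proof -
  let ?H = "zeeman_expression Bv"
  have L2: "f \<in> L2" "g \<in> L2" "?H f \<in> L2" "?H g \<in> L2"
    using f g by (auto intro: test_L2 zeeman_L2)
  have "complex_of_real (energy Bv (\<lambda>x. f x + c * g x)) = L2_inner (\<lambda>x. f x + c * g x) (\<lambda>x. ?H f x + c * ?H g x)"
    unfolding L2_inner_zeeman_self[OF test_add[OF f g], symmetric] zeeman_linear[OF f g] ..
  also have "\<dots> = L2_inner f (?H f) + cnj c * L2_inner g (?H f) + c * (L2_inner f (?H g) + cnj c * L2_inner g (?H g))"
    by (simp only: L2_inner_add_right[OF L2_add[OF L2(1,2)] L2(3,4)] L2_inner_add_left[OF L2(1,2,3)] L2_inner_add_left[OF L2(1,2,4)])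
  also have "\<dots> = complex_of_real (energy Bv f) + (c * L2_inner f (?H g) + cnj (c * L2_inner f (?H g))) + c * cnj c * complex_of_real (energy Bv g)"
    unfolding L2_inner_zeeman_self[OF f] L2_inner_zeeman_self[OF g] zeeman_symmetric[OF f g]
    by (simp add: algebra_simps)
  also have "\<dots> = complex_of_real (energy Bv f + 2 * Re (c * L2_inner f (?H g)) + (cmod c)\<^sup>2 * energy Bv g)"
    unfolding complex_add_cnj of_real_add of_real_mult complex_norm_square ..
  finally show ?thesis unfolding of_real_eq_iff .
qed

lemma sqnorm_add:
  assumes L2: "f \<in> L2" "g \<in> L2"
  shows "sqnorm (\<lambda>x. f x + c * g x) = sqnorm f + 2 * Re (c * L2_inner f g) + (cmod c)\<^sup>2 * sqnorm g"
proof -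
  have "complex_of_real (sqnorm (\<lambda>x. f x + c * g x)) = L2_inner f f + cnj c * L2_inner g f + c * (L2_inner f g + cnj c * L2_inner g g)"
    unfolding L2_inner_self[symmetric]
    by (simp only: L2_inner_add_right[OF L2_add[OF L2] L2] L2_inner_add_left[OF L2 L2(1)] L2_inner_add_left[OF L2 L2(2)])
  also have "\<dots> = complex_of_real (sqnorm f) + (c * L2_inner f g + cnj (c * L2_inner f g)) + c * cnj c * complex_of_real (sqnorm g)"
    unfolding L2_inner_self L2_inner_cnj[of g f] by (simp add: algebra_simps)
  also have "\<dots> = complex_of_real (sqnorm f + 2 * Re (c * L2_inner f g) + (cmod c)\<^sup>2 * sqnorm g)"
    unfolding complex_add_cnj of_real_add of_real_mult complex_norm_square ..
  finally show ?thesis unfolding of_real_eq_iff .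
qed

lemma zero_test: "(\<lambda>_. 0) \<in> test_functions"
  unfolding test_function_iff by (auto intro: smooth_const)

lemma energy_cmult:
  assumes g: "g \<in> test_functions"
  shows "energy Bv (\<lambda>x. c * g x) = (cmod c)\<^sup>2 * energy Bv g"
proof -
  have "complex_of_real (energy Bv (\<lambda>_. 0)) = 0"
    unfolding L2_inner_zeeman_self[OF zero_test, symmetric] by (simp add: L2_inner_def)
  then show ?thesis
    using energy_add[OF zero_test g, of Bv c] by (simp add: L2_inner_def)
qed

lemma sqnorm_cmult: "sqnorm (\<lambda>x. c * g x) = (cmod c)\<^sup>2 * sqnorm g"
  unfolding sqnorm_def by (simp add: norm_mult power_mult_distrib)

lemma energy_lower_bound:
  assumes "f \<in> test_functions"
  shows "energy Bv f \<ge> - 17 * sqnorm f"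
  using kinetic_energy_le_energy[OF assms, of Bv] kinetic_energy_nonneg[of Bv f] by linarith

definition unit_energies :: "real^3 \<Rightarrow> real set" where
  "unit_energies Bv = {energy Bv u | u. u \<in> test_functions \<and> sqnorm u = 1}"

lemma unit_energies_bdd: "bdd_below (unit_energies Bv)"
  unfolding unit_energies_def using energy_lower_bound by (intro bdd_belowI[of _ "- 17"]) fastforce

lemma Inf_unit_energies_le:
  assumes u: "u \<in> test_functions"
  shows "Inf (unit_energies Bv) * sqnorm u \<le> energy Bv u"
proof (cases "sqnorm u = 0")
  case True
  then show ?thesis using energy_lower_bound[OF u, of Bv] by simp
next
  case False
  then have pos: "sqnorm u > 0" using sqnorm_nonneg[of u] by simp
  define c where "c = complex_of_real (1 / sqrt (sqnorm u))"
  have c: "(cmod c)\<^sup>2 = 1 / sqnorm u" using pos by (simp add: c_def norm_divide power_divide)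
  have "(\<lambda>x. c * u x) \<in> test_functions" by (intro test_mult smooth_const u)
  moreover have "sqnorm (\<lambda>x. c * u x) = 1" using c pos by (simp add: sqnorm_cmult)
  ultimately have "energy Bv (\<lambda>x. c * u x) \<in> unit_energies Bv" unfolding unit_energies_def by blast
  then have "Inf (unit_energies Bv) \<le> energy Bv (\<lambda>x. c * u x)"
    by (rule cInf_lower[OF _ unit_energies_bdd])
  then show ?thesis using c pos by (simp add: energy_cmult[OF u] field_simps)
qed

text \<open>If all test functions had norm 0, then every real number, in particular 0 for \<open>B = 0\<close>, would be a
  lower bound of the energy, against the upper bound for such numbers.\<close>

lemma unit_energies_nonempty: "unit_energies Bv \<noteq> {}"
proof -
  have "\<exists>u\<in>test_functions. sqnorm u \<noteq> 0"
  proof (rule ccontr)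
    assume "\<not> ?thesis"
    then have "0 * sqnorm u \<le> energy (0 *\<^sub>R axis 3 1) u" if "u \<in> test_functions" for u
      using energy_lower_bound[OF that, of "0 *\<^sub>R axis 3 1"] that by auto
    from energy_infimum_le[OF order_refl this] show False by simp
  qed
  then obtain u where u: "u \<in> test_functions" "sqnorm u > 0"
    using sqnorm_nonneg by (metis less_eq_real_def)
  define c where "c = complex_of_real (1 / sqrt (sqnorm u))"
  have "(cmod c)\<^sup>2 * sqnorm u = 1" using u by (simp add: c_def norm_divide power_divide)
  then have "(\<lambda>x. c * u x) \<in> test_functions \<and> sqnorm (\<lambda>x. c * u x) = 1"
    using u by (simp add: sqnorm_cmult test_mult smooth_const)
  then show ?thesis unfolding unit_energies_def by blast
qed

text \<open>The Cauchy--Schwarz inequality for the nonnegative form \<open>energy - e\<close>: almost minimizers satisfy the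
  eigenvalue equation weakly, up to a small error.\<close>

lemma weak_eigenvalue_equation_error:
  fixes e :: real
  assumes e: "\<And>u. u \<in> test_functions \<Longrightarrow> e * sqnorm u \<le> energy Bv u"
    and f: "f \<in> test_functions" and g: "g \<in> test_functions"
  shows "(cmod (L2_inner f (zeeman_expression Bv g) - e * L2_inner f g))\<^sup>2
    \<le> (energy Bv f - e * sqnorm f) * (energy Bv g - e * sqnorm g + 1)"
proof -
  define \<beta> where "\<beta> = L2_inner f (zeeman_expression Bv g) - e * L2_inner f g"
  define q where "q = energy Bv g - e * sqnorm g"
  \<comment> \<open>The form is evaluated at \<open>f + c g\<close>, with the phase of \<open>c\<close> chosen to make the mixed term negative.
    The summand 1 in \<open>q + 1\<close> covers the case \<open>q = 0\<close>.\<close>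
  define s where "s = 1 / (q + 1)"
  define c where "c = - complex_of_real s * cnj \<beta>"
  have q: "q \<ge> 0" using e[OF g] by (simp add: q_def)
  have s: "s > 0" "s * (q + 1) = 1" "s * q \<le> 1" using q by (simp_all add: s_def)
  have "0 \<le> energy Bv (\<lambda>x. f x + c * g x) - e * sqnorm (\<lambda>x. f x + c * g x)"
    using e[OF test_add[OF f g]] by simp
  also have "\<dots> = (energy Bv f - e * sqnorm f) + 2 * Re (c * \<beta>) + (cmod c)\<^sup>2 * q"
    unfolding energy_add[OF f g] sqnorm_add[OF test_L2[OF f] test_L2[OF g]] \<beta>_def q_def
    by (simp add: algebra_simps)
  also have "c * \<beta> = - complex_of_real (s * (cmod \<beta>)\<^sup>2)"
    unfolding c_def of_real_mult complex_norm_square by (simp add: mult_ac)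
  also have "(cmod c)\<^sup>2 * q = s * (cmod \<beta>)\<^sup>2 * (s * q)"
    by (simp add: c_def norm_mult power_mult_distrib power2_eq_square)
  finally have "0 \<le> (energy Bv f - e * sqnorm f) - 2 * (s * (cmod \<beta>)\<^sup>2) + s * (cmod \<beta>)\<^sup>2 * (s * q)"
    by simp
  moreover have "s * (cmod \<beta>)\<^sup>2 * (s * q) \<le> s * (cmod \<beta>)\<^sup>2 * 1"
    using s by (intro mult_left_mono) auto
  ultimately have "s * (cmod \<beta>)\<^sup>2 \<le> energy Bv f - e * sqnorm f" by linarith
  then have "(q + 1) * (s * (cmod \<beta>)\<^sup>2) \<le> (q + 1) * (energy Bv f - e * sqnorm f)"
    using q by (intro mult_left_mono) auto
  moreover have "(q + 1) * (s * (cmod \<beta>)\<^sup>2) = (cmod \<beta>)\<^sup>2"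
    using s(2) by (simp add: mult.assoc[symmetric] mult.commute)
  ultimately show ?thesis unfolding \<beta>_def q_def by (simp add: mult.commute)
qed

text \<open>The gradient differs from the kinetic momentum by the vector potential, which is bounded on
  balls.\<close>

lemma local_dirichlet_bound:
  assumes f: "f \<in> test_functions" and R: "R \<ge> 0"
  shows "local_dirichlet R f \<le> ennreal (4 * kinetic_energy Bv f + 2 * (R * norm Bv)\<^sup>2 * sqnorm f)"
proof -
  let ?K = "\<lambda>j. kinetic_momentum Bv j f"
  let ?A = "\<lambda>x. (1/2) *\<^sub>R cross3 x Bv"
  have int: "integrable lborel (\<lambda>x. (cmod (?K j x))\<^sup>2)" "integrable lborel (\<lambda>x. (cmod (f x))\<^sup>2)" for j
    by (intro L2_D test_L2 kinetic_momentum_test f)+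
  have pt: "sqgrad f x \<le> 2 * (\<Sum>j\<in>UNIV. (cmod (?K j x))\<^sup>2) + 2 * (R * norm Bv)\<^sup>2 * (cmod (f x))\<^sup>2"
    if x: "norm x \<le> R" for x
  proof -
    have "(norm (?A x))\<^sup>2 \<le> (norm x * norm Bv)\<^sup>2"
    proof -
      have "(norm (cross3 x Bv))\<^sup>2 \<le> (norm x * norm Bv)\<^sup>2"
        using norm_cross_dot[of x Bv] zero_le_power2[of "x \<bullet> Bv"] by linarith
      moreover have "(norm (?A x))\<^sup>2 = (norm (cross3 x Bv))\<^sup>2 / 4" by (simp add: power_divide)
      ultimately show ?thesis using zero_le_power2[of "norm x * norm Bv"] by linarith
    qed
    also have "\<dots> \<le> (R * norm Bv)\<^sup>2" using x by (intro power_mono mult_right_mono) auto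
    finally have A: "(norm (?A x))\<^sup>2 \<le> (R * norm Bv)\<^sup>2" .
    have "(cmod (partial_deriv j f x))\<^sup>2 \<le> 2 * (cmod (?K j x))\<^sup>2 + 2 * ((?A x $ j)\<^sup>2 * (cmod (f x))\<^sup>2)" for j
    proof -
      have "- \<i> * partial_deriv j f x = ?K j x - complex_of_real (?A x $ j) * f x"
        by (simp add: kinetic_momentum_def)
      then have "cmod (partial_deriv j f x) = cmod (?K j x - complex_of_real (?A x $ j) * f x)"
        by (metis norm_mult norm_minus_cancel norm_ii mult_1)
      also have "\<dots> \<le> cmod (?K j x) + \<bar>?A x $ j\<bar> * cmod (f x)"
        using norm_triangle_ineq4[of "?K j x" "complex_of_real (?A x $ j) * f x"]
        unfolding norm_mult norm_of_real .
      finally have "(cmod (partial_deriv j f x))\<^sup>2 \<le> (cmod (?K j x) + \<bar>?A x $ j\<bar> * cmod (f x))\<^sup>2"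
        by (intro power_mono) auto
      also have "\<dots> \<le> 2 * (cmod (?K j x))\<^sup>2 + 2 * (\<bar>?A x $ j\<bar> * cmod (f x))\<^sup>2"
        using sum_squares_bound[of "cmod (?K j x)" "\<bar>?A x $ j\<bar> * cmod (f x)"] by (simp add: power2_sum)
      finally show ?thesis unfolding power_mult_distrib power2_abs .
    qed
    then have "sqgrad f x \<le> (\<Sum>j\<in>UNIV. 2 * (cmod (?K j x))\<^sup>2 + 2 * ((?A x $ j)\<^sup>2 * (cmod (f x))\<^sup>2))"
      unfolding sqgrad_def by (rule sum_mono)
    also have "\<dots> = 2 * (\<Sum>j\<in>UNIV. (cmod (?K j x))\<^sup>2) + 2 * ((norm (?A x))\<^sup>2 * (cmod (f x))\<^sup>2)"
      unfolding norm_power2_3 by (simp only: sum.distrib sum_distrib_left[symmetric] sum_distrib_right[symmetric])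
    also have "\<dots> \<le> 2 * (\<Sum>j\<in>UNIV. (cmod (?K j x))\<^sup>2) + 2 * ((R * norm Bv)\<^sup>2 * (cmod (f x))\<^sup>2)"
      using A by (intro add_left_mono mult_left_mono mult_right_mono) auto
    finally show ?thesis by (simp add: mult.assoc)
  qed
  have "local_dirichlet R f \<le> (\<integral>\<^sup>+x. ennreal (2 * (\<Sum>j\<in>UNIV. (cmod (?K j x))\<^sup>2) + 2 * (R * norm Bv)\<^sup>2 * (cmod (f x))\<^sup>2) \<partial>lborel)"
    unfolding local_dirichlet_def
    by (intro nn_integral_mono) (auto simp: indicator_def intro!: ennreal_leI pt)
  also have "\<dots> = ennreal (LINT x|lborel. 2 * (\<Sum>j\<in>UNIV. (cmod (?K j x))\<^sup>2) + 2 * (R * norm Bv)\<^sup>2 * (cmod (f x))\<^sup>2)"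
  proof (rule nn_integral_eq_integral)
    show "integrable lborel (\<lambda>x. 2 * (\<Sum>j\<in>UNIV. (cmod (?K j x))\<^sup>2) + 2 * (R * norm Bv)\<^sup>2 * (cmod (f x))\<^sup>2)"
      using int by simp
  qed (intro AE_I2 add_nonneg_nonneg mult_nonneg_nonneg sum_nonneg; simp)
  also have "(LINT x|lborel. 2 * (\<Sum>j\<in>UNIV. (cmod (?K j x))\<^sup>2) + 2 * (R * norm Bv)\<^sup>2 * (cmod (f x))\<^sup>2)
      = 4 * kinetic_energy Bv f + 2 * (R * norm Bv)\<^sup>2 * sqnorm f"
    using int unfolding kinetic_energy_def sqnorm_def by simp
  finally show ?thesis .
qed

lemma nn_integral_sqnorm:
  assumes "f \<in> L2"
  shows "(\<integral>\<^sup>+x. ennreal ((cmod (f x))\<^sup>2) \<partial>lborel) = ennreal (sqnorm f)"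
  unfolding sqnorm_def by (intro nn_integral_eq_integral L2_D assms) auto

lemma local_sqdist_eq_sqnorm:
  assumes f: "f \<in> L2" and g: "g \<in> L2"
  shows "(\<lambda>x. indicator (cball 0 R) x *\<^sub>R (f x - g x)) \<in> L2"
    and "local_sqdist R f g = ennreal (sqnorm (\<lambda>x. indicator (cball 0 R) x *\<^sub>R (f x - g x)))"
proof -
  let ?h = "\<lambda>x. indicator (cball 0 R) x *\<^sub>R (f x - g x)"
  have d: "(\<lambda>x. f x - g x) \<in> L2" using L2_add[OF f g, of "- 1"] by simp
  note [measurable] = L2_D(1)[OF d]
  show h: "?h \<in> L2"
  proof (rule L2_I)
    show "?h \<in> borel_measurable borel" by measurable
    have "(cmod (?h x))\<^sup>2 = indicator (cball 0 R) x *\<^sub>R (cmod (f x - g x))\<^sup>2" for x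
      by (simp add: indicator_def)
    then show "integrable lborel (\<lambda>x. (cmod (?h x))\<^sup>2)"
      using integrable_mult_indicator[OF _ L2_D(2)[OF d], of "cball 0 R"] by simp
  qed
  have "indicator (cball 0 R) x * ennreal ((cmod (f x - g x))\<^sup>2) = ennreal ((cmod (?h x))\<^sup>2)" for x
    by (simp add: indicator_def)
  then show "local_sqdist R f g = ennreal (sqnorm ?h)"
    unfolding local_sqdist_def nn_integral_sqnorm[OF h, symmetric] by simp
qed

lemma L2_inner_tendsto_of_local:
  assumes f: "\<And>n. f n \<in> L2" and \<psi>: "\<psi> \<in> L2" and h: "h \<in> L2"
    and supp: "\<And>x. norm x > R \<Longrightarrow> h x = 0"
    and lim: "(\<lambda>n. local_sqdist R (f n) \<psi>) \<longlonglongrightarrow> 0"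
  shows "(\<lambda>n. L2_inner (f n) h) \<longlonglongrightarrow> L2_inner \<psi> h"
proof -
  let ?d = "\<lambda>n x. indicator (cball 0 R) x *\<^sub>R (f n x - \<psi> x)"
  note d = local_sqdist_eq_sqnorm[OF f \<psi>]
  have "(\<lambda>n. ennreal (sqnorm (?d n))) \<longlonglongrightarrow> ennreal 0"
    using lim unfolding d(2) by simp
  then have "(\<lambda>n. sqnorm (?d n)) \<longlonglongrightarrow> 0"
    by (subst (asm) tendsto_ennreal_iff) (auto simp: sqnorm_nonneg)
  then have "(\<lambda>n. sqrt (sqnorm (?d n) * sqnorm h)) \<longlonglongrightarrow> sqrt (0 * sqnorm h)"
    by (intro tendsto_intros)
  then have "(\<lambda>n. sqrt (sqnorm (?d n) * sqnorm h)) \<longlonglongrightarrow> 0" by simp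
  moreover have "\<forall>\<^sub>F n in sequentially. norm (L2_inner (?d n) h) \<le> sqrt (sqnorm (?d n) * sqnorm h)"
    using Cauchy_Schwarz_L2[OF d(1) h] by (intro always_eventually allI real_le_rsqrt) auto
  ultimately have "(\<lambda>n. L2_inner (?d n) h) \<longlonglongrightarrow> 0"
    by (rule Lim_null_comparison[rotated])
  moreover have "L2_inner (?d n) h = L2_inner (f n) h - L2_inner \<psi> h" for n
  proof -
    have "L2_inner (?d n) h = L2_inner (\<lambda>x. f n x + - 1 * \<psi> x) h"
      unfolding L2_inner_def using supp by (intro Bochner_Integration.integral_cong) (auto simp: indicator_def not_le)
    then show ?thesis using L2_inner_add_left[OF f \<psi> h, of n "- 1"] by simp
  qed
  ultimately show ?thesis by (simp add: LIM_zero_iff)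
qed

text \<open>Existence of a ground state by the direct method. The Landau bound forces the Coulomb energy of
  a minimizing sequence to stay away from zero, so mass remains in a bounded region and the local
  limit does not vanish.\<close>

theorem ground_state_exists:
  assumes B: "B \<ge> 0"
  defines "Bv \<equiv> B *\<^sub>R axis 3 1 :: real^3"
  defines "e \<equiv> Inf (unit_energies Bv)"
  shows "eigenvalue (zeeman_hamiltonian Bv) (complex_of_real e)"
proof -
  have e_le: "e * sqnorm u \<le> energy Bv u" if "u \<in> test_functions" for u
    unfolding e_def by (rule Inf_unit_energies_le[OF that])
  have e_bound: "e \<le> - 1 / 2 + B / 2"
    by (rule energy_infimum_le[OF B]) (use e_le in \<open>simp add: Bv_def\<close>)
  have "\<exists>u. u \<in> test_functions \<and> sqnorm u = 1 \<and> energy Bv u < e + 1 / real (Suc n)" for n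
  proof -
    have "Inf (unit_energies Bv) < e + 1 / real (Suc n)" by (simp add: e_def)
    then obtain y where "y \<in> unit_energies Bv" "y < e + 1 / real (Suc n)"
      using cInf_lessD[OF unit_energies_nonempty] by blast
    then show ?thesis unfolding unit_energies_def by blast
  qed
  then obtain f where f: "\<And>n. f n \<in> test_functions" "\<And>n. sqnorm (f n) = 1"
    and f_energy: "\<And>n. energy Bv (f n) < e + 1 / real (Suc n)"
    by metis
  define M where "M = \<bar>2 * (e + 1) + 34\<bar> + 1"
  have M: "M > 0" by (simp add: M_def)
  have f_kin: "kinetic_energy Bv (f n) \<le> M" for n
  proof -
    have "1 / real (Suc n) \<le> 1" by simp
    then have "energy Bv (f n) \<le> e + 1" using f_energy[of n] by linarith
    then show ?thesis using kinetic_energy_le_energy[OF f(1)[of n], of Bv] f(2)[of n]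
      abs_ge_self[of "2 * (e + 1) + 34"] unfolding M_def by simp
  qed
  have dir: "local_dirichlet R (f n) \<le> ennreal (4 * M + 2 * (max R 0 * norm Bv)\<^sup>2)" for R n
  proof -
    have "local_dirichlet R (f n) \<le> local_dirichlet (max R 0) (f n)"
      unfolding local_dirichlet_def by (intro nn_integral_mono mult_right_mono) (auto simp: indicator_def)
    also have "\<dots> \<le> ennreal (4 * kinetic_energy Bv (f n) + 2 * (max R 0 * norm Bv)\<^sup>2 * sqnorm (f n))"
      by (rule local_dirichlet_bound[OF f(1)]) simp
    also have "\<dots> \<le> ennreal (4 * M + 2 * (max R 0 * norm Bv)\<^sup>2)"
      using f_kin[of n] f(2)[of n] by (intro ennreal_leI) simp
    finally show ?thesis .
  qed
  have f_C1: "times_cont_diff (Suc 0) (f n)" for n by (rule smooth_C1[OF test_smooth[OF f(1)]])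
  have f_norm: "(\<integral>\<^sup>+x. ennreal ((cmod (f n x))\<^sup>2) \<partial>lborel) \<le> 1" for n
    by (simp add: nn_integral_sqnorm test_L2 f)
  obtain \<kappa> \<psi> where \<kappa>: "strict_mono \<kappa>" and \<psi>m: "\<psi> \<in> borel_measurable borel"
    and \<psi>2: "(\<integral>\<^sup>+x. ennreal ((cmod (\<psi> x))\<^sup>2) \<partial>lborel) \<le> 2"
    and conv: "\<And>R. (\<lambda>n. local_sqdist R (f (\<kappa> n)) \<psi>) \<longlonglongrightarrow> 0"
    by (rule local_Rellich[OF f_C1 f_norm dir]) (rule that)
  have \<psi>: "\<psi> \<in> L2"
  proof (rule L2_I[OF \<psi>m integrableI_bounded])
    show "(\<lambda>x. (cmod (\<psi> x))\<^sup>2) \<in> borel_measurable lborel" using \<psi>m by measurable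
    show "(\<integral>\<^sup>+x. ennreal (norm ((cmod (\<psi> x))\<^sup>2)) \<partial>lborel) < \<infinity>"
      using le_less_trans[OF \<psi>2] by simp
  qed
  have small: "(\<lambda>n. 1 / real (Suc (\<kappa> n))) \<longlonglongrightarrow> 0"
    using LIMSEQ_subseq_LIMSEQ[OF LIMSEQ_inverse_real_of_nat \<kappa>] by (simp add: inverse_eq_divide o_def)
  have fL2: "f n \<in> L2" for n by (intro test_L2 f)
  have weak: "L2_inner \<psi> (zeeman_expression Bv g) = e * L2_inner \<psi> g" if g: "g \<in> test_functions" for g
  proof -
    obtain R where R: "\<And>x. norm x > R \<Longrightarrow> g x = 0" using test_support[OF g] by metis
    let ?b = "\<lambda>n. L2_inner (f (\<kappa> n)) (zeeman_expression Bv g) - e * L2_inner (f (\<kappa> n)) g"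
    have "?b \<longlonglongrightarrow> L2_inner \<psi> (zeeman_expression Bv g) - e * L2_inner \<psi> g"
      by (intro tendsto_diff tendsto_mult tendsto_const L2_inner_tendsto_of_local[OF fL2 \<psi> _ _ conv[of R]]
          zeeman_L2 test_L2 g R zeeman_vanishes)
    moreover have "?b \<longlonglongrightarrow> 0"
    proof (rule Lim_null_comparison)
      let ?q = "energy Bv g - e * sqnorm g + 1"
      show "\<forall>\<^sub>F n in sequentially. norm (?b n) \<le> sqrt (1 / real (Suc (\<kappa> n)) * ?q)"
      proof (intro always_eventually allI real_le_rsqrt)
        fix n
        have "(cmod (?b n))\<^sup>2 \<le> (energy Bv (f (\<kappa> n)) - e * sqnorm (f (\<kappa> n))) * ?q"
          by (rule weak_eigenvalue_equation_error[OF e_le f(1) g])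
        also have "\<dots> \<le> 1 / real (Suc (\<kappa> n)) * ?q"
          using f_energy[of "\<kappa> n"] f(2)[of "\<kappa> n"] e_le[OF g] by (intro mult_right_mono) auto
        finally show "(cmod (?b n))\<^sup>2 \<le> 1 / real (Suc (\<kappa> n)) * ?q" .
      qed
      have "(\<lambda>n. sqrt (1 / real (Suc (\<kappa> n)) * ?q)) \<longlonglongrightarrow> sqrt (0 * ?q)"
        by (intro tendsto_real_sqrt tendsto_mult tendsto_const small)
      then show "(\<lambda>n. sqrt (1 / real (Suc (\<kappa> n)) * ?q)) \<longlonglongrightarrow> 0" by simp
    qed
    ultimately have "L2_inner \<psi> (zeeman_expression Bv g) - e * L2_inner \<psi> g = 0"
      by (rule LIMSEQ_unique)
    then show ?thesis by simp
  qed
  have nonzero: "\<not> (AE x in lborel. \<psi> x = 0)"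
  proof
    assume zero: "AE x in lborel. \<psi> x = 0"
    \<comment> \<open>Radius 8 and \<open>d = 1 / (64 M)\<close> make the Hardy term and the far term of the Coulomb energy at
      most \<open>1 / 8\<close> each, so at least about \<open>1 / 4\<close> must come from the ball.\<close>
    let ?m = "\<lambda>n. LINT x|lborel. indicator (cball 0 8) x * (cmod (f (\<kappa> n) x))\<^sup>2"
    have m: "ennreal (?m n) = local_sqdist 8 (f (\<kappa> n)) \<psi>" for n
    proof -
      have "integrable lborel (\<lambda>x. indicator (cball 0 8) x * (cmod (f (\<kappa> n) x))\<^sup>2)"
        using integrable_mult_indicator[OF _ L2_D(2)[OF fL2[of "\<kappa> n"]], of "cball 0 8"] by simp
      then have "ennreal (?m n) = (\<integral>\<^sup>+x. ennreal (indicator (cball 0 8) x * (cmod (f (\<kappa> n) x))\<^sup>2) \<partial>lborel)"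
        by (intro nn_integral_eq_integral[symmetric]) auto
      also have "\<dots> = local_sqdist 8 (f (\<kappa> n)) \<psi>"
        unfolding local_sqdist_def
      proof (rule nn_integral_cong_AE)
        show "AE x in lborel. ennreal (indicator (cball 0 8) x * (cmod (f (\<kappa> n) x))\<^sup>2)
            = indicator (cball 0 8) x * ennreal ((cmod (f (\<kappa> n) x - \<psi> x))\<^sup>2)"
          using zero by eventually_elim (simp add: indicator_def)
      qed
      finally show ?thesis .
    qed
    have "(\<lambda>n. ennreal (?m n)) \<longlonglongrightarrow> ennreal 0"
      using conv[of 8] unfolding m by simp
    then have "?m \<longlonglongrightarrow> 0"
      by (subst (asm) tendsto_ennreal_iff) (auto intro!: always_eventually Bochner_Integration.integral_nonneg)
    then have lim: "(\<lambda>n. 1 / 4 + ?m n * (64 * M) + 1 / real (Suc (\<kappa> n))) \<longlonglongrightarrow> 1 / 4 + 0 * (64 * M) + 0"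
      by (intro tendsto_add tendsto_mult tendsto_const small)
    have "1 / 2 \<le> 1 / 4 + ?m n * (64 * M) + 1 / real (Suc (\<kappa> n))" for n
    proof -
      have "B / 2 \<le> kinetic_energy Bv (f (\<kappa> n))"
        using Landau_lower_bound[OF f(1), of B] f(2) by (simp add: Bv_def)
      then have "1 / 2 - 1 / real (Suc (\<kappa> n)) \<le> coulomb_energy (f (\<kappa> n))"
        using f_energy[of "\<kappa> n"] e_bound unfolding energy_def by linarith
      also have "\<dots> \<le> 8 * (1 / (64 * M)) * kinetic_energy Bv (f (\<kappa> n)) + sqnorm (f (\<kappa> n)) / 8 + ?m n / (1 / (64 * M))"
        by (rule coulomb_energy_split[OF f(1)]) (use M in auto)
      also have "8 * (1 / (64 * M)) * kinetic_energy Bv (f (\<kappa> n)) \<le> 1 / 8"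
        using f_kin[of "\<kappa> n"] M by (simp add: field_simps)
      finally show ?thesis using f(2)[of "\<kappa> n"] by simp
    qed
    then have "1 / 2 \<le> 1 / 4 + 0 * (64 * M) + (0::real)"
      by (intro LIMSEQ_le_const[OF lim]) auto
    then show False by simp
  qed
  have "(\<psi>, \<lambda>x. complex_of_real e * \<psi> x) \<in> zeeman_hamiltonian Bv"
    unfolding zeeman_hamiltonian_def adjoint_operator_def
  proof (clarsimp, intro conjI allI impI)
    show "\<psi> \<in> L2" by (rule \<psi>)
    show "(\<lambda>x. complex_of_real e * \<psi> x) \<in> L2" by (rule L2_cmult[OF \<psi>])
    fix g assume g: "g \<in> test_functions"
    have "L2_inner (\<lambda>x. complex_of_real e * \<psi> x) g = complex_of_real e * L2_inner \<psi> g"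
      unfolding L2_inner_def by (simp add: mult.assoc)
    then show "L2_inner \<psi> (zeeman_expression Bv g) = L2_inner (\<lambda>x. complex_of_real e * \<psi> x) g"
      using weak[OF g] by simp
  qed
  then show ?thesis
    unfolding eigenvalue_def using nonzero by (intro bexI[of _ "(\<psi>, \<lambda>x. complex_of_real e * \<psi> x)"]) auto
qed

theorem proposition1:
  fixes B e\<^sub>0 :: real
  assumes "B \<ge> 0"
    and "smallest_eigenvalue (zeeman_hamiltonian (B *\<^sub>R axis 3 1)) e\<^sub>0"
  shows "e\<^sub>0 \<le> - 1 / 2 + B / 2"
proof -
  let ?Bv = "B *\<^sub>R axis 3 1 :: real^3"
  have "e\<^sub>0 \<le> Inf (unit_energies ?Bv)"
    using assms(2) ground_state_exists[OF assms(1)] unfolding smallest_eigenvalue_def by blast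
  also have "\<dots> \<le> - 1 / 2 + B / 2"
    by (rule energy_infimum_le[OF assms(1)]) (rule Inf_unit_energies_le)
  finally show ?thesis .
qed

end
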